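(* Let $R$ be a standard graded polynomial ring over a field $k$, $N$ a finitely generated graded $R$-module and $I$ a homogeneous ideal of $R$. If $\dim \operatorname{Hom}_R(R/I,N)\le 1$ then $$\operatorname{reg} \operatorname{Hom}_R(R/I,N)\le \operatorname{reg} N.$$
   Context: A standard graded polynomial ring is $k[x_1,\ldots,x_n]$ with all $\deg x_i=1$; $\mathfrak m=(x_1,\ldots,x_n)$. $\operatorname{Hom}_R$ is the graded Hom module. For a finitely generated graded $R$-module $M$, the Castelnuovo-Mumford regularity is $\operatorname{reg} M=\sup\{i+j: H^i_{\mathfrak m}(M)_j\neq 0\}$, where $H^i_{\mathfrak m}$ is local cohomology with support in $\mathfrak m$, and $\operatorname{reg} 0=-\infty$. *)

theory Defs
  imports
    "HOL-Library.Poly_Mapping"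
    "HOL-Library.Extended_Real"
    "HOL-Algebra.Algebra"
begin

section \<open>The standard graded polynomial ring\<close>

text \<open>
  Monomials are exponent vectors of type \<open>nat \<Rightarrow>\<^sub>0 nat\<close>. The ring \<open>k[x\<^sub>0, \<dots>, x\<^bsub>n-1\<^esub>]\<close>
  consists of the polynomials in which only variables with index below \<open>n\<close> occur; the field
  of coefficients is the type \<open>'k\<close>.
\<close>

type_synonym 'k mpoly = "(nat \<Rightarrow>\<^sub>0 nat) \<Rightarrow>\<^sub>0 'k"

definition mpoly_ring :: "nat \<Rightarrow> 'k::field mpoly ring"
  where "mpoly_ring n =
    \<lparr>carrier = {p. \<forall>m\<in>Poly_Mapping.keys p. Poly_Mapping.keys m \<subseteq> {..<n}},
     monoid.mult = (*), one = 1, ring.zero = 0, add = (+)\<rparr>"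

definition indet :: "nat \<Rightarrow> 'k::field mpoly"
  where "indet a = Poly_Mapping.single (Poly_Mapping.single a 1) 1"

definition monomial_degree :: "(nat \<Rightarrow>\<^sub>0 nat) \<Rightarrow> nat"
  where "monomial_degree m = (\<Sum>a\<in>Poly_Mapping.keys m. Poly_Mapping.lookup m a)"

definition mpoly_hcomp :: "nat \<Rightarrow> int \<Rightarrow> 'k::field mpoly set"
  where "mpoly_hcomp n j =
    {p \<in> carrier (mpoly_ring n). \<forall>m\<in>Poly_Mapping.keys p. int (monomial_degree m) = j}"

definition homogeneous_ideal :: "nat \<Rightarrow> 'k::field mpoly set \<Rightarrow> bool"
  where "homogeneous_ideal n I \<longleftrightarrow>
    ideal I (mpoly_ring n) \<and> I = genideal (mpoly_ring n) {p \<in> I. \<exists>j. p \<in> mpoly_hcomp n j}"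

lemma mpoly_ring_cring: "cring (mpoly_ring n :: 'k::field mpoly ring)"
proof -
  let ?P = "\<lambda>p::'k mpoly. \<forall>m\<in>Poly_Mapping.keys p. Poly_Mapping.keys m \<subseteq> {..<n}"
  have plus: "?P (p + q)" if "?P p" "?P q" for p q
    using that keys_add[of p q] by blast
  have times: "?P (p * q)" if "?P p" "?P q" for p q
  proof
    fix m assume "m \<in> Poly_Mapping.keys (p * q)"
    then obtain a b where "m = a + b" "a \<in> Poly_Mapping.keys p" "b \<in> Poly_Mapping.keys q"
      using keys_mult[of p q] by blast
    then show "Poly_Mapping.keys m \<subseteq> {..<n}"
      using that keys_add[of a b] by blast
  qed
  have uminus: "?P (- p)" if "?P p" for p
    using that by simp
  have simps: "carrier (mpoly_ring n) = {p::'k mpoly. ?P p}"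
    "\<And>p q::'k mpoly. p \<otimes>\<^bsub>mpoly_ring n\<^esub> q = p * q"
    "\<And>p q::'k mpoly. p \<oplus>\<^bsub>mpoly_ring n\<^esub> q = p + q"
    "\<one>\<^bsub>mpoly_ring n\<^esub> = (1::'k mpoly)" "\<zero>\<^bsub>mpoly_ring n\<^esub> = (0::'k mpoly)"
    by (simp_all add: mpoly_ring_def)
  have zero_one: "?P 0" "?P 1"
    by simp_all
  show ?thesis
  proof (rule cringI)
    show "abelian_group (mpoly_ring n :: 'k mpoly ring)"
    proof (rule abelian_groupI, unfold simps mem_Collect_eq)
      fix p :: "'k mpoly"
      assume "?P p"
      then show "\<exists>q\<in>{q. ?P q}. q + p = 0"
        using uminus[of p] by (intro bexI[of _ "- p"]) simp_all
    qed (rule plus zero_one add.assoc add.commute add_0_left; assumption)+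
    show "Group.comm_monoid (mpoly_ring n :: 'k mpoly ring)"
      by (rule comm_monoidI, unfold simps mem_Collect_eq)
        (rule times zero_one mult.assoc mult.commute mult_1_left; assumption)+
  qed (simp add: simps distrib_right)
qed


section \<open>Graded modules\<close>

record ('r, 'a) gmodule = "('r, 'a) module" +
  hcomp :: "int \<Rightarrow> 'a set"

locale graded_module = module "mpoly_ring n" M
  for n :: nat and M :: "('k::field mpoly, 'a) gmodule" (structure) +
  assumes hcomp_subgroup: "subgroup (hcomp M j) (add_monoid M)"
    and hcomp_smult:
      "\<lbrakk>r \<in> mpoly_hcomp n i; x \<in> hcomp M j\<rbrakk> \<Longrightarrow> r \<odot>\<^bsub>M\<^esub> x \<in> hcomp M (i + j)"
    and decomposition:
      "x \<in> carrier M \<Longrightarrow>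
       \<exists>!c. (\<forall>j. c j \<in> hcomp M j) \<and> finite {j. c j \<noteq> \<zero>\<^bsub>M\<^esub>} \<and>
            x = (\<Oplus>\<^bsub>M\<^esub>j\<in>{j. c j \<noteq> \<zero>\<^bsub>M\<^esub>}. c j)"

definition finitely_generated ::
    "('r, 'm) ring_scheme \<Rightarrow> ('r, 'a, 'c) module_scheme \<Rightarrow> bool"
  where "finitely_generated R M \<longleftrightarrow>
    (\<exists>S. finite S \<and> S \<subseteq> carrier M \<and>
      (\<forall>x\<in>carrier M. \<exists>r\<in>S \<rightarrow> carrier R. x = (\<Oplus>\<^bsub>M\<^esub>s\<in>S. r s \<odot>\<^bsub>M\<^esub> s)))"

text \<open>
  The fields \<open>mult\<close> and \<open>one\<close> are only present because module records extend ring records;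
  they play no role for modules.
\<close>

definition quotient_gmodule ::
    "nat \<Rightarrow> 'k::field mpoly set \<Rightarrow> ('k mpoly, 'k mpoly set) gmodule"
  where "quotient_gmodule n I =
    \<lparr>carrier = carrier (mpoly_ring n Quot I), monoid.mult = monoid.mult (mpoly_ring n Quot I),
     one = one (mpoly_ring n Quot I), ring.zero = ring.zero (mpoly_ring n Quot I),
     add = add (mpoly_ring n Quot I),
     smult = (\<lambda>r U. (I +>\<^bsub>mpoly_ring n\<^esub> r) \<otimes>\<^bsub>mpoly_ring n Quot I\<^esub> U),
     hcomp = (\<lambda>j. (\<lambda>p. I +>\<^bsub>mpoly_ring n\<^esub> p) ` mpoly_hcomp n j)\<rparr>"

definition module_homs ::
    "('r, 'm) ring_scheme \<Rightarrow> ('r, 'a, 'c) module_scheme \<Rightarrow> ('r, 'b, 'd) module_scheme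
      \<Rightarrow> ('a \<Rightarrow> 'b) set"
  where "module_homs R A B =
    {f \<in> carrier A \<rightarrow>\<^sub>E carrier B.
      (\<forall>x\<in>carrier A. \<forall>y\<in>carrier A. f (x \<oplus>\<^bsub>A\<^esub> y) = f x \<oplus>\<^bsub>B\<^esub> f y) \<and>
      (\<forall>r\<in>carrier R. \<forall>x\<in>carrier A. f (r \<odot>\<^bsub>A\<^esub> x) = r \<odot>\<^bsub>B\<^esub> f x)}"

definition homs_of_degree ::
    "('r, 'm) ring_scheme \<Rightarrow> ('r, 'a) gmodule \<Rightarrow> ('r, 'b) gmodule \<Rightarrow> int \<Rightarrow> ('a \<Rightarrow> 'b) set"
  where "homs_of_degree R A B d =
    {f \<in> module_homs R A B. \<forall>j. f ` hcomp A j \<subseteq> hcomp B (j + d)}"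

text \<open>
  The graded Hom module: the finite sums of homogeneous homomorphisms. (If \<open>A\<close> is finitely
  generated these are all homomorphisms.)
\<close>

definition hom_gmodule ::
    "('r, 'm) ring_scheme \<Rightarrow> ('r, 'a) gmodule \<Rightarrow> ('r, 'b) gmodule \<Rightarrow> ('r, 'a \<Rightarrow> 'b) gmodule"
  where "hom_gmodule R A B =
    \<lparr>carrier = {f \<in> module_homs R A B.
       \<exists>D c. finite D \<and> (\<forall>d\<in>D. c d \<in> homs_of_degree R A B d) \<and>
             (\<forall>x\<in>carrier A. f x = (\<Oplus>\<^bsub>B\<^esub>d\<in>D. c d x))},
     monoid.mult = undefined, one = undefined,
     ring.zero = (\<lambda>x\<in>carrier A. \<zero>\<^bsub>B\<^esub>),
     add = (\<lambda>f g. \<lambda>x\<in>carrier A. f x \<oplus>\<^bsub>B\<^esub> g x),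
     smult = (\<lambda>r f. \<lambda>x\<in>carrier A. r \<odot>\<^bsub>B\<^esub> f x),
     hcomp = homs_of_degree R A B\<rparr>"


section \<open>Krull dimension of a module\<close>

definition annihilator :: "('r, 'm) ring_scheme \<Rightarrow> ('r, 'a, 'c) module_scheme \<Rightarrow> 'r set"
  where "annihilator R M = {r \<in> carrier R. \<forall>x\<in>carrier M. r \<odot>\<^bsub>M\<^esub> x = \<zero>\<^bsub>M\<^esub>}"

text \<open>
  The Krull dimension of \<open>R / Ann M\<close>: the supremum of the lengths \<open>l\<close> of chains
  \<open>p 0 \<subset> \<dots> \<subset> p l\<close> of prime ideals containing the annihilator. It is \<open>-\<infinity>\<close>, the
  supremum of the empty set, if \<open>M = 0\<close>.
\<close>

definition module_dim :: "('r, 'm) ring_scheme \<Rightarrow> ('r, 'a, 'c) module_scheme \<Rightarrow> ereal"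
  where "module_dim R M =
    Sup {ereal (real l) | l :: nat. \<exists>p :: nat \<Rightarrow> 'r set.
      (\<forall>i\<le>l. primeideal (p i) R \<and> annihilator R M \<subseteq> p i) \<and> (\<forall>i<l. p i \<subset> p (Suc i))}"


section \<open>Localization at a homogeneous element\<close>

text \<open>The fraction \<open>m / f\<^sup>t\<close>, as the equivalence class of all pairs \<open>(m', t')\<close> with
  \<open>m' / f\<^bsup>t'\<^esup> = m / f\<^sup>t\<close>.\<close>

definition fraction ::
    "('r, 'm) ring_scheme \<Rightarrow> ('r, 'a, 'c) module_scheme \<Rightarrow> 'r \<Rightarrow> 'a \<Rightarrow> nat \<Rightarrow> ('a \<times> nat) set"
  where "fraction R M f m t =
    {(m', t'). m' \<in> carrier M \<and>
      (\<exists>s::nat. (f [^]\<^bsub>R\<^esub> s) \<odot>\<^bsub>M\<^esub> ((f [^]\<^bsub>R\<^esub> t') \<odot>\<^bsub>M\<^esub> m) =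
                (f [^]\<^bsub>R\<^esub> s) \<odot>\<^bsub>M\<^esub> ((f [^]\<^bsub>R\<^esub> t) \<odot>\<^bsub>M\<^esub> m'))}"

text \<open>
  The localization \<open>M\<^sub>f\<close> for \<open>f\<close> homogeneous of degree \<open>d\<close>. The operations are defined on
  representatives; the unions are unions of copies of one and the same equivalence class.
\<close>

definition localization ::
    "('r, 'm) ring_scheme \<Rightarrow> ('r, 'a) gmodule \<Rightarrow> 'r \<Rightarrow> nat \<Rightarrow> ('r, ('a \<times> nat) set) gmodule"
  where "localization R M f d =
    \<lparr>carrier = {fraction R M f m t | m t. m \<in> carrier M},
     monoid.mult = undefined, one = undefined,
     ring.zero = fraction R M f \<zero>\<^bsub>M\<^esub> 0,
     add = (\<lambda>U V. \<Union>(m, t)\<in>U. \<Union>(m', t')\<in>V.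
              fraction R M f
                (((f [^]\<^bsub>R\<^esub> t') \<odot>\<^bsub>M\<^esub> m) \<oplus>\<^bsub>M\<^esub> ((f [^]\<^bsub>R\<^esub> t) \<odot>\<^bsub>M\<^esub> m')) (t + t')),
     smult = (\<lambda>r U. \<Union>(m, t)\<in>U. fraction R M f (r \<odot>\<^bsub>M\<^esub> m) t),
     hcomp = (\<lambda>j. {fraction R M f m t | m t. m \<in> hcomp M (j + int (t * d))})\<rparr>"

text \<open>The canonical map \<open>M\<^sub>f \<rightarrow> M\<^bsub>fg\<^esub>\<close>, sending \<open>m / f\<^sup>t\<close> to \<open>g\<^sup>t m / (fg)\<^sup>t\<close>.\<close>

definition localization_map ::
    "('r, 'm) ring_scheme \<Rightarrow> ('r, 'a, 'c) module_scheme \<Rightarrow> 'r \<Rightarrow> 'r \<Rightarrow> ('a \<times> nat) set \<Rightarrow> ('a \<times> nat) set"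
  where "localization_map R M f g U =
    (\<Union>(m, t)\<in>U. fraction R M (f \<otimes>\<^bsub>R\<^esub> g) ((g [^]\<^bsub>R\<^esub> t) \<odot>\<^bsub>M\<^esub> m) t)"


section \<open>Local cohomology and Castelnuovo-Mumford regularity\<close>

text \<open>
  Local cohomology with support in the maximal ideal generated by the variables is defined,
  with its grading, as the cohomology of the graded Cech complex
  \<open>0 \<rightarrow> M \<rightarrow> \<Oplus>\<^sub>a M\<^bsub>x_a\<^esub> \<rightarrow> \<Oplus>\<^bsub>a<b\<^esub> M\<^bsub>x_a x_b\<^esub> \<rightarrow> \<dots> \<rightarrow> M\<^bsub>x_0 \<cdots> x_(n-1)\<^esub> \<rightarrow> 0\<close>.
  Its term in cohomological degree \<open>i\<close> is the direct sum over the \<open>i\<close>-element sets \<open>\<sigma>\<close> of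
  variables; the groups below are the homogeneous parts of (internal) degree \<open>j\<close>.
\<close>

definition cech_faces :: "nat \<Rightarrow> nat \<Rightarrow> nat set set"
  where "cech_faces n i = {\<sigma>. \<sigma> \<subseteq> {..<n} \<and> card \<sigma> = i}"

definition cech_term ::
    "nat \<Rightarrow> ('k::field mpoly, 'a) gmodule \<Rightarrow> nat set \<Rightarrow> ('k mpoly, ('a \<times> nat) set) gmodule"
  where "cech_term n M \<sigma> = localization (mpoly_ring n) M (\<Prod>a\<in>\<sigma>. indet a) (card \<sigma>)"

definition cech_group ::
    "nat \<Rightarrow> ('k::field mpoly, 'a) gmodule \<Rightarrow> nat \<Rightarrow> int \<Rightarrow> (nat set \<Rightarrow> ('a \<times> nat) set) monoid"
  where "cech_group n M i j =
    product_group (cech_faces n i)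
      (\<lambda>\<sigma>. (add_monoid (cech_term n M \<sigma>))\<lparr>carrier := hcomp (cech_term n M \<sigma>) j\<rparr>)"

definition cech_diff ::
    "nat \<Rightarrow> ('k::field mpoly, 'a) gmodule \<Rightarrow> nat
      \<Rightarrow> (nat set \<Rightarrow> ('a \<times> nat) set) \<Rightarrow> nat set \<Rightarrow> ('a \<times> nat) set"
  where "cech_diff n M i c =
    (\<lambda>\<tau>\<in>cech_faces n (Suc i).
      \<Oplus>\<^bsub>cech_term n M \<tau>\<^esub>a\<in>\<tau>.
        let y = localization_map (mpoly_ring n) M (\<Prod>b\<in>\<tau> - {a}. indet b) (indet a) (c (\<tau> - {a}))
        in if even (card {b \<in> \<tau>. b < a}) then y else \<ominus>\<^bsub>cech_term n M \<tau>\<^esub> y)"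

definition cech_coboundaries ::
    "nat \<Rightarrow> ('k::field mpoly, 'a) gmodule \<Rightarrow> nat \<Rightarrow> int \<Rightarrow> (nat set \<Rightarrow> ('a \<times> nat) set) set"
  where "cech_coboundaries n M i j =
    (case i of
       0 \<Rightarrow> {\<one>\<^bsub>cech_group n M 0 j\<^esub>}
     | Suc i' \<Rightarrow> cech_diff n M i' ` carrier (cech_group n M i' j))"

text \<open>The homogeneous part of degree \<open>j\<close> of the \<open>i\<close>-th local cohomology module, as a group
  (written multiplicatively, as the library's quotient groups are).\<close>

definition local_cohomology ::
    "nat \<Rightarrow> ('k::field mpoly, 'a) gmodule \<Rightarrow> nat \<Rightarrow> int
      \<Rightarrow> (nat set \<Rightarrow> ('a \<times> nat) set) set monoid"
  where "local_cohomology n M i j =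
    (cech_group n M i j)
      \<lparr>carrier := kernel (cech_group n M i j) (cech_group n M (Suc i) j) (cech_diff n M i)\<rparr>
    Mod cech_coboundaries n M i j"

definition regularity :: "nat \<Rightarrow> ('k::field mpoly, 'a) gmodule \<Rightarrow> ereal"
  where "regularity n M =
    Sup {ereal (real_of_int (int i + j)) | i j.
      carrier (local_cohomology n M i j) \<noteq> {\<one>\<^bsub>local_cohomology n M i j\<^esub>}}"

end

theory Submission
  imports Defs
begin

text \<open>
  \<open>H = Hom(R/I, N)\<close> is the graded submodule \<open>(0 : I)\<close> of \<open>N\<close>. Let \<open>i + j > reg N\<close>;
  it is to be shown that \<open>H\<^sup>i(H)\<close> vanishes in degree \<open>j\<close>.

  For \<open>i = 0\<close>, the degree \<open>j\<close> part of \<open>H\<^sup>0(H)\<close> is contained in that of \<open>H\<^sup>0(N)\<close>, which vanishes.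

  For \<open>i = 1\<close>, a Cech cocycle of \<open>H\<close> is the coboundary of some \<open>y \<in> N\<^sub>j\<close>. If \<open>f \<in> I\<close> is homogeneous of
  degree \<open>d \<ge> 1\<close>, then \<open>f y\<close> vanishes in all localizations, so it lies in \<open>H\<^sup>0(N)\<close> in degree
  \<open>j + d > reg N\<close>, whence \<open>f y = 0\<close>. Thus \<open>y \<in> H\<close>.

  For \<open>i \<ge> 2\<close>, \<open>H\<^sup>i(H) = 0\<close> because \<open>dim H \<le> 1\<close>: for every \<open>t\<close> there is a homogeneous
  \<open>s = \<Sum> w\<^sub>a x\<^sub>a\<^sup>t\<close> such that a power of every variable lies in \<open>Ann H + (s)\<close>. Multiplication by \<open>s\<close> is
  null-homotopic on the Koszul complex of the \<open>x\<^sub>a\<^sup>t\<close>, and it is invertible on the localizations of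
  \<open>H\<close> at non-empty products of variables, so every cocycle is a coboundary.
\<close>

section \<open>Homogeneous components of polynomials\<close>

text \<open>The bound by \<open>reg N\<close> reaches only cohomological degrees 0 and 1.
  Multiplication by homogeneous generators \<open>f\<close> of \<open>I\<close> embeds
  \<open>N / H\<close> into a sum of shifted copies of \<open>N\<close>; an embedding controls
  \<open>H^0\<close> and nothing above it, so the exact sequence
  \<open>0 -> H -> N -> N / H -> 0\<close> yields \<open>H^1(H)\<close> but not
  \<open>H^2(H)\<close>. The lost cohomological degree is paid for by the internal degree
  \<open>d >= 1\<close> of \<open>f\<close>. From degree 2 on the dimension hypothesis has to take
  over.

  There, general vanishing above the dimension is replaced by one explicit element. A Cech cocycle
  is a finite datum: its fractions have a common exponent \<open>t\<close>, and after enlarging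
  \<open>t\<close> its numerators form an honest Koszul cocycle for the \<open>t\<close>-th powers
  of the variables. That is why \<open>s\<close> must lie in the ideal of these powers, for
  \<open>t\<close> prescribed in advance. Dimension at most one enters only through a relation
  between two elements, extracted from the absence of prime chains of length 2; applied to
  \<open>s\<close> and the next variable, it lets \<open>s\<close> be adapted to one variable at a
  time.\<close>

abbreviation polys :: "nat \<Rightarrow> 'k::field mpoly set"
  where "polys n \<equiv> carrier (mpoly_ring n)"

lemma mpoly_ring_simps [simp]:
  "p \<otimes>\<^bsub>mpoly_ring n\<^esub> q = p * q" "p \<oplus>\<^bsub>mpoly_ring n\<^esub> q = p + q"
  "\<one>\<^bsub>mpoly_ring n\<^esub> = 1" "\<zero>\<^bsub>mpoly_ring n\<^esub> = 0"
  by (simp_all add: mpoly_ring_def)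

lemma mem_polys_iff:
  "p \<in> polys n \<longleftrightarrow> (\<forall>m\<in>Poly_Mapping.keys p. Poly_Mapping.keys m \<subseteq> {..<n})"
  by (simp add: mpoly_ring_def)

lemma polys_closed [simp, intro]:
  fixes p q :: "'k::field mpoly"
  shows "(0::'k mpoly) \<in> polys n" "(1::'k mpoly) \<in> polys n"
    "p \<in> polys n \<Longrightarrow> q \<in> polys n \<Longrightarrow> p + q \<in> polys n"
    "p \<in> polys n \<Longrightarrow> q \<in> polys n \<Longrightarrow> p * q \<in> polys n"
    "p \<in> polys n \<Longrightarrow> - p \<in> polys n"
proof -
  interpret cring "mpoly_ring n :: 'k mpoly ring"
    by (rule mpoly_ring_cring)
  show "(0::'k mpoly) \<in> polys n" "(1::'k mpoly) \<in> polys n"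
    "p \<in> polys n \<Longrightarrow> q \<in> polys n \<Longrightarrow> p + q \<in> polys n"
    "p \<in> polys n \<Longrightarrow> q \<in> polys n \<Longrightarrow> p * q \<in> polys n"
    using zero_closed one_closed a_closed[of p q] m_closed[of p q] by simp_all
  show "p \<in> polys n \<Longrightarrow> - p \<in> polys n"
    by (simp add: mem_polys_iff)
qed

lemma polys_diff [simp, intro]:
  "p \<in> polys n \<Longrightarrow> q \<in> polys n \<Longrightarrow> p - q \<in> polys n"
  using polys_closed(3)[of p n "- q"] by simp

lemma polys_power [simp, intro]: "p \<in> polys n \<Longrightarrow> p ^ k \<in> polys n"
  by (induction k) simp_all

lemma polys_sum [intro]: "(\<And>a. a \<in> A \<Longrightarrow> p a \<in> polys n) \<Longrightarrow> sum p A \<in> polys n"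
  by (induction A rule: infinite_finite_induct) simp_all

lemma polys_prod [intro]: "(\<And>a. a \<in> A \<Longrightarrow> p a \<in> polys n) \<Longrightarrow> prod p A \<in> polys n"
  by (induction A rule: infinite_finite_induct) simp_all

lemma polys_single [simp]: "Poly_Mapping.single 0 c \<in> polys n"
  by (simp add: mem_polys_iff)

lemma polys_indet [simp]: "a < n \<Longrightarrow> indet a \<in> polys n"
  by (simp add: mem_polys_iff indet_def)

lemma mpoly_ring_pow [simp]: "p [^]\<^bsub>mpoly_ring n\<^esub> (k::nat) = p ^ k"
  by (induction k) (simp_all add: nat_pow_def mult.commute)

lemma mpoly_ring_uminus [simp]: "p \<in> polys n \<Longrightarrow> \<ominus>\<^bsub>mpoly_ring n\<^esub> p = - p"
  for p :: "'k::field mpoly"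
proof -
  assume p: "p \<in> polys n"
  interpret cring "mpoly_ring n :: 'k mpoly ring"
    by (rule mpoly_ring_cring)
  show ?thesis
    using minus_equality[of "- p" p] p by simp
qed

lemma monomial_degree_superset:
  assumes "finite A" "Poly_Mapping.keys m \<subseteq> A"
  shows "monomial_degree m = (\<Sum>a\<in>A. Poly_Mapping.lookup m a)"
  unfolding monomial_degree_def
  by (rule sum.mono_neutral_left) (use assms in \<open>auto simp: in_keys_iff\<close>)

lemma monomial_degree_add: "monomial_degree (a + b) = monomial_degree a + monomial_degree b"
proof -
  let ?A = "Poly_Mapping.keys a \<union> Poly_Mapping.keys b"
  have "monomial_degree m = (\<Sum>i\<in>?A. Poly_Mapping.lookup m i)" if "m \<in> {a, b, a + b}" for m
    using that keys_add[of a b] by (intro monomial_degree_superset) auto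
  then show ?thesis
    by (simp add: lookup_add sum.distrib)
qed

lemma monomial_degree_0 [simp]: "monomial_degree 0 = 0"
  by (simp add: monomial_degree_def)

lemma hcomp_polys: "p \<in> mpoly_hcomp n d \<Longrightarrow> p \<in> polys n"
  by (simp add: mpoly_hcomp_def)

lemma hcomp_0 [simp]: "0 \<in> mpoly_hcomp n d"
  by (simp add: mpoly_hcomp_def)

lemma hcomp_single [simp]: "Poly_Mapping.single 0 c \<in> mpoly_hcomp n 0"
  by (simp add: mpoly_hcomp_def)

lemma hcomp_1 [simp]: "1 \<in> mpoly_hcomp n 0"
  by (simp add: mpoly_hcomp_def)

lemma hcomp_indet: "a < n \<Longrightarrow> indet a \<in> mpoly_hcomp n 1"
  by (simp add: mpoly_hcomp_def) (simp add: indet_def monomial_degree_def)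

lemma hcomp_add: "p \<in> mpoly_hcomp n d \<Longrightarrow> q \<in> mpoly_hcomp n d \<Longrightarrow> p + q \<in> mpoly_hcomp n d"
  using keys_add[of p q] unfolding mpoly_hcomp_def by auto

lemma hcomp_uminus: "p \<in> mpoly_hcomp n d \<Longrightarrow> - p \<in> mpoly_hcomp n d"
  by (simp add: mpoly_hcomp_def)

lemma hcomp_diff: "p \<in> mpoly_hcomp n d \<Longrightarrow> q \<in> mpoly_hcomp n d \<Longrightarrow> p - q \<in> mpoly_hcomp n d"
  using hcomp_add[of p n d "- q"] by (simp add: hcomp_uminus)

lemma hcomp_mult:
  assumes "p \<in> mpoly_hcomp n d" "q \<in> mpoly_hcomp n e"
  shows "p * q \<in> mpoly_hcomp n (d + e)"
proof -
  have "int (monomial_degree m) = d + e" if m: "m \<in> Poly_Mapping.keys (p * q)" for m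
  proof -
    obtain a b where "m = a + b" "a \<in> Poly_Mapping.keys p" "b \<in> Poly_Mapping.keys q"
      using m keys_mult[of p q] by blast
    then show ?thesis
      using assms by (auto simp: mpoly_hcomp_def monomial_degree_add)
  qed
  then show ?thesis
    using assms unfolding mpoly_hcomp_def by auto
qed

lemma hcomp_power: "p \<in> mpoly_hcomp n d \<Longrightarrow> p ^ k \<in> mpoly_hcomp n (int k * d)"
proof (induction k)
  case (Suc k)
  then show ?case
    using hcomp_mult[of p n d "p ^ k" "int k * d"] by (simp add: algebra_simps)
qed simp

lemma hcomp_indet_power: "a < n \<Longrightarrow> indet a ^ k \<in> mpoly_hcomp n (int k)"
  using hcomp_power[OF hcomp_indet[of a n], of k] by simp

definition hpart :: "int \<Rightarrow> 'k::field mpoly \<Rightarrow> 'k mpoly"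
  where "hpart d p =
    Abs_poly_mapping (\<lambda>m. if int (monomial_degree m) = d then Poly_Mapping.lookup p m else 0)"

lemma lookup_hpart:
  "Poly_Mapping.lookup (hpart d p) m =
    (if int (monomial_degree m) = d then Poly_Mapping.lookup p m else 0)"
proof -
  have "finite {m. (if int (monomial_degree m) = d then Poly_Mapping.lookup p m else 0) \<noteq> 0}"
    by (rule finite_subset[OF _ finite_lookup[of p]]) auto
  then show ?thesis
    by (simp add: hpart_def)
qed

lemma keys_hpart: "Poly_Mapping.keys (hpart d p) \<subseteq> Poly_Mapping.keys p"
  by (auto simp: in_keys_iff lookup_hpart split: if_splits)

lemma hpart_hcomp: "p \<in> polys n \<Longrightarrow> hpart d p \<in> mpoly_hcomp n d"
  using keys_hpart[of d p]
  by (auto simp: mpoly_hcomp_def mem_polys_iff)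
    (auto simp: in_keys_iff lookup_hpart split: if_splits)

lemma hpart_of_hcomp: "p \<in> mpoly_hcomp n d \<Longrightarrow> hpart e p = (if e = d then p else 0)"
  by (rule poly_mapping_eqI) (auto simp: mpoly_hcomp_def lookup_hpart in_keys_iff)

lemma hpart_diff: "hpart d (p - q) = hpart d p - hpart d q"
  by (rule poly_mapping_eqI) (simp add: lookup_hpart lookup_minus)

lemma hpart_sum: "hpart d (sum p A) = (\<Sum>a\<in>A. hpart d (p a))"
  by (rule poly_mapping_eqI) (auto simp: lookup_hpart lookup_sum)

definition degree_set :: "'k::field mpoly \<Rightarrow> int set"
  where "degree_set p = (\<lambda>m. int (monomial_degree m)) ` Poly_Mapping.keys p"

lemma finite_degree_set [simp]: "finite (degree_set p)"
  by (simp add: degree_set_def)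

lemma sum_hpart: "(\<Sum>d\<in>degree_set p. hpart d p) = p"
proof (rule poly_mapping_eqI)
  fix m
  show "Poly_Mapping.lookup (\<Sum>d\<in>degree_set p. hpart d p) m = Poly_Mapping.lookup p m"
  proof (cases "m \<in> Poly_Mapping.keys p")
    case True
    then have "int (monomial_degree m) \<in> degree_set p"
      by (auto simp: degree_set_def)
    then show ?thesis
      by (simp add: lookup_sum lookup_hpart sum.delta)
  next
    case False
    then show ?thesis
      by (simp add: lookup_sum lookup_hpart in_keys_iff)
  qed
qed

text \<open>Degrees are integers, so for \<open>e < d\<close> the part
  \<open>hpart (e - d) p\<close> is simply zero and no truncated subtraction intervenes.\<close>

lemma hpart_mult:
  assumes f: "f \<in> mpoly_hcomp n d" and p: "p \<in> polys n"
  shows "hpart e (f * p) = f * hpart (e - d) p"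
proof -
  have "hpart e (f * p) = hpart e (f * (\<Sum>i\<in>degree_set p. hpart i p))"
    by (simp add: sum_hpart)
  also have "\<dots> = (\<Sum>i\<in>degree_set p. hpart e (f * hpart i p))"
    by (simp add: sum_distrib_left hpart_sum)
  also have "\<dots> = (\<Sum>i\<in>degree_set p. if i = e - d then f * hpart i p else 0)"
    by (intro sum.cong refl)
      (subst hpart_of_hcomp[OF hcomp_mult[OF f hpart_hcomp[OF p]]], auto)
  also have "\<dots> = (if e - d \<in> degree_set p then f * hpart (e - d) p else 0)"
    by (simp add: sum.delta)
  also have "\<dots> = f * hpart (e - d) p"
  proof (cases "e - d \<in> degree_set p")
    case False
    then have "hpart (e - d) p = 0"
      by (intro poly_mapping_eqI) (simp add: lookup_hpart degree_set_def image_iff, metis in_keys_iff)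
    then show ?thesis
      by simp
  qed simp
  finally show ?thesis .
qed

lemma hpart_0_eq_single: "hpart 0 u = Poly_Mapping.single 0 (Poly_Mapping.lookup u 0)"
proof (rule poly_mapping_eqI)
  fix m :: "nat \<Rightarrow>\<^sub>0 nat"
  have "m = 0" if "monomial_degree m = 0"
    using that by (intro poly_mapping_eqI) (auto simp: monomial_degree_def in_keys_iff)
  then show "Poly_Mapping.lookup (hpart 0 u) m =
      Poly_Mapping.lookup (Poly_Mapping.single 0 (Poly_Mapping.lookup u 0)) m"
    by (auto simp: lookup_hpart lookup_single when_def)
qed

text \<open>Exponents are natural numbers, so two exponent vectors add up to \<open>0\<close> only
  if both are \<open>0\<close>. Hence having a non-zero constant coefficient is stable under
  products, which makes the ideal of the variables prime.\<close>

lemma lookup_mult_0: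
  fixes p q :: "'k::field mpoly"
  shows "Poly_Mapping.lookup (p * q) 0 = Poly_Mapping.lookup p 0 * Poly_Mapping.lookup q 0"
proof -
  have "(0 = l + q) \<longleftrightarrow> l = 0 \<and> q = 0" for l q :: "nat \<Rightarrow>\<^sub>0 nat"
    by (auto simp: poly_mapping_eq_iff fun_eq_iff lookup_add)
  then have "(\<Sum>m. Poly_Mapping.lookup q m when 0 = l + m) = (Poly_Mapping.lookup q 0 when l = 0)" for l
    by (cases "l = 0") simp_all
  then show ?thesis
    unfolding lookup_mult by (simp add: mult_when)
qed

section \<open>Scalar action and homogeneous elements of a graded module\<close>

context graded_module
begin

lemma smult_smult [simp]:
  "\<lbrakk>r \<in> polys n; s \<in> polys n; x \<in> carrier M\<rbrakk> \<Longrightarrow> r \<odot> (s \<odot> x) = (r * s) \<odot> x"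
  using smult_assoc1[of r s x] by simp

lemma add_smult:
  "\<lbrakk>r \<in> polys n; s \<in> polys n; x \<in> carrier M\<rbrakk> \<Longrightarrow> (r + s) \<odot> x = r \<odot> x \<oplus> s \<odot> x"
  using smult_l_distr[of r s x] by simp

lemma zero_smult [simp]: "x \<in> carrier M \<Longrightarrow> 0 \<odot> x = \<zero>"
  using smult_l_null[of x] by (metis mpoly_ring_simps(4))

lemma one_smult [simp]: "x \<in> carrier M \<Longrightarrow> 1 \<odot> x = x"
  using smult_one[of x] by (metis mpoly_ring_simps(3))

lemma uminus_smult:
  "\<lbrakk>r \<in> polys n; x \<in> carrier M\<rbrakk> \<Longrightarrow> (- r) \<odot> x = \<ominus> (r \<odot> x)"
  using smult_l_minus[of r x] by simp

lemma sum_smult: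
  "\<lbrakk>\<And>a. a \<in> A \<Longrightarrow> r a \<in> polys n; finite A; x \<in> carrier M\<rbrakk>
    \<Longrightarrow> sum r A \<odot> x = (\<Oplus>a\<in>A. r a \<odot> x)"
proof (induction A rule: infinite_finite_induct)
  case (insert a A)
  then show ?case
    by (simp add: add_smult polys_sum M.finsum_insert Pi_def)
qed simp_all

lemma finsum_swap:
  assumes "finite A" "finite B" "\<And>a b. a \<in> A \<Longrightarrow> b \<in> B \<Longrightarrow> u a b \<in> carrier M"
  shows "(\<Oplus>a\<in>A. \<Oplus>b\<in>B. u a b) = (\<Oplus>b\<in>B. \<Oplus>a\<in>A. u a b)"
  using assms(1,3)
proof (induction A)
  case (insert a A)
  then have "(\<Oplus>c\<in>insert a A. \<Oplus>b\<in>B. u c b) = (\<Oplus>b\<in>B. u a b) \<oplus> (\<Oplus>b\<in>B. \<Oplus>a\<in>A. u a b)"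
    by (subst M.finsum_insert) (auto simp: Pi_def intro!: M.finsum_closed)
  also have "\<dots> = (\<Oplus>b\<in>B. u a b \<oplus> (\<Oplus>a\<in>A. u a b))"
    using insert.prems by (intro M.finsum_addf[symmetric]) (auto intro!: M.finsum_closed)
  also have "\<dots> = (\<Oplus>b\<in>B. \<Oplus>a\<in>insert a A. u a b)"
    using insert by (intro M.finsum_cong') (auto simp: M.finsum_insert Pi_def intro!: M.finsum_closed)
  finally show ?case .
qed (simp add: M.finsum_zero)

lemma hcomp_carrier: "x \<in> hcomp M j \<Longrightarrow> x \<in> carrier M"
  using subgroup.subset[OF hcomp_subgroup] by auto

lemma zero_hcomp [simp]: "\<zero> \<in> hcomp M j"
  using subgroup.one_closed[OF hcomp_subgroup] by simp

lemma add_hcomp: "\<lbrakk>x \<in> hcomp M j; y \<in> hcomp M j\<rbrakk> \<Longrightarrow> x \<oplus> y \<in> hcomp M j"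
  using subgroup.m_closed[OF hcomp_subgroup] by simp

lemma minus_hcomp: "x \<in> hcomp M j \<Longrightarrow> \<ominus> x \<in> hcomp M j"
  using subgroup.m_inv_closed[OF hcomp_subgroup] by (simp add: a_inv_def)

lemma finsum_hcomp: "(\<And>a. a \<in> A \<Longrightarrow> u a \<in> hcomp M j) \<Longrightarrow> finsum M u A \<in> hcomp M j"
proof (induction A rule: infinite_finite_induct)
  case (insert a A)
  then have "finsum M u (insert a A) = u a \<oplus> finsum M u A"
    by (intro M.finsum_insert) (use hcomp_carrier in blast)+
  then show ?case
    using insert by (simp add: add_hcomp)
qed (simp_all add: M.finsum_infinite)

section \<open>Fractions\<close>

abbreviation frac :: "'k mpoly \<Rightarrow> 'a \<Rightarrow> nat \<Rightarrow> ('a \<times> nat) set"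
  where "frac \<equiv> fraction (mpoly_ring n) M"

lemma mem_frac:
  assumes "f \<in> polys n" "m \<in> carrier M"
  shows "(m', t') \<in> frac f m t \<longleftrightarrow>
    m' \<in> carrier M \<and> (\<exists>s. f ^ (s + t') \<odot> m = f ^ (s + t) \<odot> m')"
  using assms by (auto simp: fraction_def power_add)

text \<open>Equality of fractions is transitive although \<open>f\<close> may be a zero divisor,
  because an extra power of \<open>f\<close> is allowed. One membership therefore already identifies
  the two classes.\<close>

lemma frac_eq_of_mem:
  assumes f: "f \<in> polys n" and m: "m \<in> carrier M" and mem: "(m', t') \<in> frac f m t"
  shows "frac f m' t' = frac f m t"
proof -
  have trans: "\<exists>s. f ^ (s + t3) \<odot> m1 = f ^ (s + t1) \<odot> m3"
    if c: "m1 \<in> carrier M" "m2 \<in> carrier M" "m3 \<in> carrier M"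
      and 1: "f ^ (s + t2) \<odot> m1 = f ^ (s + t1) \<odot> m2" and 2: "f ^ (s' + t3) \<odot> m2 = f ^ (s' + t2) \<odot> m3"
    for m1 m2 m3 t1 t2 t3 s s'
  proof
    \<comment> \<open>The first relation applies to \<open>m1\<close> only in the presence of
      \<open>f ^ t2\<close>; hence \<open>t2\<close> is part of the witness.\<close>
    have "f ^ (s + s' + t2 + t3) \<odot> m1 = f ^ (s' + t3) \<odot> (f ^ (s + t2) \<odot> m1)"
      using c f by (simp add: power_add[symmetric] ac_simps)
    also have "\<dots> = f ^ (s + t1) \<odot> (f ^ (s' + t3) \<odot> m2)"
      unfolding 1 using c f by (simp add: power_add[symmetric] ac_simps)
    also have "\<dots> = f ^ (s + s' + t2 + t1) \<odot> m3"
      unfolding 2 using c f by (simp add: power_add[symmetric] ac_simps)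
    finally show "f ^ (s + s' + t2 + t3) \<odot> m1 = f ^ (s + s' + t2 + t1) \<odot> m3" .
  qed
  obtain s where m': "m' \<in> carrier M" and s: "f ^ (s + t') \<odot> m = f ^ (s + t) \<odot> m'"
    using mem f m by (auto simp: mem_frac)
  have "(u, k) \<in> frac f m' t' \<longleftrightarrow> (u, k) \<in> frac f m t" for u k
    unfolding mem_frac[OF f m] mem_frac[OF f m']
    by (metis trans[OF m' m _ s[symmetric]] trans[OF m m' _ s])
  then show ?thesis
    by auto
qed

lemma frac_eq_iff:
  assumes f: "f \<in> polys n" and m: "m \<in> carrier M" and m': "m' \<in> carrier M"
  shows "frac f m t = frac f m' t' \<longleftrightarrow> (\<exists>s. f ^ (s + t') \<odot> m = f ^ (s + t) \<odot> m')"
proof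
  assume "frac f m t = frac f m' t'"
  moreover have "(m', t') \<in> frac f m' t'"
    using f m' by (simp add: mem_frac)
  ultimately show "\<exists>s. f ^ (s + t') \<odot> m = f ^ (s + t) \<odot> m'"
    using f m by (metis mem_frac)
next
  assume "\<exists>s. f ^ (s + t') \<odot> m = f ^ (s + t) \<odot> m'"
  then have "(m', t') \<in> frac f m t"
    using f m m' by (simp add: mem_frac)
  then show "frac f m t = frac f m' t'"
    using frac_eq_of_mem[OF f m] by simp
qed

lemma self_mem_frac: "\<lbrakk>f \<in> polys n; m \<in> carrier M\<rbrakk> \<Longrightarrow> (m, t) \<in> frac f m t"
  by (simp add: mem_frac)

lemma frac_expand:
  assumes "f \<in> polys n" "m \<in> carrier M"
  shows "frac f (f ^ k \<odot> m) (t + k) = frac f m t"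
  using assms by (subst frac_eq_iff) (auto simp: power_add ac_simps)

lemma frac_zero: "f \<in> polys n \<Longrightarrow> frac f \<zero> t = frac f \<zero> t'"
  by (subst frac_eq_iff) auto

lemma frac_eq_zero_iff:
  assumes "f \<in> polys n" "m \<in> carrier M"
  shows "frac f m t = frac f \<zero> t' \<longleftrightarrow> (\<exists>s. f ^ s \<odot> m = \<zero>)"
proof -
  have "frac f m t = frac f \<zero> 0 \<longleftrightarrow> (\<exists>s. f ^ s \<odot> m = \<zero>)"
    using assms by (subst frac_eq_iff) auto
  then show ?thesis
    using frac_zero[OF assms(1), of t' 0] by simp
qed

text \<open>The operations of a localization are unions over all representatives. Such a union is a
  single class once its members do not depend on the representative, since a class is never
  empty.\<close>

lemma UN_frac:
  assumes "f \<in> polys n" "m \<in> carrier M"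
    and "\<And>m' t'. (m', t') \<in> frac f m t \<Longrightarrow> F m' t' = Y"
  shows "(\<Union>(m', t')\<in>frac f m t. F m' t') = Y"
  using assms self_mem_frac[of f m t] by fastforce

section \<open>Localizations as abelian groups with homogeneous parts\<close>

abbreviation loc :: "'k mpoly \<Rightarrow> nat \<Rightarrow> ('k mpoly, ('a \<times> nat) set) gmodule"
  where "loc \<equiv> localization (mpoly_ring n) M"

lemma loc_carrier: "carrier (loc f d) = {frac f m t | m t. m \<in> carrier M}"
  and loc_zero: "\<zero>\<^bsub>loc f d\<^esub> = frac f \<zero> 0"
  and loc_hcomp: "hcomp (loc f d) j = {frac f m t | m t. m \<in> hcomp M (j + int (t * d))}"
  by (simp_all add: localization_def)

lemma frac_in_loc: "m \<in> carrier M \<Longrightarrow> frac f m t \<in> carrier (loc f d)"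
  unfolding loc_carrier by blast

lemma frac_in_loc_hcomp: "m \<in> hcomp M (j + int (t * d)) \<Longrightarrow> frac f m t \<in> hcomp (loc f d) j"
  unfolding loc_hcomp by blast

lemma loc_add:
  assumes f: "f \<in> polys n" and m: "m \<in> carrier M" and m': "m' \<in> carrier M"
  shows "frac f m t \<oplus>\<^bsub>loc f d\<^esub> frac f m' t' = frac f (f ^ t' \<odot> m \<oplus> f ^ t \<odot> m') (t + t')"
proof -
  have eq: "frac f (f ^ l' \<odot> u \<oplus> f ^ l \<odot> u') (l + l') = frac f (f ^ t' \<odot> m \<oplus> f ^ t \<odot> m') (t + t')"
    if "(u, l) \<in> frac f m t" "(u', l') \<in> frac f m' t'" for u l u' l'
  proof -
    obtain s s' where u: "u \<in> carrier M" "u' \<in> carrier M"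
      and s: "f ^ (s + l) \<odot> m = f ^ (s + t) \<odot> u" and s': "f ^ (s' + l') \<odot> m' = f ^ (s' + t') \<odot> u'"
      using \<open>(u, l) \<in> frac f m t\<close> \<open>(u', l') \<in> frac f m' t'\<close> f m m' by (auto simp: mem_frac)
    have "f ^ (s + s' + (t + t')) \<odot> (f ^ l' \<odot> u \<oplus> f ^ l \<odot> u') =
        f ^ (s' + t' + l') \<odot> (f ^ (s + t) \<odot> u) \<oplus> f ^ (s + t + l) \<odot> (f ^ (s' + t') \<odot> u')"
      using f u by (simp add: smult_r_distr power_add[symmetric] ac_simps)
    also have "\<dots> = f ^ (s + s' + (l + l')) \<odot> (f ^ t' \<odot> m \<oplus> f ^ t \<odot> m')"
      using f m m' unfolding s[symmetric] s'[symmetric]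
      by (simp add: smult_r_distr power_add[symmetric] ac_simps)
    finally show ?thesis
      using f m m' u by (subst frac_eq_iff) (auto intro!: exI[of _ "s + s'"])
  qed
  have "(\<Union>(u, l)\<in>frac f m t. \<Union>(u', l')\<in>frac f m' t'.
      frac f (f ^ l' \<odot> u \<oplus> f ^ l \<odot> u') (l + l')) = frac f (f ^ t' \<odot> m \<oplus> f ^ t \<odot> m') (t + t')"
    by (rule UN_frac[OF f m]) (rule UN_frac[OF f m'], rule eq)
  then show ?thesis
    by (simp add: localization_def)
qed

lemma loc_add_same:
  assumes "f \<in> polys n" "m \<in> carrier M" "m' \<in> carrier M"
  shows "frac f m t \<oplus>\<^bsub>loc f d\<^esub> frac f m' t = frac f (m \<oplus> m') t"
proof -
  have "f ^ t \<odot> m \<oplus> f ^ t \<odot> m' = f ^ t \<odot> (m \<oplus> m')"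
    using assms by (simp add: smult_r_distr)
  then show ?thesis
    using assms by (simp add: loc_add frac_expand)
qed

text \<open>The denominators \<open>f a\<close> may vary with \<open>a\<close>; what is made common
  is the exponent. \<open>P\<close> carries a condition linking numerator and exponent, such as the
  degree condition of a homogeneous fraction, and must survive expansion.\<close>

lemma frac_common_denominator:
  assumes "finite A" "\<And>a. a \<in> A \<Longrightarrow> f a \<in> polys n"
    and "\<And>a. a \<in> A \<Longrightarrow> \<exists>m t. m \<in> carrier M \<and> P a m t \<and> c a = frac (f a) m t"
    and "\<And>a m t k. \<lbrakk>a \<in> A; m \<in> carrier M; P a m t\<rbrakk> \<Longrightarrow> P a (f a ^ k \<odot> m) (t + k)"
  shows "\<exists>m t. \<forall>a\<in>A. m a \<in> carrier M \<and> P a (m a) t \<and> c a = frac (f a) (m a) t"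
proof -
  obtain m t where mt: "\<And>a. a \<in> A \<Longrightarrow> m a \<in> carrier M \<and> P a (m a) (t a) \<and> c a = frac (f a) (m a) (t a)"
    using assms(3) by metis
  \<comment> \<open>Any bound for the finitely many exponents would serve.\<close>
  define T where "T = (\<Sum>a\<in>A. t a)"
  have T: "t a + (T - t a) = T" if "a \<in> A" for a
    using member_le_sum[of a A t] that assms(1) by (simp add: T_def)
  show ?thesis
  proof (intro exI ballI conjI)
    fix a assume a: "a \<in> A"
    show "f a ^ (T - t a) \<odot> m a \<in> carrier M"
      using a mt assms(2) by simp
    show "P a (f a ^ (T - t a) \<odot> m a) T"
      using assms(4)[of a "m a" "t a" "T - t a"] a mt T by simp
    show "c a = frac (f a) (f a ^ (T - t a) \<odot> m a) T"
      using frac_expand[of "f a" "m a" "T - t a" "t a"] a mt assms(2) T by simp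
  qed
qed

text \<open>Finitely many fractions have a common exponent, and over it addition is addition of
  numerators, so each axiom is inherited from \<open>M\<close>.\<close>

lemma loc_abelian_group:
  assumes f: "f \<in> polys n"
  shows "abelian_group (loc f d)"
proof -
  have rep: "\<exists>m t. \<forall>u\<in>A. m u \<in> carrier M \<and> u = frac f (m u) t"
    if A: "finite A" "A \<subseteq> carrier (loc f d)" for A
  proof -
    have "\<exists>m t. m \<in> carrier M \<and> True \<and> u = frac f m t" if "u \<in> A" for u
    proof -
      have "u \<in> carrier (loc f d)"
        using that A by blast
      then show ?thesis
        unfolding loc_carrier by blast
    qed
    from frac_common_denominator[of A "\<lambda>_. f" "\<lambda>_ _ _. True" "\<lambda>u. u", OF A(1) f this TrueI]
    show ?thesis
      by simp
  qed
  show ?thesis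
  proof (rule abelian_groupI)
    fix x y z assume xyz: "x \<in> carrier (loc f d)" "y \<in> carrier (loc f d)" "z \<in> carrier (loc f d)"
    have "\<exists>m t. \<forall>u\<in>{x, y, z}. m u \<in> carrier M \<and> u = frac f (m u) t"
      by (rule rep) (use xyz in simp_all)
    then obtain a b c t where m: "a \<in> carrier M" "b \<in> carrier M" "c \<in> carrier M"
      "x = frac f a t" "y = frac f b t" "z = frac f c t"
      by (metis insertCI)
    show "x \<oplus>\<^bsub>loc f d\<^esub> y \<in> carrier (loc f d)"
      using m f by (simp add: loc_add_same frac_in_loc)
    show "x \<oplus>\<^bsub>loc f d\<^esub> y \<oplus>\<^bsub>loc f d\<^esub> z = x \<oplus>\<^bsub>loc f d\<^esub> (y \<oplus>\<^bsub>loc f d\<^esub> z)"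
      using m f by (simp add: loc_add_same M.a_assoc)
    show "x \<oplus>\<^bsub>loc f d\<^esub> y = y \<oplus>\<^bsub>loc f d\<^esub> x"
      using m f by (simp add: loc_add_same M.a_comm)
  next
    show "\<zero>\<^bsub>loc f d\<^esub> \<in> carrier (loc f d)"
      by (simp add: frac_in_loc loc_zero)
  next
    fix x assume "x \<in> carrier (loc f d)"
    then obtain m t where m: "m \<in> carrier M" "x = frac f m t"
      by (auto simp: loc_carrier)
    have z: "\<zero>\<^bsub>loc f d\<^esub> = frac f \<zero> t"
      using frac_zero[OF f] by (simp add: loc_zero)
    show "\<zero>\<^bsub>loc f d\<^esub> \<oplus>\<^bsub>loc f d\<^esub> x = x"
      unfolding z using m f by (simp add: loc_add_same)
    have "frac f (\<ominus> m) t \<oplus>\<^bsub>loc f d\<^esub> x = \<zero>\<^bsub>loc f d\<^esub>"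
      unfolding z using m f by (simp add: loc_add_same M.l_neg)
    then show "\<exists>y\<in>carrier (loc f d). y \<oplus>\<^bsub>loc f d\<^esub> x = \<zero>\<^bsub>loc f d\<^esub>"
      by (rule bexI) (use m in \<open>simp add: frac_in_loc\<close>)
  qed
qed

lemma loc_minus:
  assumes f: "f \<in> polys n" and m: "m \<in> carrier M"
  shows "\<ominus>\<^bsub>loc f d\<^esub> frac f m t = frac f (\<ominus> m) t"
proof -
  interpret L: abelian_group "loc f d"
    using f by (rule loc_abelian_group)
  have "frac f (\<ominus> m) t \<oplus>\<^bsub>loc f d\<^esub> frac f m t = \<zero>\<^bsub>loc f d\<^esub>"
    using m f frac_zero[OF f, of t 0] by (simp add: loc_add_same M.l_neg loc_zero)
  then show ?thesis
    using m by (intro L.minus_equality) (simp_all add: frac_in_loc)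
qed

lemma loc_finsum:
  assumes f: "f \<in> polys n" and "finite A" "\<And>a. a \<in> A \<Longrightarrow> u a \<in> carrier M"
  shows "(\<Oplus>\<^bsub>loc f d\<^esub>a\<in>A. frac f (u a) t) = frac f (finsum M u A) t"
proof -
  interpret L: abelian_group "loc f d"
    using f by (rule loc_abelian_group)
  show ?thesis
    using assms(2,3)
  proof (induction A)
    case empty
    then show ?case
      using frac_zero[OF f, of t 0] by (simp add: loc_zero)
  next
    case (insert a A)
    have "frac f (u b) t \<in> carrier (loc f d)" if "b \<in> insert a A" for b
      using insert.prems that by (simp add: frac_in_loc)
    then show ?case
      using insert f by (simp add: L.finsum_insert M.finsum_insert Pi_def loc_add_same M.finsum_closed)
  qed
qed

lemma loc_hcomp_subgroup:
  assumes f: "f \<in> mpoly_hcomp n (int d)"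
  shows "subgroup (hcomp (loc f d) j) (add_monoid (loc f d))"
proof -
  have fp: "f \<in> polys n"
    using f by (rule hcomp_polys)
  interpret L: abelian_group "loc f d"
    using fp by (rule loc_abelian_group)
  have deg: "f ^ k \<odot> m \<in> hcomp M (j + int ((t + k) * d))" if "m \<in> hcomp M (j + int (t * d))" for k m t
    using hcomp_smult[OF hcomp_power[OF f, of k] that] by (simp add: algebra_simps)
  show ?thesis
  proof (rule L.add.subgroupI)
    show "hcomp (loc f d) j \<subseteq> carrier (loc f d)"
      by (auto simp: loc_hcomp loc_carrier hcomp_carrier)
    show "hcomp (loc f d) j \<noteq> {}"
      using frac_in_loc_hcomp[OF zero_hcomp] by blast
  next
    fix x assume "x \<in> hcomp (loc f d) j"
    then obtain m t where "x = frac f m t" "m \<in> hcomp M (j + int (t * d))"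
      unfolding loc_hcomp by blast
    then show "\<ominus>\<^bsub>loc f d\<^esub> x \<in> hcomp (loc f d) j"
      using fp frac_in_loc_hcomp[OF minus_hcomp, of m j t d f] by (simp add: loc_minus hcomp_carrier)
  next
    fix x y assume "x \<in> hcomp (loc f d) j" "y \<in> hcomp (loc f d) j"
    then obtain m t m' t' where "x = frac f m t" "y = frac f m' t'"
      and m: "m \<in> hcomp M (j + int (t * d))" "m' \<in> hcomp M (j + int (t' * d))"
      by (auto simp: loc_hcomp)
    then have "x \<oplus>\<^bsub>loc f d\<^esub> y = frac f (f ^ t' \<odot> m \<oplus> f ^ t \<odot> m') (t + t')"
      using fp by (simp add: loc_add hcomp_carrier)
    moreover have "f ^ t' \<odot> m \<oplus> f ^ t \<odot> m' \<in> hcomp M (j + int ((t + t') * d))"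
      using deg[OF m(1), of t'] deg[OF m(2), of t] by (simp add: add_hcomp add.commute)
    ultimately show "x \<oplus>\<^bsub>loc f d\<^esub> y \<in> hcomp (loc f d) j"
      unfolding loc_hcomp by blast
  qed
qed

lemma localization_map_frac:
  assumes f: "f \<in> polys n" and g: "g \<in> polys n" and m: "m \<in> carrier M"
  shows "localization_map (mpoly_ring n) M f g (frac f m t) = frac (f * g) (g ^ t \<odot> m) t"
proof -
  have "frac (f * g) (g ^ t' \<odot> m') t' = frac (f * g) (g ^ t \<odot> m) t" if mem: "(m', t') \<in> frac f m t" for m' t'
  proof -
    obtain s where m': "m' \<in> carrier M" and s: "f ^ (s + t') \<odot> m = f ^ (s + t) \<odot> m'"
      using mem f m by (auto simp: mem_frac)
    have "(f * g) ^ (s + t) \<odot> (g ^ t' \<odot> m') = g ^ (s + t + t') \<odot> (f ^ (s + t) \<odot> m')"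
      using f g m' by (simp add: power_add power_mult_distrib ac_simps)
    also have "\<dots> = (f * g) ^ (s + t') \<odot> (g ^ t \<odot> m)"
      unfolding s[symmetric] using f g m by (simp add: power_add power_mult_distrib ac_simps)
    finally show ?thesis
      using f g m m' by (subst frac_eq_iff) auto
  qed
  then show ?thesis
    using UN_frac[OF f m, of t "\<lambda>m' t'. frac (f * g) (g ^ t' \<odot> m') t'" "frac (f * g) (g ^ t \<odot> m) t"]
    by (simp add: localization_map_def)
qed

end

section \<open>Cech cochains and their numerators\<close>

abbreviation xm :: "nat set \<Rightarrow> 'k::field mpoly"
  where "xm \<rho> \<equiv> \<Prod>a\<in>\<rho>. indet a"

text \<open>The sign is a ring element, not a choice between a term and its negative, so that it
  merges with the scalars of the Koszul differential.\<close>

definition cech_sign :: "nat \<Rightarrow> nat set \<Rightarrow> 'k::field mpoly"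
  where "cech_sign a \<tau> = (- 1) ^ card {b \<in> \<tau>. b < a}"

lemma cech_sign_polys [simp]: "cech_sign a \<tau> \<in> polys n"
  by (simp add: cech_sign_def)

lemma cech_sign_hcomp: "cech_sign a \<tau> \<in> mpoly_hcomp n 0"
  using hcomp_power[OF hcomp_uminus[OF hcomp_1]] by (simp add: cech_sign_def)

lemma cech_sign_sq: "cech_sign a \<tau> * cech_sign a \<tau> = 1"
  by (simp add: cech_sign_def flip: power_mult_distrib)

lemma finite_cech_faces [simp]: "finite (cech_faces n i)"
  by (rule finite_subset[of _ "Pow {..<n}"]) (simp_all add: cech_faces_def subset_iff)

lemma cech_facesD:
  assumes "\<rho> \<in> cech_faces n i"
  shows "finite \<rho>" "\<rho> \<subseteq> {..<n}" "card \<rho> = i"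
proof -
  show "\<rho> \<subseteq> {..<n}" "card \<rho> = i"
    using assms by (simp_all add: cech_faces_def)
  then show "finite \<rho>"
    by (meson finite_lessThan finite_subset)
qed

lemma cech_faces_remove:
  assumes "\<tau> \<in> cech_faces n (Suc i)" "a \<in> \<tau>"
  shows "\<tau> - {a} \<in> cech_faces n i"
proof -
  have "\<tau> - {a} \<subseteq> {..<n}"
    using cech_facesD(2)[OF assms(1)] by blast
  then show ?thesis
    using cech_facesD(3)[OF assms(1)] assms(2) by (simp add: cech_faces_def)
qed

lemma cech_faces_insert:
  assumes "\<rho> \<in> cech_faces n i" "a < n" "a \<notin> \<rho>"
  shows "insert a \<rho> \<in> cech_faces n (Suc i)"
  using cech_facesD[OF assms(1)] assms(2,3) by (simp add: cech_faces_def)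

lemma xm_polys [simp]: "\<rho> \<subseteq> {..<n} \<Longrightarrow> xm \<rho> \<in> polys n"
  by (intro polys_prod polys_indet) auto

lemma xm_hcomp: "\<rho> \<subseteq> {..<n} \<Longrightarrow> xm \<rho> \<in> mpoly_hcomp n (int (card \<rho>))"
proof (induction \<rho> rule: infinite_finite_induct)
  case (insert a \<rho>)
  then show ?case
    using hcomp_mult[of "indet a" n 1 "xm \<rho>" "int (card \<rho>)"] by (simp add: hcomp_indet)
qed simp_all

lemma xm_remove: "\<lbrakk>finite \<tau>; a \<in> \<tau>\<rbrakk> \<Longrightarrow> indet a * xm (\<tau> - {a}) = xm \<tau>"
  by (simp only: prod.remove[symmetric])

context graded_module
begin

text \<open>The coboundary of the cochain with numerators \<open>m \<rho>\<close> over the common exponent \<open>t\<close> of all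
  denominators has the numerators \<open>koszul t m \<tau>\<close> over the same exponent.\<close>

definition koszul :: "nat \<Rightarrow> (nat set \<Rightarrow> 'a) \<Rightarrow> nat set \<Rightarrow> 'a"
  where "koszul t m \<tau> = (\<Oplus>a\<in>\<tau>. (cech_sign a \<tau> * indet a ^ t) \<odot> m (\<tau> - {a}))"

definition cochain :: "nat \<Rightarrow> (nat set \<Rightarrow> 'a) \<Rightarrow> nat \<Rightarrow> nat set \<Rightarrow> ('a \<times> nat) set"
  where "cochain i m t = (\<lambda>\<rho>\<in>cech_faces n i. frac (xm \<rho>) (m \<rho>) t)"

lemma koszul_term_closed:
  assumes "\<tau> \<in> cech_faces n (Suc i)" "m \<in> cech_faces n i \<rightarrow> carrier M" "a \<in> \<tau>"
  shows "(indet a :: 'k mpoly) \<in> polys n" "m (\<tau> - {a}) \<in> carrier M"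
proof -
  show "(indet a :: 'k mpoly) \<in> polys n"
    using assms(3) cech_facesD(2)[OF assms(1)] by (intro polys_indet) blast
  show "m (\<tau> - {a}) \<in> carrier M"
    using cech_faces_remove[OF assms(1,3)] assms(2) by blast
qed

lemma koszul_closed:
  assumes "\<tau> \<in> cech_faces n (Suc i)" "m \<in> cech_faces n i \<rightarrow> carrier M"
  shows "koszul t m \<tau> \<in> carrier M"
  unfolding koszul_def
  by (intro M.finsum_closed) (use koszul_term_closed[OF assms] in auto)

lemma koszul_hcomp:
  assumes "\<tau> \<in> cech_faces n (Suc i)"
    and "m \<in> cech_faces n i \<rightarrow> hcomp M (j + int (t * i))"
  shows "koszul t m \<tau> \<in> hcomp M (j + int (t * Suc i))"
  unfolding koszul_def
proof (rule finsum_hcomp)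
  fix a assume a: "a \<in> \<tau>"
  then have "a < n"
    using cech_facesD(2)[OF assms(1)] by auto
  then have "cech_sign a \<tau> * indet a ^ t \<in> mpoly_hcomp n (0 + int t)"
    by (intro hcomp_mult cech_sign_hcomp hcomp_indet_power)
  from hcomp_smult[OF this funcset_mem[OF assms(2) cech_faces_remove[OF assms(1) a]]]
  show "(cech_sign a \<tau> * indet a ^ t) \<odot> m (\<tau> - {a}) \<in> hcomp M (j + int (t * Suc i))"
    by (simp add: algebra_simps)
qed

lemma koszul_cong:
  assumes "\<tau> \<in> cech_faces n (Suc i)" "m \<in> cech_faces n i \<rightarrow> carrier M"
    and "\<And>\<rho>. \<rho> \<in> cech_faces n i \<Longrightarrow> m' \<rho> = m \<rho>"
  shows "koszul t m' \<tau> = koszul t m \<tau>"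
  unfolding koszul_def
proof (rule M.finsum_cong'[OF refl])
  show "(\<lambda>a. (cech_sign a \<tau> * indet a ^ t) \<odot> m (\<tau> - {a})) \<in> \<tau> \<rightarrow> carrier M"
    using koszul_term_closed[OF assms(1,2)] by auto
qed (use assms(3) cech_faces_remove[OF assms(1)] in auto)

lemma koszul_add:
  assumes \<tau>: "\<tau> \<in> cech_faces n (Suc i)"
    and "m \<in> cech_faces n i \<rightarrow> carrier M"
    and "m' \<in> cech_faces n i \<rightarrow> carrier M"
  shows "koszul t (\<lambda>\<rho>. m \<rho> \<oplus> m' \<rho>) \<tau> = koszul t m \<tau> \<oplus> koszul t m' \<tau>"
proof -
  note closed = koszul_term_closed[OF \<tau> assms(2)] koszul_term_closed[OF \<tau> assms(3)]
  have "koszul t (\<lambda>\<rho>. m \<rho> \<oplus> m' \<rho>) \<tau> = (\<Oplus>a\<in>\<tau>. (cech_sign a \<tau> * indet a ^ t) \<odot> m (\<tau> - {a})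
      \<oplus> (cech_sign a \<tau> * indet a ^ t) \<odot> m' (\<tau> - {a}))"
    unfolding koszul_def using closed by (intro M.finsum_cong') (auto simp: smult_r_distr)
  then show ?thesis
    unfolding koszul_def using closed by (simp add: M.finsum_addf Pi_def)
qed

lemma koszul_smult:
  assumes \<tau>: "\<tau> \<in> cech_faces n (Suc i)" and "m \<in> cech_faces n i \<rightarrow> carrier M"
    and r: "r \<in> polys n"
  shows "koszul t (\<lambda>\<rho>. r \<odot> m \<rho>) \<tau> = r \<odot> koszul t m \<tau>"
proof -
  note closed = koszul_term_closed[OF \<tau> assms(2)]
  have "r \<odot> koszul t m \<tau> = (\<Oplus>a\<in>\<tau>. r \<odot> ((cech_sign a \<tau> * indet a ^ t) \<odot> m (\<tau> - {a})))"
    unfolding koszul_def using closed r cech_facesD(1)[OF \<tau>] by (intro finsum_smult_ldistr) auto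
  also have "\<dots> = koszul t (\<lambda>\<rho>. r \<odot> m \<rho>) \<tau>"
    unfolding koszul_def using closed r by (intro M.finsum_cong') (auto simp: mult.commute)
  finally show ?thesis ..
qed

text \<open>Raising the common exponent by \<open>q\<close> multiplies every numerator by the
  \<open>q\<close>-th power of the monomial of its own face. The differential respects this because
  \<open>indet a\<close> times \<open>xm (\<tau> - {a})\<close> is \<open>xm \<tau>\<close>.\<close>

lemma koszul_expand:
  assumes \<tau>: "\<tau> \<in> cech_faces n (Suc i)" and m: "m \<in> cech_faces n i \<rightarrow> carrier M"
  shows "koszul (t + q) (\<lambda>\<rho>. xm \<rho> ^ q \<odot> m \<rho>) \<tau> = xm \<tau> ^ q \<odot> koszul t m \<tau>"
proof -
  note closed = koszul_term_closed[OF \<tau> m]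
  note \<tau>D = cech_facesD[OF \<tau>]
  have eq: "(cech_sign a \<tau> * indet a ^ (t + q)) \<odot> (xm (\<tau> - {a}) ^ q \<odot> m (\<tau> - {a})) =
      xm \<tau> ^ q \<odot> ((cech_sign a \<tau> * indet a ^ t) \<odot> m (\<tau> - {a}))" if "a \<in> \<tau>" for a
  proof -
    have x: "(xm (\<tau> - {a}) :: 'k mpoly) \<in> polys n"
      using \<tau>D(2) by (intro xm_polys) auto
    have e: "cech_sign a \<tau> * indet a ^ (t + q) * xm (\<tau> - {a}) ^ q =
        xm \<tau> ^ q * (cech_sign a \<tau> * indet a ^ t :: 'k mpoly)"
      unfolding xm_remove[OF \<tau>D(1) that, symmetric]
      by (simp add: power_add power_mult_distrib ac_simps)
    show ?thesis
      using closed[OF that] \<tau>D(2) x by (simp add: e)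
  qed
  have "xm \<tau> ^ q \<odot> koszul t m \<tau> = (\<Oplus>a\<in>\<tau>. xm \<tau> ^ q \<odot> ((cech_sign a \<tau> * indet a ^ t) \<odot> m (\<tau> - {a})))"
    unfolding koszul_def using closed \<tau>D by (intro finsum_smult_ldistr) auto
  also have "\<dots> = koszul (t + q) (\<lambda>\<rho>. xm \<rho> ^ q \<odot> m \<rho>) \<tau>"
    unfolding koszul_def by (intro M.finsum_cong' refl) (use closed \<tau>D eq m cech_faces_remove[OF \<tau>] in \<open>auto simp del: smult_smult\<close>)
  finally show ?thesis ..
qed

section \<open>Cech cochain groups and the differential on numerators\<close>

lemma cech_term_eq: "cech_term n M \<rho> = loc (xm \<rho>) (card \<rho>)"
  by (simp add: cech_term_def)

lemma cech_group_carrier: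
  "carrier (cech_group n M i j) = (\<Pi>\<^sub>E \<rho>\<in>cech_faces n i. hcomp (cech_term n M \<rho>) j)"
  by (simp add: cech_group_def)

lemma group_cech_group [simp]: "group (cech_group n M i j)"
  unfolding cech_group_def
proof (rule product_group)
  fix \<rho> assume \<rho>: "\<rho> \<in> cech_faces n i"
  note D = cech_facesD[OF \<rho>]
  interpret L: abelian_group "cech_term n M \<rho>"
    unfolding cech_term_eq using D(2) by (intro loc_abelian_group xm_polys)
  have "subgroup (hcomp (cech_term n M \<rho>) j) (add_monoid (cech_term n M \<rho>))"
    unfolding cech_term_eq using D(2) by (intro loc_hcomp_subgroup xm_hcomp)
  then show "group (add_monoid (cech_term n M \<rho>)\<lparr>carrier := hcomp (cech_term n M \<rho>) j\<rparr>)"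
    using L.add.subgroup_imp_group by blast
qed

lemma cochain_mem:
  assumes "m \<in> cech_faces n i \<rightarrow> hcomp M (j + int (t * i))"
  shows "cochain i m t \<in> carrier (cech_group n M i j)"
  unfolding cech_group_carrier cochain_def cech_term_eq
proof (intro restrict_PiE_iff[THEN iffD2] ballI frac_in_loc_hcomp)
  fix \<rho> assume "\<rho> \<in> cech_faces n i"
  then show "m \<rho> \<in> hcomp M (j + int (t * card \<rho>))"
    using funcset_mem[OF assms] by (simp add: cech_facesD(3))
qed

lemma cochain_carrier: "m \<in> cech_faces n i \<rightarrow> hcomp M j \<Longrightarrow> m \<in> cech_faces n i \<rightarrow> carrier M"
  using hcomp_carrier by blast

text \<open>There are finitely many faces, so one exponent serves all of them; and all of them have
  \<open>i\<close> elements, so all denominators have the same degree \<open>t * i\<close>.\<close>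

lemma cochain_cases:
  assumes c: "c \<in> carrier (cech_group n M i j)"
  obtains m t where "m \<in> cech_faces n i \<rightarrow> hcomp M (j + int (t * i))" "c = cochain i m t"
proof -
  have "\<exists>m t. \<forall>\<rho>\<in>cech_faces n i. m \<rho> \<in> carrier M \<and> m \<rho> \<in> hcomp M (j + int (t * i)) \<and>
      c \<rho> = frac (xm \<rho>) (m \<rho>) t"
  proof (rule frac_common_denominator[where P = "\<lambda>_ m t. m \<in> hcomp M (j + int (t * i))"])
    fix \<rho> assume \<rho>: "\<rho> \<in> cech_faces n i"
    note D = cech_facesD[OF \<rho>]
    show "xm \<rho> \<in> polys n"
      using D by simp
    have "c \<rho> \<in> hcomp (loc (xm \<rho>) i) j"
      using PiE_mem[OF c[unfolded cech_group_carrier] \<rho>] by (simp add: D cech_term_eq)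
    then obtain m t where m: "c \<rho> = frac (xm \<rho>) m t" "m \<in> hcomp M (j + int (t * i))"
      unfolding loc_hcomp by blast
    show "\<exists>m t. m \<in> carrier M \<and> m \<in> hcomp M (j + int (t * i)) \<and> c \<rho> = frac (xm \<rho>) m t"
      by (intro exI conjI) (rule hcomp_carrier[OF m(2)], rule m(2), rule m(1))
    fix m t k assume "m \<in> hcomp M (j + int (t * i))"
    from hcomp_smult[OF hcomp_power[OF xm_hcomp[OF D(2)], of k] this]
    show "xm \<rho> ^ k \<odot> m \<in> hcomp M (j + int ((t + k) * i))"
      by (simp add: D algebra_simps)
  qed simp
  then obtain m t where m: "\<forall>\<rho>\<in>cech_faces n i. m \<rho> \<in> carrier M \<and> m \<rho> \<in> hcomp M (j + int (t * i)) \<and>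
      c \<rho> = frac (xm \<rho>) (m \<rho>) t"
    by blast
  have "c = cochain i m t"
    unfolding cochain_def
  proof (rule ext)
    fix \<rho>
    show "c \<rho> = (\<lambda>\<rho>\<in>cech_faces n i. frac (xm \<rho>) (m \<rho>) t) \<rho>"
    proof (cases "\<rho> \<in> cech_faces n i")
      case False
      then show ?thesis
        using PiE_arb[OF c[unfolded cech_group_carrier]] by simp
    next
      case True
      then show ?thesis
        using bspec[OF m True] by (simp only: restrict_apply')
    qed
  qed
  then show thesis
    using m by (intro that[of m t]) simp_all
qed

lemma cochain_expand:
  assumes "m \<in> cech_faces n i \<rightarrow> carrier M"
  shows "cochain i (\<lambda>\<rho>. xm \<rho> ^ k \<odot> m \<rho>) (t + k) = cochain i m t"
  unfolding cochain_def
proof (rule restrict_ext)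
  fix \<rho> assume "\<rho> \<in> cech_faces n i"
  then show "frac (xm \<rho>) (xm \<rho> ^ k \<odot> m \<rho>) (t + k) = frac (xm \<rho>) (m \<rho>) t"
    using assms cech_facesD(2) by (intro frac_expand xm_polys) blast+
qed

lemma cochain_mult:
  assumes "m \<in> cech_faces n i \<rightarrow> carrier M"
    and "m' \<in> cech_faces n i \<rightarrow> carrier M"
  shows "cochain i m t \<otimes>\<^bsub>cech_group n M i j\<^esub> cochain i m' t = cochain i (\<lambda>\<rho>. m \<rho> \<oplus> m' \<rho>) t"
  unfolding cech_group_def cochain_def mult_product_group cech_term_eq
proof (rule restrict_ext)
  fix \<rho> assume \<rho>: "\<rho> \<in> cech_faces n i"
  then have "m \<rho> \<in> carrier M" "m' \<rho> \<in> carrier M"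
    using assms by blast+
  then show "(\<lambda>\<rho>\<in>cech_faces n i. frac (xm \<rho>) (m \<rho>) t) \<rho>
      \<otimes>\<^bsub>add_monoid (loc (xm \<rho>) (card \<rho>))\<lparr>carrier := hcomp (loc (xm \<rho>) (card \<rho>)) j\<rparr>\<^esub>
      (\<lambda>\<rho>\<in>cech_faces n i. frac (xm \<rho>) (m' \<rho>) t) \<rho> = frac (xm \<rho>) (m \<rho> \<oplus> m' \<rho>) t"
    using \<rho> cech_facesD(2)[OF \<rho>] by (simp add: loc_add_same)
qed

lemma cochain_one: "\<one>\<^bsub>cech_group n M i j\<^esub> = cochain i (\<lambda>_. \<zero>) t"
  unfolding cech_group_def cochain_def one_product_group cech_term_eq
proof (rule restrict_ext)
  fix \<rho> assume "\<rho> \<in> cech_faces n i"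
  then have "frac (xm \<rho>) \<zero> 0 = frac (xm \<rho>) \<zero> t"
    by (intro frac_zero xm_polys cech_facesD(2))
  then show "\<one>\<^bsub>add_monoid (loc (xm \<rho>) (card \<rho>))\<lparr>carrier := hcomp (loc (xm \<rho>) (card \<rho>)) j\<rparr>\<^esub> =
      frac (xm \<rho>) \<zero> t"
    by (simp add: loc_zero)
qed

lemma cochain_eq_iff:
  "cochain i m t = cochain i m' t' \<longleftrightarrow>
    (\<forall>\<rho>\<in>cech_faces n i. frac (xm \<rho>) (m \<rho>) t = frac (xm \<rho>) (m' \<rho>) t')"
proof
  assume eq: "cochain i m t = cochain i m' t'"
  show "\<forall>\<rho>\<in>cech_faces n i. frac (xm \<rho>) (m \<rho>) t = frac (xm \<rho>) (m' \<rho>) t'"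
  proof
    fix \<rho> assume "\<rho> \<in> cech_faces n i"
    then show "frac (xm \<rho>) (m \<rho>) t = frac (xm \<rho>) (m' \<rho>) t'"
      using fun_cong[OF eq, of \<rho>] by (simp add: cochain_def)
  qed
qed (simp add: cochain_def cong: restrict_cong)

lemma cech_diff_cochain:
  assumes m: "m \<in> cech_faces n i \<rightarrow> carrier M"
  shows "cech_diff n M i (cochain i m t) = cochain (Suc i) (koszul t m) t"
  unfolding cech_diff_def cochain_def[of "Suc i"]
proof (rule restrict_ext)
  fix \<tau> assume \<tau>: "\<tau> \<in> cech_faces n (Suc i)"
  note D = cech_facesD[OF \<tau>]
  note closed = koszul_term_closed[OF \<tau> m]
  have xm: "(xm \<tau> :: 'k mpoly) \<in> polys n"
    using D by simp
  interpret L: abelian_group "loc (xm \<tau>) (card \<tau>)"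
    using xm by (rule loc_abelian_group)
  let ?y = "\<lambda>a. localization_map (mpoly_ring n) M (xm (\<tau> - {a})) (indet a) (cochain i m t (\<tau> - {a}))"
  let ?z = "\<lambda>a. let y = ?y a in if even (card {b \<in> \<tau>. b < a}) then y else \<ominus>\<^bsub>loc (xm \<tau>) (card \<tau>)\<^esub> y"
  have z: "?z a = frac (xm \<tau>) ((cech_sign a \<tau> * indet a ^ t) \<odot> m (\<tau> - {a})) t" if a: "a \<in> \<tau>" for a
  proof -
    have a_polys: "(indet a :: 'k mpoly) \<in> polys n" "(xm (\<tau> - {a}) :: 'k mpoly) \<in> polys n"
      using D(2) a by (auto intro!: polys_indet xm_polys)
    have "xm (\<tau> - {a}) * indet a = (xm \<tau> :: 'k mpoly)"
      using xm_remove[OF D(1) a] by (simp only: mult.commute)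
    then have "?y a = frac (xm \<tau>) (indet a ^ t \<odot> m (\<tau> - {a})) t"
      using a_polys closed(2)[OF a] cech_faces_remove[OF \<tau> a]
      by (simp add: cochain_def localization_map_frac)
    then show ?thesis
      using a_polys closed(2)[OF a] xm
      by (cases "even (card {b \<in> \<tau>. b < a})")
        (simp_all add: cech_sign_def loc_minus uminus_smult Let_def)
  qed
  have "(\<Oplus>\<^bsub>loc (xm \<tau>) (card \<tau>)\<^esub>a\<in>\<tau>. ?z a) =
      (\<Oplus>\<^bsub>loc (xm \<tau>) (card \<tau>)\<^esub>a\<in>\<tau>. frac (xm \<tau>) ((cech_sign a \<tau> * indet a ^ t) \<odot> m (\<tau> - {a})) t)"
    using z closed by (intro L.finsum_cong') (auto intro!: frac_in_loc)
  also have "\<dots> = frac (xm \<tau>) (koszul t m \<tau>) t"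
    unfolding koszul_def using closed D by (intro loc_finsum xm) auto
  finally show "(\<Oplus>\<^bsub>cech_term n M \<tau>\<^esub>a\<in>\<tau>.
      let y = ?y a in if even (card {b \<in> \<tau>. b < a}) then y else \<ominus>\<^bsub>cech_term n M \<tau>\<^esub> y) =
      frac (xm \<tau>) (koszul t m \<tau>) t"
    unfolding cech_term_eq .
qed

lemma cech_diff_hom: "cech_diff n M i \<in> hom (cech_group n M i j) (cech_group n M (Suc i) j)"
proof (rule homI)
  fix c assume "c \<in> carrier (cech_group n M i j)"
  then obtain m t where m: "m \<in> cech_faces n i \<rightarrow> hcomp M (j + int (t * i))"
    and c: "c = cochain i m t"
    by (rule cochain_cases)
  have "cech_diff n M i c = cochain (Suc i) (koszul t m) t"
    unfolding c using cech_diff_cochain[OF cochain_carrier[OF m]] .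
  moreover have "cochain (Suc i) (koszul t m) t \<in> carrier (cech_group n M (Suc i) j)"
    by (intro cochain_mem funcsetI koszul_hcomp m)
  ultimately show "cech_diff n M i c \<in> carrier (cech_group n M (Suc i) j)"
    by simp
next
  fix c c' assume "c \<in> carrier (cech_group n M i j)" "c' \<in> carrier (cech_group n M i j)"
  then obtain u t u' t' where u: "u \<in> cech_faces n i \<rightarrow> hcomp M (j + int (t * i))"
      "u' \<in> cech_faces n i \<rightarrow> hcomp M (j + int (t' * i))"
    and c: "c = cochain i u t" "c' = cochain i u' t'"
    by (elim cochain_cases) blast
  note u = u[THEN cochain_carrier]
  \<comment> \<open>Crosswise expansion brings both cochains to the exponent
    \<open>t + t'\<close>.\<close>
  define m m' where "m = (\<lambda>\<rho>. xm \<rho> ^ t' \<odot> u \<rho>)" and "m' = (\<lambda>\<rho>. xm \<rho> ^ t \<odot> u' \<rho>)"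
  have m: "m \<in> cech_faces n i \<rightarrow> carrier M" "m' \<in> cech_faces n i \<rightarrow> carrier M"
    using u cech_facesD(2) by (auto simp: m_def m'_def)
  have c: "c = cochain i m (t + t')" "c' = cochain i m' (t + t')"
    using cochain_expand[OF u(1), of t' t] cochain_expand[OF u(2), of t t']
    by (simp_all add: c m_def m'_def add.commute)
  have K: "koszul (t + t') (\<lambda>\<rho>. m \<rho> \<oplus> m' \<rho>) \<tau> = koszul (t + t') m \<tau> \<oplus> koszul (t + t') m' \<tau>"
    if "\<tau> \<in> cech_faces n (Suc i)" for \<tau>
    using that m by (rule koszul_add)
  have "cech_diff n M i (c \<otimes>\<^bsub>cech_group n M i j\<^esub> c') =
      cochain (Suc i) (koszul (t + t') (\<lambda>\<rho>. m \<rho> \<oplus> m' \<rho>)) (t + t')"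
    unfolding c cochain_mult[OF m] by (rule cech_diff_cochain) (use m in blast)
  also have "\<dots> = cochain (Suc i) (koszul (t + t') m) (t + t') \<otimes>\<^bsub>cech_group n M (Suc i) j\<^esub>
      cochain (Suc i) (koszul (t + t') m') (t + t')"
  proof (subst cochain_mult)
    show "koszul (t + t') m \<in> cech_faces n (Suc i) \<rightarrow> carrier M"
      "koszul (t + t') m' \<in> cech_faces n (Suc i) \<rightarrow> carrier M"
      using m by (blast intro: koszul_closed)+
  qed (simp add: K cochain_eq_iff)
  also have "\<dots> = cech_diff n M i c \<otimes>\<^bsub>cech_group n M (Suc i) j\<^esub> cech_diff n M i c'"
    unfolding c using m by (simp add: cech_diff_cochain)
  finally show "cech_diff n M i (c \<otimes>\<^bsub>cech_group n M i j\<^esub> c') =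
      cech_diff n M i c \<otimes>\<^bsub>cech_group n M (Suc i) j\<^esub> cech_diff n M i c'" .
qed

section \<open>Cocycles, coboundaries and trivial cohomology groups\<close>

abbreviation cocycles :: "nat \<Rightarrow> int \<Rightarrow> (nat set \<Rightarrow> ('a \<times> nat) set) set"
  where "cocycles i j \<equiv> kernel (cech_group n M i j) (cech_group n M (Suc i) j) (cech_diff n M i)"

lemma cech_coboundaries_subgroup: "subgroup (cech_coboundaries n M i j) (cech_group n M i j)"
proof (cases i)
  case 0
  then show ?thesis
    using group.triv_subgroup[OF group_cech_group] by (simp add: cech_coboundaries_def)
next
  case (Suc i')
  interpret group_hom "cech_group n M i' j" "cech_group n M i j" "cech_diff n M i'"
    unfolding Suc by (intro group_hom.intro group_hom_axioms.intro cech_diff_hom group_cech_group)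
  show ?thesis
    using img_is_subgroup by (simp add: cech_coboundaries_def Suc)
qed

definition coh_trivial :: "nat \<Rightarrow> int \<Rightarrow> bool"
  where "coh_trivial i j \<longleftrightarrow> carrier (local_cohomology n M i j) = {\<one>\<^bsub>local_cohomology n M i j\<^esub>}"

lemma coh_trivial_iff: "coh_trivial i j \<longleftrightarrow> cocycles i j \<subseteq> cech_coboundaries n M i j"
proof -
  let ?G = "cech_group n M i j" and ?Z = "cocycles i j" and ?B = "cech_coboundaries n M i j"
  interpret G: group ?G
    by (rule group_cech_group)
  interpret d: group_hom ?G "cech_group n M (Suc i) j" "cech_diff n M i"
    by (intro group_hom.intro group_hom_axioms.intro cech_diff_hom group_cech_group)
  have Z: "?Z \<subseteq> carrier ?G" and one_Z: "\<one>\<^bsub>?G\<^esub> \<in> ?Z"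
    using d.subgroup_kernel by (rule subgroup.subset, rule subgroup.one_closed)
  \<comment> \<open>A coset depends only on the multiplication, so it may be formed in the whole
    cochain group, where \<open>?B\<close> is known to be a subgroup.\<close>
  have coset: "?B #>\<^bsub>?G\<lparr>carrier := ?Z\<rparr>\<^esub> z = ?B #>\<^bsub>?G\<^esub> z" for z
    by (simp add: r_coset_def)
  have carrier: "carrier (local_cohomology n M i j) = (\<lambda>z. ?B #>\<^bsub>?G\<^esub> z) ` ?Z"
    unfolding local_cohomology_def FactGroup_def RCOSETS_def partial_object.simps coset
    by (simp add: UNION_singleton_eq_range)
  have one: "\<one>\<^bsub>local_cohomology n M i j\<^esub> = ?B"
    by (simp add: local_cohomology_def FactGroup_def)
  have iff: "?B #>\<^bsub>?G\<^esub> z = ?B \<longleftrightarrow> z \<in> ?B" if "z \<in> ?Z" for z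
    using subsetD[OF Z that] G.coset_join1[OF _ _ cech_coboundaries_subgroup]
      G.coset_join2[OF _ cech_coboundaries_subgroup] by metis
  show ?thesis
    unfolding coh_trivial_def carrier one
  proof
    assume eq: "(\<lambda>z. ?B #>\<^bsub>?G\<^esub> z) ` ?Z = {?B}"
    show "?Z \<subseteq> ?B"
    proof
      fix z assume z: "z \<in> ?Z"
      then have "?B #>\<^bsub>?G\<^esub> z \<in> {?B}"
        unfolding eq[symmetric] by (rule imageI)
      then show "z \<in> ?B"
        using iff[OF z] by simp
    qed
  next
    assume "?Z \<subseteq> ?B"
    then have "?B #>\<^bsub>?G\<^esub> z = ?B" if "z \<in> ?Z" for z
      using iff[OF that] that by (simp add: subsetD)
    then have "(\<lambda>z. ?B #>\<^bsub>?G\<^esub> z) ` ?Z = (\<lambda>z. ?B) ` ?Z"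
      by (rule image_cong[OF refl])
    then show "(\<lambda>z. ?B #>\<^bsub>?G\<^esub> z) ` ?Z = {?B}"
      using one_Z by (simp only: image_constant)
  qed
qed

end

text \<open>Exactly one of the two signs changes: for \<open>a < b\<close> the presence of
  \<open>a\<close> shifts the position of \<open>b\<close>, and for \<open>b < a\<close> the removal
  of \<open>b\<close> shifts the position of \<open>a\<close>.\<close>

lemma cech_sign_flip:
  assumes "finite \<rho>" "b \<in> \<rho>" "a \<notin> \<rho>"
  shows "cech_sign b \<rho> * cech_sign a (insert a (\<rho> - {b})) =
    - (cech_sign a (insert a \<rho>) * cech_sign b (insert a \<rho>))"
proof (cases "a < b")
  case True
  then have 1: "{c \<in> insert a \<rho>. c < b} = insert a {c \<in> \<rho>. c < b}"
    and 2: "{c \<in> insert a (\<rho> - {b}). c < a} = {c \<in> insert a \<rho>. c < a}"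
    by auto
  have "card (insert a {c \<in> \<rho>. c < b}) = Suc (card {c \<in> \<rho>. c < b})"
    using assms by (intro card_insert_disjoint) simp_all
  then show ?thesis
    unfolding cech_sign_def 1 2 by simp
next
  case False
  with assms have "b < a"
    by (metis linorder_cases)
  then have 1: "{c \<in> insert a \<rho>. c < b} = {c \<in> \<rho>. c < b}"
    and 2: "{c \<in> insert a \<rho>. c < a} = insert b {c \<in> insert a (\<rho> - {b}). c < a}"
    using assms by auto
  have "card (insert b {c \<in> insert a (\<rho> - {b}). c < a}) = Suc (card {c \<in> insert a (\<rho> - {b}). c < a})"
    using assms \<open>b < a\<close> by (intro card_insert_disjoint) auto
  then show ?thesis
    unfolding cech_sign_def 1 2 by simp
qed

lemma cech_faces_0: "cech_faces n 0 = {{}}"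
  by (auto simp: cech_faces_def finite_subset[OF _ finite_lessThan])

lemma cech_faces_1: "cech_faces n (Suc 0) = (\<lambda>a. {a}) ` {..<n}"
  by (auto simp: cech_faces_def card_1_singleton_iff)

section \<open>Triviality of cohomology as a statement about numerators\<close>

context graded_module
begin

lemma koszul_singleton:
  assumes "a < n" "m {} \<in> carrier M"
  shows "koszul t m {a} = indet a ^ t \<odot> m {}"
proof -
  have "{b \<in> {a}. b < a} = {}"
    by auto
  then have "cech_sign a {a} = (1 :: 'k mpoly)"
    unfolding cech_sign_def by (simp only: card.empty power_0)
  then show ?thesis
    using assms by (simp add: koszul_def M.finsum_insert[of "{}"] M.finsum_empty)
qed

text \<open>A fraction is zero exactly if a power of its denominator kills the numerator; the power
  may depend on the face.\<close>

lemma cocycle_iff: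
  assumes m: "m \<in> cech_faces n i \<rightarrow> hcomp M (j + int (t * i))"
  shows "cochain i m t \<in> cocycles i j \<longleftrightarrow>
    (\<forall>\<tau>\<in>cech_faces n (Suc i). \<exists>s. xm \<tau> ^ s \<odot> koszul t m \<tau> = \<zero>)"
proof -
  have "cochain i m t \<in> cocycles i j \<longleftrightarrow>
      cochain (Suc i) (koszul t m) t = cochain (Suc i) (\<lambda>_. \<zero>) t"
    using cochain_mem[OF m]
    by (simp only: kernel_def mem_Collect_eq cech_diff_cochain[OF cochain_carrier[OF m]]
        cochain_one[of "Suc i" j t] simp_thms)
  also have "\<dots> \<longleftrightarrow> (\<forall>\<tau>\<in>cech_faces n (Suc i). \<exists>s. xm \<tau> ^ s \<odot> koszul t m \<tau> = \<zero>)"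
    unfolding cochain_eq_iff
    by (intro ball_cong refl frac_eq_zero_iff xm_polys cech_facesD(2) koszul_closed)
      (assumption | rule cochain_carrier[OF m])+
  finally show ?thesis .
qed

text \<open>A 0-cochain is a single element, since the only face is empty and has denominator 1. Its
  coboundary vanishes exactly if each variable has a power that kills it, so \<open>H^0\<close> is
  the torsion supported at the ideal of the variables.\<close>

lemma coh_trivial_0_iff:
  "coh_trivial 0 j \<longleftrightarrow>
    (\<forall>m\<in>hcomp M j. (\<forall>a<n. \<exists>s. indet a ^ s \<odot> m = \<zero>) \<longrightarrow> m = \<zero>)"
proof -
  have cocycle: "cochain 0 m t \<in> cocycles 0 j \<longleftrightarrow> (\<forall>a<n. \<exists>s. indet a ^ s \<odot> m {} = \<zero>)"
    if m: "m {} \<in> hcomp M j" for m t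
  proof -
    \<comment> \<open>The factor \<open>indet a ^ t\<close> comes from the differential and is
      absorbed in the unspecified power.\<close>
    have "(\<exists>s. indet a ^ s \<odot> (indet a ^ t \<odot> m {}) = \<zero>) \<longleftrightarrow> (\<exists>s. indet a ^ s \<odot> m {} = \<zero>)"
      if "a < n" for a
    proof
      assume "\<exists>s. indet a ^ s \<odot> (indet a ^ t \<odot> m {}) = \<zero>"
      then obtain s where "indet a ^ s \<odot> (indet a ^ t \<odot> m {}) = \<zero>"
        by blast
      then have "indet a ^ (s + t) \<odot> m {} = \<zero>"
        using that hcomp_carrier[OF m] by (simp add: power_add)
      then show "\<exists>s. indet a ^ s \<odot> m {} = \<zero>" ..
    next
      assume "\<exists>s. indet a ^ s \<odot> m {} = \<zero>"
      then obtain s where "indet a ^ s \<odot> m {} = \<zero>"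
        by blast
      then have "indet a ^ s \<odot> (indet a ^ t \<odot> m {}) = \<zero>"
        using that hcomp_carrier[OF m] smult_smult[of "indet a ^ t" "indet a ^ s" "m {}"]
        by (simp add: mult.commute)
      then show "\<exists>s. indet a ^ s \<odot> (indet a ^ t \<odot> m {}) = \<zero>" ..
    qed
    moreover have "m \<in> cech_faces n 0 \<rightarrow> hcomp M (j + int (t * 0))"
      using m by (simp add: cech_faces_0)
    ultimately show ?thesis
      using hcomp_carrier[OF m] by (simp add: cocycle_iff cech_faces_1 koszul_singleton, simp add: Ball_def)
  qed
  have zero: "cochain 0 m t = \<one>\<^bsub>cech_group n M 0 j\<^esub> \<longleftrightarrow> m {} = \<zero>"
    if "m {} \<in> hcomp M j" for m t
    using hcomp_carrier[OF that] frac_eq_zero_iff[of 1 "m {}" t t]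
    by (simp add: cochain_one[of 0 j t] cochain_eq_iff cech_faces_0)
  have B: "cech_coboundaries n M 0 j = {\<one>\<^bsub>cech_group n M 0 j\<^esub>}"
    by (simp add: cech_coboundaries_def)
  show ?thesis
    unfolding coh_trivial_iff B
  proof (intro iffI ballI impI)
    fix m assume sub: "cocycles 0 j \<subseteq> {\<one>\<^bsub>cech_group n M 0 j\<^esub>}" and m: "m \<in> hcomp M j"
      and "\<forall>a<n. \<exists>s. indet a ^ s \<odot> m = \<zero>"
    then have "cochain 0 (\<lambda>_. m) 0 \<in> cocycles 0 j"
      by (simp add: cocycle)
    then have "cochain 0 (\<lambda>_. m) 0 = \<one>\<^bsub>cech_group n M 0 j\<^esub>"
      using sub by blast
    then show "m = \<zero>"
      using zero[of "\<lambda>_. m" 0] m by simp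
  next
    assume R: "\<forall>m\<in>hcomp M j. (\<forall>a<n. \<exists>s. indet a ^ s \<odot> m = \<zero>) \<longrightarrow> m = \<zero>"
    show "cocycles 0 j \<subseteq> {\<one>\<^bsub>cech_group n M 0 j\<^esub>}"
    proof
      fix c assume c: "c \<in> cocycles 0 j"
      then have "c \<in> carrier (cech_group n M 0 j)"
        by (simp only: kernel_def mem_Collect_eq)
      then obtain m t where "m \<in> cech_faces n 0 \<rightarrow> hcomp M (j + int (t * 0))" and c_eq: "c = cochain 0 m t"
        by (rule cochain_cases)
      then have m: "m {} \<in> hcomp M j"
        by (simp add: cech_faces_0)
      have "m {} = \<zero>"
        using R m c unfolding c_eq cocycle[of m, OF m] by blast
      then show "c \<in> {\<one>\<^bsub>cech_group n M 0 j\<^esub>}"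
        using zero[of m, OF m] by (simp add: c_eq)
    qed
  qed
qed

text \<open>A Cech cocycle satisfies the Koszul cocycle condition only up to powers of the
  denominators. Enlarging the common exponent makes the condition exact, as the Koszul homotopy
  requires.\<close>

lemma coh_trivial_Suc_iff:
  "coh_trivial (Suc i) j \<longleftrightarrow>
    (\<forall>t. \<forall>m\<in>cech_faces n (Suc i) \<rightarrow> hcomp M (j + int (t * Suc i)).
      (\<forall>\<tau>\<in>cech_faces n (Suc (Suc i)). koszul t m \<tau> = \<zero>) \<longrightarrow>
      (\<exists>t'. \<exists>b\<in>cech_faces n i \<rightarrow> hcomp M (j + int (t' * i)).
        cochain (Suc i) m t = cochain (Suc i) (koszul t' b) t'))"
    (is "_ \<longleftrightarrow> ?R")
proof -
  have B: "cech_coboundaries n M (Suc i) j = cech_diff n M i ` carrier (cech_group n M i j)"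
    by (simp add: cech_coboundaries_def)
  show ?thesis
    unfolding coh_trivial_iff B
  proof (intro iffI allI ballI impI)
    fix t m assume sub: "cocycles (Suc i) j \<subseteq> cech_diff n M i ` carrier (cech_group n M i j)"
      and m: "m \<in> cech_faces n (Suc i) \<rightarrow> hcomp M (j + int (t * Suc i))"
      and K: "\<forall>\<tau>\<in>cech_faces n (Suc (Suc i)). koszul t m \<tau> = \<zero>"
    have "cochain (Suc i) m t \<in> cocycles (Suc i) j"
      unfolding cocycle_iff[OF m]
    proof (intro ballI exI)
      fix \<tau> assume \<tau>: "\<tau> \<in> cech_faces n (Suc (Suc i))"
      show "xm \<tau> ^ 0 \<odot> koszul t m \<tau> = \<zero>"
        using K \<tau> by simp
    qed
    then obtain c where c: "c \<in> carrier (cech_group n M i j)" "cochain (Suc i) m t = cech_diff n M i c"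
      using sub by blast
    from c(1) obtain b t' where b: "b \<in> cech_faces n i \<rightarrow> hcomp M (j + int (t' * i))" "c = cochain i b t'"
      by (rule cochain_cases)
    then have "cochain (Suc i) m t = cochain (Suc i) (koszul t' b) t'"
      using c(2) cech_diff_cochain[OF cochain_carrier[OF b(1)]] by simp
    then show "\<exists>t'. \<exists>b\<in>cech_faces n i \<rightarrow> hcomp M (j + int (t' * i)).
        cochain (Suc i) m t = cochain (Suc i) (koszul t' b) t'"
      using b(1) by blast
  next
    assume R: ?R
    show "cocycles (Suc i) j \<subseteq> cech_diff n M i ` carrier (cech_group n M i j)"
    proof
      fix c assume c: "c \<in> cocycles (Suc i) j"
      then have "c \<in> carrier (cech_group n M (Suc i) j)"
        by (simp only: kernel_def mem_Collect_eq)
      then obtain m t where m: "m \<in> cech_faces n (Suc i) \<rightarrow> hcomp M (j + int (t * Suc i))"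
        and c_eq: "c = cochain (Suc i) m t"
        by (rule cochain_cases)
      note mc = cochain_carrier[OF m]
      obtain s where s: "\<forall>\<tau>\<in>cech_faces n (Suc (Suc i)). xm \<tau> ^ s \<tau> \<odot> koszul t m \<tau> = \<zero>"
        using c unfolding c_eq cocycle_iff[OF m] by metis
      \<comment> \<open>One bound for the powers on all faces: expanding by \<open>q\<close>
        multiplies \<open>koszul t m \<tau>\<close> by \<open>xm \<tau> ^ q\<close>, which kills
        it.\<close>
      define q where "q = (\<Sum>\<tau>\<in>cech_faces n (Suc (Suc i)). s \<tau>)"
      define m' where "m' = (\<lambda>\<rho>. xm \<rho> ^ q \<odot> m \<rho>)"
      have m': "m' \<in> cech_faces n (Suc i) \<rightarrow> hcomp M (j + int ((t + q) * Suc i))"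
      proof
        fix \<rho> assume \<rho>: "\<rho> \<in> cech_faces n (Suc i)"
        note D = cech_facesD[OF \<rho>]
        show "m' \<rho> \<in> hcomp M (j + int ((t + q) * Suc i))"
          using hcomp_smult[OF hcomp_power[OF xm_hcomp[OF D(2)], of q] funcset_mem[OF m \<rho>]]
          by (simp add: D m'_def algebra_simps)
      qed
      have K: "\<forall>\<tau>\<in>cech_faces n (Suc (Suc i)). koszul (t + q) m' \<tau> = \<zero>"
      proof
        fix \<tau> assume \<tau>: "\<tau> \<in> cech_faces n (Suc (Suc i))"
        have "s \<tau> \<le> q"
          unfolding q_def using \<tau> by (intro member_le_sum) simp_all
        then have q: "q = (q - s \<tau>) + s \<tau>"
          by simp
        have "koszul (t + q) m' \<tau> = xm \<tau> ^ q \<odot> koszul t m \<tau>"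
          unfolding m'_def using \<tau> mc by (rule koszul_expand)
        also have "\<dots> = xm \<tau> ^ (q - s \<tau>) \<odot> (xm \<tau> ^ s \<tau> \<odot> koszul t m \<tau>)"
          using koszul_closed[OF \<tau> mc, of t] cech_facesD(2)[OF \<tau>]
          by (subst q) (simp add: power_add)
        also have "\<dots> = \<zero>"
          using bspec[OF s \<tau>] cech_facesD(2)[OF \<tau>] by (simp del: smult_smult)
        finally show "koszul (t + q) m' \<tau> = \<zero>" .
      qed
      obtain t' b where b: "b \<in> cech_faces n i \<rightarrow> hcomp M (j + int (t' * i))"
        and eq: "cochain (Suc i) m' (t + q) = cochain (Suc i) (koszul t' b) t'"
        using R m' K by blast
      have "c = cochain (Suc i) m' (t + q)"
        unfolding c_eq m'_def using cochain_expand[OF mc] by simp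
      also have "\<dots> = cech_diff n M i (cochain i b t')"
        using eq cech_diff_cochain[OF cochain_carrier[OF b]] by simp
      finally show "c \<in> cech_diff n M i ` carrier (cech_group n M i j)"
        using cochain_mem[OF b] by (rule image_eqI)
    qed
  qed
qed

section \<open>Vanishing above degree one\<close>

text \<open>Contraction with the vector \<open>w\<close>: the standard homotopy on a Koszul cochain
  complex, here used for the sequence of the \<open>indet a ^ t\<close>.\<close>

definition koszul_homotopy :: "(nat \<Rightarrow> 'k mpoly) \<Rightarrow> (nat set \<Rightarrow> 'a) \<Rightarrow> nat set \<Rightarrow> 'a"
  where "koszul_homotopy w m \<tau> = (\<Oplus>a\<in>{..<n} - \<tau>. (cech_sign a (insert a \<tau>) * w a) \<odot> m (insert a \<tau>))"

lemma koszul_homotopy_hcomp: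
  assumes m: "m \<in> cech_faces n (Suc i) \<rightarrow> hcomp M j" and w: "\<And>a. a < n \<Longrightarrow> w a \<in> mpoly_hcomp n d"
    and \<tau>: "\<tau> \<in> cech_faces n i"
  shows "koszul_homotopy w m \<tau> \<in> hcomp M (d + j)"
  unfolding koszul_homotopy_def
proof (rule finsum_hcomp)
  fix a assume "a \<in> {..<n} - \<tau>"
  then have a: "a < n" "a \<notin> \<tau>"
    by simp_all
  have "cech_sign a (insert a \<tau>) * w a \<in> mpoly_hcomp n (0 + d)"
    using w[OF a(1)] by (rule hcomp_mult[OF cech_sign_hcomp])
  from hcomp_smult[OF this funcset_mem[OF m cech_faces_insert[OF \<tau> a]]]
  show "(cech_sign a (insert a \<tau>) * w a) \<odot> m (insert a \<tau>) \<in> hcomp M (d + j)"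
    by simp
qed

text \<open>With \<open>d\<close> the Koszul differential and \<open>h\<close> the contraction, this
  is the homotopy formula for \<open>d h + h d\<close> on an element with \<open>d m = 0\<close>.
  Reinserting the removed index gives the part of the sum over \<open>\<rho>\<close>; the other
  terms, regrouped by the inserted index \<open>a\<close>, give the part outside
  \<open>\<rho>\<close> by the cocycle condition on \<open>insert a \<rho>\<close>.\<close>

lemma koszul_koszul_homotopy:
  assumes m: "m \<in> cech_faces n (Suc i) \<rightarrow> carrier M" and w: "\<And>a. a < n \<Longrightarrow> w a \<in> polys n"
    and K: "\<And>\<tau>. \<tau> \<in> cech_faces n (Suc (Suc i)) \<Longrightarrow> koszul t m \<tau> = \<zero>"
    and \<rho>: "\<rho> \<in> cech_faces n (Suc i)"
  shows "koszul t (koszul_homotopy w m) \<rho> = (\<Sum>a<n. w a * indet a ^ t) \<odot> m \<rho>"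
proof -
  note D = cech_facesD[OF \<rho>]
  let ?C = "{..<n} - \<rho>"
  let ?x = "\<lambda>a. indet a ^ t :: 'k mpoly"
  \<comment> \<open>The term in which \<open>b\<close> is removed and \<open>a\<close> inserted,
    written with the signs of \<open>insert a \<rho>\<close>. For fixed \<open>a\<close> these are,
    up to a common factor, the terms of \<open>koszul t m (insert a \<rho>)\<close>.\<close>
  define T where "T b a = (- (cech_sign a (insert a \<rho>) * w a) * (cech_sign b (insert a \<rho>) * ?x b)) \<odot>
      m (insert a \<rho> - {b})" for b a
  have x: "?x a \<in> polys n" if "a < n" for a
    using that by simp
  have b_n: "b < n" if "b \<in> \<rho>" for b
    using that D(2) by blast
  have m_\<rho>: "m \<rho> \<in> carrier M"
    using m \<rho> by blast
  have m_T: "m (insert a \<rho> - {b}) \<in> carrier M" if "a \<in> ?C" "b \<in> \<rho>" for a b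
  proof -
    have "insert a \<rho> \<in> cech_faces n (Suc (Suc i))"
      using that by (intro cech_faces_insert \<rho>) simp_all
    then have "insert a \<rho> - {b} \<in> cech_faces n (Suc i)"
      using that by (intro cech_faces_remove) simp_all
    then show ?thesis
      using m by blast
  qed
  have T_closed: "T b a \<in> carrier M" if "a \<in> ?C" "b \<in> \<rho>" for a b
    unfolding T_def using m_T[OF that] w[of a] x[OF b_n[OF that(2)]] that by simp
  have summand: "(cech_sign b \<rho> * ?x b) \<odot> koszul_homotopy w m (\<rho> - {b}) =
      (w b * ?x b) \<odot> m \<rho> \<oplus> (\<Oplus>a\<in>?C. T b a)" if b: "b \<in> \<rho>" for b
  proof -
    have ins: "insert b (\<rho> - {b}) = \<rho>" "{..<n} - (\<rho> - {b}) = insert b ?C"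
      using b b_n by auto
    let ?u = "\<lambda>a. (cech_sign a (insert a (\<rho> - {b})) * w a) \<odot> m (insert a (\<rho> - {b}))"
    have ins': "insert a (\<rho> - {b}) = insert a \<rho> - {b}" if "a \<in> ?C" for a
      using that b by auto
    have u_closed: "?u a \<in> carrier M" if "a \<in> ?C" for a
      using m_T[OF that b] w[of a] that unfolding ins'[OF that] by simp
    have split: "koszul_homotopy w m (\<rho> - {b}) = ?u b \<oplus> (\<Oplus>a\<in>?C. ?u a)"
      unfolding koszul_homotopy_def ins(2)
    proof (rule M.finsum_insert)
      show "?u \<in> ?C \<rightarrow> carrier M"
        using u_closed by (rule funcsetI)
    qed (use b w[OF b_n[OF b]] m_\<rho> in \<open>simp_all add: insert_absorb\<close>)
    have distr: "(cech_sign b \<rho> * ?x b) \<odot> koszul_homotopy w m (\<rho> - {b}) =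
        (cech_sign b \<rho> * ?x b) \<odot> ?u b \<oplus> (cech_sign b \<rho> * ?x b) \<odot> (\<Oplus>a\<in>?C. ?u a)"
      unfolding split using x[OF b_n[OF b]] w[OF b_n[OF b]] m_\<rho> u_closed
      by (intro smult_r_distr M.finsum_closed funcsetI) (simp_all add: insert_absorb b)
    have diag: "(cech_sign b \<rho> * ?x b) \<odot> ?u b = (w b * ?x b) \<odot> m \<rho>"
    proof -
      have "cech_sign b \<rho> * ?x b * (cech_sign b \<rho> * w b) =
          (cech_sign b \<rho> * cech_sign b \<rho>) * (w b * ?x b)"
        by (simp only: mult_ac)
      then have e: "cech_sign b \<rho> * ?x b * (cech_sign b \<rho> * w b) = w b * ?x b"
        by (simp only: cech_sign_sq mult_1_left)
      show ?thesis
        unfolding ins(1) using x[OF b_n[OF b]] w[OF b_n[OF b]] m_\<rho> by (subst smult_smult) (simp_all add: e)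
    qed
    have "(cech_sign b \<rho> * ?x b) \<odot> (\<Oplus>a\<in>?C. ?u a) = (\<Oplus>a\<in>?C. (cech_sign b \<rho> * ?x b) \<odot> ?u a)"
      using x[OF b_n[OF b]] u_closed by (intro finsum_smult_ldistr funcsetI) simp_all
    also have "\<dots> = (\<Oplus>a\<in>?C. T b a)"
    proof (intro M.finsum_cong' refl funcsetI)
      fix a assume a: "a \<in> ?C"
      show "T b a \<in> carrier M"
        using T_closed a b by blast
      have "cech_sign b \<rho> * ?x b * (cech_sign a (insert a (\<rho> - {b})) * w a) =
          (cech_sign b \<rho> * cech_sign a (insert a (\<rho> - {b}))) * (?x b * w a)"
        by (simp only: mult_ac)
      also have "\<dots> = - (cech_sign a (insert a \<rho>) * w a) * (cech_sign b (insert a \<rho>) * ?x b)"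
        using a by (subst cech_sign_flip[OF D(1) b])
          (simp_all only: Diff_iff simp_thms mult_minus_left mult_minus_right mult_ac)
      finally show "(cech_sign b \<rho> * ?x b) \<odot> ?u a = T b a"
        unfolding T_def ins'[OF a] using m_T[OF a b] w[of a] x[OF b_n[OF b]] a
        by (simp del: insert_Diff_if)
    qed
    finally show ?thesis
      unfolding distr diag by (rule arg_cong)
  qed
  \<comment> \<open>The cocycle condition on \<open>insert a \<rho>\<close> expresses the sum over
    \<open>b\<close> in \<open>\<rho>\<close> as the negative of the term at \<open>a\<close>. The
    minus sign in \<open>T\<close> cancels this one, and the sign of \<open>a\<close> occurs
    twice.\<close>
  have inner: "(\<Oplus>b\<in>\<rho>. T b a) = (w a * ?x a) \<odot> m \<rho>" if a: "a \<in> ?C" for a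
  proof -
    let ?v = "\<lambda>b. (cech_sign b (insert a \<rho>) * ?x b) \<odot> m (insert a \<rho> - {b})"
    have a': "a < n" "a \<notin> \<rho>"
      using a by simp_all
    have v_closed: "?v b \<in> carrier M" if "b \<in> \<rho>" for b
      using m_T[OF a that] x[OF b_n[OF that]] by simp
    have va: "?v a = (cech_sign a (insert a \<rho>) * ?x a) \<odot> m \<rho>"
      unfolding Diff_insert_absorb[OF a'(2)] ..
    have va_closed: "?v a \<in> carrier M"
      unfolding va using m_\<rho> x[OF a'(1)] by simp
    have "\<zero> = koszul t m (insert a \<rho>)"
      using K[OF cech_faces_insert[OF \<rho> a']] by (rule sym)
    also have "\<dots> = ?v a \<oplus> (\<Oplus>b\<in>\<rho>. ?v b)"
      unfolding koszul_def using D(1) a'(2) v_closed va_closed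
      by (intro M.finsum_insert funcsetI)
    finally have zero: "?v a \<oplus> (\<Oplus>b\<in>\<rho>. ?v b) = \<zero>" ..
    have sum_closed: "(\<Oplus>b\<in>\<rho>. ?v b) \<in> carrier M"
      using v_closed by (intro M.finsum_closed funcsetI)
    have "(\<Oplus>b\<in>\<rho>. ?v b) \<oplus> ?v a = \<zero>"
      unfolding zero[symmetric] using sum_closed va_closed by (rule M.a_comm)
    then have sum_v: "(\<Oplus>b\<in>\<rho>. ?v b) = \<ominus> ?v a"
      using va_closed sum_closed by (rule M.minus_equality[symmetric])
    let ?e = "- (cech_sign a (insert a \<rho>) * w a)"
    have e: "?e \<in> polys n"
      using w[OF a'(1)] by simp
    have "(\<Oplus>b\<in>\<rho>. T b a) = (\<Oplus>b\<in>\<rho>. ?e \<odot> ?v b)"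
    proof (intro M.finsum_cong' refl funcsetI)
      fix b assume b: "b \<in> \<rho>"
      show "?e \<odot> ?v b \<in> carrier M"
        using e v_closed[OF b] by (rule smult_closed)
      show "T b a = ?e \<odot> ?v b"
        unfolding T_def using e m_T[OF a b] x[OF b_n[OF b]]
        by (subst smult_smult) simp_all
    qed
    also have "\<dots> = ?e \<odot> (\<Oplus>b\<in>\<rho>. ?v b)"
      using D(1) e v_closed by (intro finsum_smult_ldistr[symmetric] funcsetI)
    also have "\<dots> = \<ominus> (?e \<odot> ?v a)"
      unfolding sum_v using e va_closed by (rule smult_r_minus)
    also have "\<dots> = (- ?e) \<odot> ?v a"
      using e va_closed by (rule uminus_smult[symmetric])
    also have "\<dots> = (w a * ?x a) \<odot> m \<rho>"
    proof -
      have "(cech_sign a (insert a \<rho>) * w a) * (cech_sign a (insert a \<rho>) * ?x a) =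
          (cech_sign a (insert a \<rho>) * cech_sign a (insert a \<rho>)) * (w a * ?x a)"
        by (simp only: mult_ac)
      then have e': "(cech_sign a (insert a \<rho>) * w a) * (cech_sign a (insert a \<rho>) * ?x a) = w a * ?x a"
        by (simp only: cech_sign_sq mult_1_left)
      show ?thesis
        unfolding va minus_minus using w[OF a'(1)] x[OF a'(1)] m_\<rho>
        by (subst smult_smult) (simp_all add: e')
    qed
    finally show ?thesis .
  qed
  have wx_closed: "(w a * ?x a) \<odot> m \<rho> \<in> carrier M" if "a < n" for a
    using w[OF that] x[OF that] m_\<rho> by simp
  have 1: "(\<Oplus>b\<in>\<rho>. (w b * ?x b) \<odot> m \<rho>) = (\<Sum>b\<in>\<rho>. w b * ?x b) \<odot> m \<rho>"
    using w x b_n D(1) m_\<rho> by (intro sum_smult[symmetric]) simp_all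
  have "(\<Oplus>b\<in>\<rho>. \<Oplus>a\<in>?C. T b a) = (\<Oplus>a\<in>?C. \<Oplus>b\<in>\<rho>. T b a)"
    using D(1) T_closed by (intro finsum_swap) simp_all
  also have "\<dots> = (\<Oplus>a\<in>?C. (w a * ?x a) \<odot> m \<rho>)"
    using wx_closed by (intro M.finsum_cong' refl funcsetI inner) simp_all
  also have "\<dots> = (\<Sum>a\<in>?C. w a * ?x a) \<odot> m \<rho>"
    using w x m_\<rho> by (intro sum_smult[symmetric]) simp_all
  finally have 2: "(\<Oplus>b\<in>\<rho>. \<Oplus>a\<in>?C. T b a) = (\<Sum>a\<in>?C. w a * ?x a) \<odot> m \<rho>" .
  have "koszul t (koszul_homotopy w m) \<rho> = (\<Oplus>b\<in>\<rho>. (w b * ?x b) \<odot> m \<rho> \<oplus> (\<Oplus>a\<in>?C. T b a))"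
    unfolding koszul_def
    by (intro M.finsum_cong' refl funcsetI summand M.add.m_closed M.finsum_closed wx_closed b_n T_closed)
  also have "\<dots> = (\<Oplus>b\<in>\<rho>. (w b * ?x b) \<odot> m \<rho>) \<oplus> (\<Oplus>b\<in>\<rho>. \<Oplus>a\<in>?C. T b a)"
    by (intro M.finsum_addf funcsetI M.finsum_closed wx_closed b_n T_closed)
  also have "\<dots> = ((\<Sum>b\<in>\<rho>. w b * ?x b) + (\<Sum>a\<in>?C. w a * ?x a)) \<odot> m \<rho>"
    unfolding 1 2 using w x b_n m_\<rho> by (intro add_smult[symmetric] polys_sum) simp_all
  also have "(\<Sum>b\<in>\<rho>. w b * ?x b) + (\<Sum>a\<in>?C. w a * ?x a) = (\<Sum>a<n. w a * ?x a)"
    using sum.subset_diff[OF D(2) finite_lessThan, of "\<lambda>a. w a * ?x a"] by (simp only: add.commute)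
  finally show ?thesis .
qed

text \<open>For a cocycle with exponent \<open>t\<close> the homotopy gives
  \<open>d h = s m\<close>, and dividing \<open>h\<close> by \<open>s\<close> yields a preimage. The
  division takes place on faces of size \<open>Suc i\<close>, which are non-empty and so contain an
  inverted variable; this is why the statement starts in degree two.\<close>

lemma coh_trivial_of_parameter:
  assumes par: "\<And>t. \<exists>d s w k g. s \<in> mpoly_hcomp n d \<and>
    (\<forall>a<n. w a \<in> mpoly_hcomp n (d - int t)) \<and> s = (\<Sum>a<n. w a * indet a ^ t) \<and>
    (\<forall>a<n. g a \<in> mpoly_hcomp n (int k - d) \<and>
      (\<forall>x\<in>carrier M. indet a ^ k \<odot> x = (s * g a) \<odot> x))"
  shows "coh_trivial (Suc (Suc i)) j"
  unfolding coh_trivial_Suc_iff[of "Suc i"]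
proof (intro allI ballI impI)
  fix t m assume m: "m \<in> cech_faces n (Suc (Suc i)) \<rightarrow> hcomp M (j + int (t * Suc (Suc i)))"
    and K: "\<forall>\<tau>\<in>cech_faces n (Suc (Suc (Suc i))). koszul t m \<tau> = \<zero>"
  obtain d s w k g where s: "s \<in> mpoly_hcomp n d"
    and w: "\<And>a. a < n \<Longrightarrow> w a \<in> mpoly_hcomp n (d - int t)" and s_eq: "s = (\<Sum>a<n. w a * indet a ^ t)"
    and g: "\<And>a. a < n \<Longrightarrow> g a \<in> mpoly_hcomp n (int k - d)"
    and inv: "\<And>a x. a < n \<Longrightarrow> x \<in> carrier M \<Longrightarrow> indet a ^ k \<odot> x = (s * g a) \<odot> x"
    using par[of t] by blast
  note s' = hcomp_polys[OF s] and w' = hcomp_polys[OF w] and g' = hcomp_polys[OF g]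
  note mc = cochain_carrier[OF m]
  define h where "h = koszul_homotopy w m"
  have h: "h \<tau> \<in> hcomp M (d + j + int (t * Suc i))" if "\<tau> \<in> cech_faces n (Suc i)" for \<tau>
    using koszul_homotopy_hcomp[OF m w that] by (simp add: h_def algebra_simps)
  have hc: "h \<in> cech_faces n (Suc i) \<rightarrow> carrier M"
    using h hcomp_carrier by blast
  \<comment> \<open>The quotient \<open>h \<tau> / s\<close>. For \<open>a\<close> in
    \<open>\<tau>\<close>, \<open>indet a ^ k\<close> acts as \<open>s * g a\<close>, so dividing by
    \<open>s\<close> amounts to multiplying by \<open>g a / indet a ^ k\<close>; the factor
    \<open>xm (\<tau> - {a}) ^ k\<close> brings the result over the exponent \<open>t + k\<close>.
    \<open>Min\<close> just selects such an \<open>a\<close>.\<close>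
  define b where "b \<tau> = (g (Min \<tau>) * xm (\<tau> - {Min \<tau>}) ^ k) \<odot> h \<tau>" for \<tau>
  have face: "Min \<tau> \<in> \<tau>" "Min \<tau> < n" "xm (\<tau> - {Min \<tau>}) \<in> mpoly_hcomp n (int l)"
    if "\<tau> \<in> cech_faces n (Suc l)" for \<tau> l
  proof -
    note D = cech_facesD[OF that]
    show 1: "Min \<tau> \<in> \<tau>"
      using D(1,3) by (intro Min_in) auto
    then show "Min \<tau> < n"
      using D(2) by blast
    show "xm (\<tau> - {Min \<tau>}) \<in> mpoly_hcomp n (int l)"
      using xm_hcomp[OF cech_facesD(2)[OF cech_faces_remove[OF that 1]]]
      by (simp only: cech_facesD(3)[OF cech_faces_remove[OF that 1]])
  qed
  have b: "b \<in> cech_faces n (Suc i) \<rightarrow> hcomp M (j + int ((t + k) * Suc i))"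
  proof
    fix \<tau> assume \<tau>: "\<tau> \<in> cech_faces n (Suc i)"
    show "b \<tau> \<in> hcomp M (j + int ((t + k) * Suc i))"
      using hcomp_smult[OF hcomp_mult[OF g[OF face(2)[OF \<tau>]] hcomp_power[OF face(3)[OF \<tau>], of k]] h[OF \<tau>]]
      by (simp add: b_def algebra_simps)
  qed
  have s_b: "s \<odot> b \<tau> = xm \<tau> ^ k \<odot> h \<tau>" if \<tau>: "\<tau> \<in> cech_faces n (Suc i)" for \<tau>
  proof -
    let ?a = "Min \<tau>"
    let ?y = "xm (\<tau> - {?a}) :: 'k mpoly"
    have h\<tau>: "h \<tau> \<in> carrier M"
      using hc \<tau> by blast
    have y: "?y \<in> polys n"
      using face(3)[OF \<tau>] by (rule hcomp_polys)
    have "s \<odot> b \<tau> = (s * g ?a) \<odot> (?y ^ k \<odot> h \<tau>)"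
      unfolding b_def using s' g'[OF face(2)[OF \<tau>]] y h\<tau> by (simp add: mult_ac)
    also have "\<dots> = indet ?a ^ k \<odot> (?y ^ k \<odot> h \<tau>)"
      using y h\<tau> by (intro inv[symmetric] face(2)[OF \<tau>]) simp
    also have "\<dots> = (indet ?a * ?y) ^ k \<odot> h \<tau>"
      using y h\<tau> face(2)[OF \<tau>] by (simp add: power_mult_distrib)
    finally show ?thesis
      unfolding xm_remove[OF cech_facesD(1)[OF \<tau>] face(1)[OF \<tau>]] .
  qed
  have "frac (xm \<rho>) (m \<rho>) t = frac (xm \<rho>) (koszul (t + k) b \<rho>) (t + k)"
    if \<rho>: "\<rho> \<in> cech_faces n (Suc (Suc i))" for \<rho>
  proof -
    let ?a = "Min \<rho>"
    let ?y = "xm (\<rho> - {?a}) :: 'k mpoly"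
    let ?z = "koszul (t + k) b \<rho>"
    let ?u = "xm \<rho> ^ k \<odot> m \<rho>"
    have z: "?z \<in> carrier M"
      using \<rho> cochain_carrier[OF b] by (rule koszul_closed)
    have m\<rho>: "m \<rho> \<in> carrier M"
      using mc \<rho> by blast
    have x: "(xm \<rho> :: 'k mpoly) \<in> polys n"
      using cech_facesD(2)[OF \<rho>] by simp
    have u: "?u \<in> carrier M"
      using x m\<rho> by simp
    have y: "?y \<in> polys n"
      using face(3)[OF \<rho>] by (rule hcomp_polys)
    have "s \<odot> ?z = koszul (t + k) (\<lambda>\<tau>. s \<odot> b \<tau>) \<rho>"
      using \<rho> cochain_carrier[OF b] s' by (rule koszul_smult[symmetric])
    also have "\<dots> = koszul (t + k) (\<lambda>\<tau>. xm \<tau> ^ k \<odot> h \<tau>) \<rho>"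
    proof (rule koszul_cong[OF \<rho>])
      show "(\<lambda>\<tau>. xm \<tau> ^ k \<odot> h \<tau>) \<in> cech_faces n (Suc i) \<rightarrow> carrier M"
        using hc cech_facesD(2) by (intro funcsetI smult_closed polys_power xm_polys) blast+
    qed (rule s_b)
    also have "\<dots> = xm \<rho> ^ k \<odot> koszul t h \<rho>"
      using \<rho> hc by (rule koszul_expand)
    also have "koszul t h \<rho> = s \<odot> m \<rho>"
      unfolding h_def s_eq by (intro koszul_koszul_homotopy[OF mc w' _ \<rho>]) (use K in simp_all)
    also have "xm \<rho> ^ k \<odot> (s \<odot> m \<rho>) = s \<odot> ?u"
      using s' x m\<rho> by (simp add: mult.commute)
    finally have sz: "s \<odot> ?z = s \<odot> ?u" .
    \<comment> \<open>\<open>s\<close> need not be cancellable on \<open>M\<close>, but multiplying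
      by \<open>g ?a\<close> turns it into a power of a variable that is inverted at
      \<open>\<rho>\<close>.\<close>
    have "indet ?a ^ k \<odot> v = g ?a \<odot> (s \<odot> v)" if "v \<in> carrier M" for v
      using inv[OF face(2)[OF \<rho>] that] s' g'[OF face(2)[OF \<rho>]] that by (simp add: mult.commute)
    then have "indet ?a ^ k \<odot> ?z = indet ?a ^ k \<odot> ?u"
      using z u sz by metis
    \<comment> \<open>The factor \<open>?y ^ k\<close> completes \<open>indet ?a ^ k\<close> to
      \<open>xm \<rho> ^ k\<close>, and \<open>xm \<rho> ^ t\<close> comes from cross-multiplying
      with the denominator of \<open>m \<rho>\<close>.\<close>
    then have "(xm \<rho> ^ t * ?y ^ k) \<odot> (indet ?a ^ k \<odot> ?z) = (xm \<rho> ^ t * ?y ^ k) \<odot> (indet ?a ^ k \<odot> ?u)"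
      by (rule arg_cong)
    moreover have "(xm \<rho> ^ t * ?y ^ k) \<odot> (indet ?a ^ k \<odot> v) = xm \<rho> ^ (k + t) \<odot> v" if v: "v \<in> carrier M" for v
    proof -
      have "xm \<rho> ^ t * ?y ^ k * indet ?a ^ k = xm \<rho> ^ t * (indet ?a * ?y) ^ k"
        by (simp only: power_mult_distrib mult_ac)
      also have "\<dots> = xm \<rho> ^ (k + t)"
        unfolding xm_remove[OF cech_facesD(1)[OF \<rho>] face(1)[OF \<rho>]] by (simp only: power_add mult_ac)
      finally have e: "xm \<rho> ^ t * ?y ^ k * indet ?a ^ k = xm \<rho> ^ (k + t)" .
      show ?thesis
        using v x y face(2)[OF \<rho>] by (subst smult_smult) (simp_all add: e)
    qed
    ultimately have "xm \<rho> ^ (k + t) \<odot> ?z = xm \<rho> ^ (k + t) \<odot> ?u"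
      using z u by simp
    also have "\<dots> = xm \<rho> ^ (k + (t + k)) \<odot> m \<rho>"
      using x m\<rho> by (simp add: power_add mult_ac)
    finally show ?thesis
      using x m\<rho> z by (subst frac_eq_iff) (auto intro!: exI[of _ k])
  qed
  then show "\<exists>t'. \<exists>b\<in>cech_faces n (Suc i) \<rightarrow> hcomp M (j + int (t' * Suc i)).
      cochain (Suc (Suc i)) m t = cochain (Suc (Suc i)) (koszul t' b) t'"
    using b unfolding cochain_eq_iff by blast
qed

end

text \<open>Krull's argument: by Zorn there is an ideal \<open>P\<close> maximal among those over
  \<open>J\<close> that miss \<open>S\<close>. For \<open>a\<close> and \<open>b\<close> outside
  \<open>P\<close>, both \<open>P + (a)\<close> and \<open>P + (b)\<close> meet \<open>S\<close>;
  the product of two such elements lies in \<open>S\<close>, and would lie in \<open>P\<close> if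
  \<open>a \<otimes> b\<close> did.\<close>

lemma (in cring) exists_primeideal_disjoint:
  assumes "ideal J R" and S: "S \<subseteq> carrier R" "\<one> \<in> S" "\<And>x y. x \<in> S \<Longrightarrow> y \<in> S \<Longrightarrow> x \<otimes> y \<in> S"
    and disj: "J \<inter> S = {}"
  shows "\<exists>P. primeideal P R \<and> J \<subseteq> P \<and> P \<inter> S = {}"
proof -
  let ?A = "{P. ideal P R \<and> J \<subseteq> P \<and> P \<inter> S = {}}"
  have "\<exists>P\<in>?A. \<forall>Q\<in>?A. P \<subseteq> Q \<longrightarrow> Q = P"
  proof (rule subset_Zorn_nonempty)
    show "?A \<noteq> {}"
      using assms(1) disj by blast
  next
    fix C assume C: "C \<noteq> {}" "subset.chain ?A C"
    then have "subset.chain {I. ideal I R} C"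
      unfolding subset.chain_def by blast
    from chain_Union_is_ideal[OF this] C(1) have "ideal (\<Union>C) R"
      by simp
    then show "\<Union>C \<in> ?A"
      using C unfolding subset.chain_def by blast
  qed
  then obtain P where P_A: "P \<in> ?A" and P_max: "\<forall>Q\<in>?A. P \<subseteq> Q \<longrightarrow> Q = P" ..
  have P: "ideal P R" "J \<subseteq> P" "P \<inter> S = {}"
    using P_A by simp_all
  have max: "Q = P" if "ideal Q R" "J \<subseteq> Q" "Q \<inter> S = {}" "P \<subseteq> Q" for Q
    using bspec[OF P_max, of Q] that by simp
  interpret P: ideal P R
    by (rule P(1))
  have ext: "\<exists>p\<in>P. \<exists>r\<in>carrier R. p \<oplus> r \<otimes> a \<in> S" if a: "a \<in> carrier R" "a \<notin> P" for a
  proof -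
    let ?Q = "set_add R P (PIdl a)"
    have Q_I: "p \<oplus> r \<otimes> a \<in> ?Q" if "p \<in> P" "r \<in> carrier R" for p r
    proof -
      have "r \<otimes> a \<in> PIdl a"
        unfolding cgenideal_def using that(2) by blast
      then show ?thesis
        unfolding set_add_def' using that(1) by blast
    qed
    have Q_E: "\<exists>p\<in>P. \<exists>r\<in>carrier R. x = p \<oplus> r \<otimes> a" if x: "x \<in> ?Q" for x
    proof -
      obtain p q where pq: "p \<in> P" "q \<in> PIdl a" "x = p \<oplus> q"
        using x unfolding set_add_def' by blast
      from pq(2) obtain r where "r \<in> carrier R" "q = r \<otimes> a"
        unfolding cgenideal_def by blast
      then have "x = p \<oplus> r \<otimes> a"
        using pq(3) by simp
      then show ?thesis
        by (intro bexI[of _ p] bexI[of _ r] pq(1) \<open>r \<in> carrier R\<close>)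
    qed
    have Q: "ideal ?Q R"
      by (rule add_ideals[OF P(1) cgenideal_ideal[OF a(1)]])
    have P_Q: "P \<subseteq> ?Q"
    proof
      fix p assume p: "p \<in> P"
      show "p \<in> ?Q"
        using Q_I[OF p zero_closed] a(1) P.Icarr[OF p] by (simp only: l_null r_zero)
    qed
    have a_Q: "a \<in> ?Q"
      using Q_I[OF P.zero_closed one_closed] a(1) by (simp only: l_one l_zero)
    have "?Q \<inter> S \<noteq> {}"
    proof
      assume "?Q \<inter> S = {}"
      with Q P_Q have "?Q = P"
        by (intro max subset_trans[OF P(2)])
      then show False
        using a_Q a(2) by simp
    qed
    then obtain x where x: "x \<in> ?Q" "x \<in> S"
      by blast
    obtain p r where pr: "p \<in> P" "r \<in> carrier R" "x = p \<oplus> r \<otimes> a"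
      using Q_E[OF x(1)] by (elim bexE)
    have "p \<oplus> r \<otimes> a \<in> S"
      using x(2) pr(3) by simp
    then show ?thesis
      by (intro bexI[of _ p] bexI[of _ r] pr)
  qed
  have "primeideal P R"
  proof (rule primeidealI[OF P(1) is_cring])
    show "carrier R \<noteq> P"
      using S(2) P(3) by blast
  next
    fix a b assume ab: "a \<in> carrier R" "b \<in> carrier R" "a \<otimes> b \<in> P"
    show "a \<in> P \<or> b \<in> P"
    proof (rule ccontr)
      assume "\<not> ?thesis"
      then obtain p q r s where p: "p \<in> P" "r \<in> carrier R" "p \<oplus> r \<otimes> a \<in> S"
        and q: "q \<in> P" "s \<in> carrier R" "q \<oplus> s \<otimes> b \<in> S"
        using ext[OF ab(1)] ext[OF ab(2)] by blast
      note closed = p(2) q(2) P.Icarr[OF p(1)] P.Icarr[OF q(1)] ab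
      have "(p \<oplus> r \<otimes> a) \<otimes> (q \<oplus> s \<otimes> b) =
          p \<otimes> (q \<oplus> s \<otimes> b) \<oplus> ((r \<otimes> a) \<otimes> q \<oplus> (r \<otimes> s) \<otimes> (a \<otimes> b))"
        using closed by (simp add: l_distr r_distr a_assoc a_lcomm m_assoc m_lcomm)
      also have "\<dots> \<in> P"
        using closed
        by (intro P.a_closed P.I_r_closed[OF p(1)] P.I_l_closed[OF q(1)] P.I_l_closed[OF ab(3)]) simp_all
      finally show False
        using S(3)[OF p(3) q(3)] P(3) by blast
    qed
  qed
  then show ?thesis
    using P by blast
qed

text \<open>The ideal of the variables, seen as the kernel of evaluation at the origin, a ring
  homomorphism to a field. It will be the top of a chain of primes.\<close>

lemma constant_free_primeideal:
  "primeideal {p \<in> polys n. Poly_Mapping.lookup p 0 = (0 :: 'k::field)} (mpoly_ring n)"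
proof (rule primeidealI)
  let ?m = "{p \<in> polys n. Poly_Mapping.lookup p 0 = (0 :: 'k)}"
  interpret cring "mpoly_ring n :: 'k mpoly ring"
    by (rule mpoly_ring_cring)
  show "ideal ?m (mpoly_ring n)"
  proof (rule idealI[OF ring_axioms])
    show "subgroup ?m (add_monoid (mpoly_ring n))"
    proof (rule add.subgroupI)
      fix p assume p: "p \<in> ?m"
      have "\<ominus>\<^bsub>mpoly_ring n\<^esub> p = - p"
        using p by (intro mpoly_ring_uminus) simp
      with p show "\<ominus>\<^bsub>mpoly_ring n\<^esub> p \<in> ?m"
        by simp
    next
      have "(0 :: 'k mpoly) \<in> ?m"
        by simp
      then show "?m \<noteq> {}"
        by (metis empty_iff)
    qed (simp_all add: lookup_add subset_iff)
  qed (simp_all add: lookup_mult_0)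
  show "carrier (mpoly_ring n) \<noteq> ?m"
  proof
    assume "polys n = ?m"
    then have "(1 :: 'k mpoly) \<in> ?m"
      using polys_closed(2) by (rule subst)
    then show False
      by simp
  qed
qed (simp_all add: lookup_mult_0 mpoly_ring_cring)

lemma lookup_indet_0: "Poly_Mapping.lookup (indet a) 0 = 0"
proof -
  have "Poly_Mapping.keys (Poly_Mapping.single a (1 :: nat)) \<noteq> Poly_Mapping.keys 0"
    by simp
  then have "Poly_Mapping.single a (1 :: nat) \<noteq> 0"
    by (rule contrapos_nn) (rule arg_cong)
  then show ?thesis
    unfolding indet_def by (rule lookup_single_not_eq)
qed

text \<open>Each term of the binomial expansion contains \<open>p ^ a\<close> or
  \<open>q ^ b\<close>. Induction on \<open>a + b\<close> avoids the coefficients: of one factor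
  \<open>p + q\<close>, the summand \<open>p\<close> accounts for lowering \<open>a\<close> and the
  summand \<open>q\<close> for lowering \<open>b\<close>.\<close>

lemma power_add_decompose:
  assumes "p \<in> polys n" "q \<in> polys n"
  shows "\<exists>u v. u \<in> polys n \<and> v \<in> polys n \<and> (p + q) ^ (a + b) = p ^ a * u + q ^ b * v"
proof (induction "a + b" arbitrary: a b)
  case 0
  show ?case
    by (rule exI[of _ 1], rule exI[of _ 0]) (use 0 in simp)
next
  case (Suc k)
  show ?case
  proof (cases "a = 0 \<or> b = 0")
    case True
    then show ?thesis
    proof
      assume "a = 0"
      then show ?thesis
        using assms by (intro exI[of _ "(p + q) ^ b"] exI[of _ 0]) simp
    next
      assume "b = 0"
      then show ?thesis
        using assms by (intro exI[of _ 0] exI[of _ "(p + q) ^ a"]) simp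
    qed
  next
    case False
    then obtain a' b' where ab: "a = Suc a'" "b = Suc b'"
      by (metis not0_implies_Suc)
    obtain u v where uv: "u \<in> polys n" "v \<in> polys n" "(p + q) ^ (a' + b) = p ^ a' * u + q ^ b * v"
      using Suc.hyps(1)[of a' b] Suc.hyps(2) ab by auto
    obtain u' v' where uv': "u' \<in> polys n" "v' \<in> polys n" "(p + q) ^ (a + b') = p ^ a * u' + q ^ b' * v'"
      using Suc.hyps(1)[of a b'] Suc.hyps(2) ab by auto
    have "(p + q) ^ (a + b) = p * (p + q) ^ (a' + b) + q * (p + q) ^ (a + b')"
      by (simp add: ab distrib_right)
    also have "\<dots> = p ^ a * (u + q * u') + q ^ b * (p * v + v')"
      unfolding uv(3) uv'(3) by (simp add: ab algebra_simps)
    finally show ?thesis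
      using assms uv uv'
      by (intro exI[of _ "u + q * u'"] exI[of _ "p * v + v'"]) simp
  qed
qed

section \<open>The annihilator of a graded module of dimension at most one\<close>

context graded_module
begin

abbreviation Ann :: "'k mpoly set"
  where "Ann \<equiv> annihilator (mpoly_ring n) M"

lemma Ann_iff: "r \<in> Ann \<longleftrightarrow> r \<in> polys n \<and> (\<forall>x\<in>carrier M. r \<odot> x = \<zero>)"
  by (simp add: annihilator_def)

lemma Ann_add: "r \<in> Ann \<Longrightarrow> s \<in> Ann \<Longrightarrow> r + s \<in> Ann"
  by (simp add: Ann_iff add_smult)

lemma Ann_mult: "r \<in> Ann \<Longrightarrow> s \<in> polys n \<Longrightarrow> s * r \<in> Ann"
  unfolding Ann_iff by (metis polys_closed(4) smult_smult smult_r_null)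

lemma Ann_mult_right: "r \<in> Ann \<Longrightarrow> s \<in> polys n \<Longrightarrow> r * s \<in> Ann"
  by (subst mult.commute) (rule Ann_mult)

lemma Ann_ideal: "ideal Ann (mpoly_ring n)"
proof (rule idealI[OF R.ring_axioms])
  show "subgroup Ann (add_monoid (mpoly_ring n))"
  proof (rule R.add.subgroupI)
    fix r assume r: "r \<in> Ann"
    then have "\<ominus>\<^bsub>mpoly_ring n\<^esub> r = - 1 * r"
      by (simp add: Ann_iff)
    then show "\<ominus>\<^bsub>mpoly_ring n\<^esub> r \<in> Ann"
      using Ann_mult[OF r, of "- 1"] by simp
  next
    have "0 \<in> Ann"
      by (simp add: Ann_iff)
    then show "Ann \<noteq> {}"
      by blast
  qed (simp_all add: Ann_add, simp add: Ann_iff subset_iff)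
qed (simp_all add: Ann_mult Ann_mult_right)

text \<open>Uniqueness of the decomposition of the zero element. Decompositions are indexed by all
  integers, so the family is extended by zero outside \<open>D\<close>.\<close>

lemma homogeneous_independent:
  assumes "finite D" and c: "\<And>d. d \<in> D \<Longrightarrow> c d \<in> hcomp M d" and zero: "(\<Oplus>d\<in>D. c d) = \<zero>"
    and d: "d \<in> D"
  shows "c d = \<zero>"
proof -
  let ?c = "\<lambda>d. if d \<in> D then c d else \<zero>"
  have fin: "finite {d. ?c d \<noteq> \<zero>}"
    by (rule finite_subset[OF _ assms(1)]) auto
  have "(\<Oplus>d\<in>{d. ?c d \<noteq> \<zero>}. ?c d) = (\<Oplus>d\<in>D. c d)"
    using c hcomp_carrier
    by (intro M.add.finprod_mono_neutral_cong_left assms(1)) auto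
  then have 1: "\<zero> = (\<Oplus>d\<in>{d. ?c d \<noteq> \<zero>}. ?c d)"
    using zero by simp
  have 2: "\<zero> = (\<Oplus>d\<in>{d :: int. \<zero> \<noteq> \<zero>}. \<zero>)"
    by (simp add: M.finsum_empty)
  have 3: "\<forall>d. ?c d \<in> hcomp M d"
    using c by simp
  have "?c = (\<lambda>_. \<zero>)"
    using decomposition[OF M.zero_closed] unfolding ex1_iff_ex_Uniq
    by (elim conjE, elim Uniq_D) (intro conjI 3 fin 1, intro conjI allI zero_hcomp 2, simp)
  then show ?thesis
    using d fun_cong[of ?c "\<lambda>_. \<zero>" d] by simp
qed

text \<open>This form fits families of products in which one factor is fixed and homogeneous of
  degree \<open>j\<close>.\<close>

lemma homogeneous_independent_shift:
  assumes "finite D" and c: "\<And>d. d \<in> D \<Longrightarrow> c d \<in> hcomp M (d + j)" and zero: "(\<Oplus>d\<in>D. c d) = \<zero>"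
    and d: "d \<in> D"
  shows "c d = \<zero>"
proof -
  let ?D = "(\<lambda>d. d + j) ` D"
  have "(\<Oplus>e\<in>?D. c (e - j)) = (\<Oplus>d\<in>D. c (d + j - j))"
    using hcomp_carrier[OF c] by (intro M.finsum_reindex inj_onI funcsetI) auto
  then have "(\<Oplus>e\<in>?D. c (e - j)) = \<zero>"
    using zero by simp
  moreover have "c (e - j) \<in> hcomp M e" if e: "e \<in> ?D" for e
    using e c by auto
  ultimately have "c (d + j - j) = \<zero>"
    using assms(1) d by (intro homogeneous_independent[of ?D "\<lambda>e. c (e - j)" "d + j"]) simp_all
  then show ?thesis
    by simp
qed

text \<open>On a homogeneous element the parts of \<open>r\<close> have values of different degrees
  with sum zero, so each value vanishes; homogeneous elements generate the module.\<close>

lemma Ann_hpart: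
  assumes r: "r \<in> Ann"
  shows "hpart e r \<in> Ann"
  unfolding Ann_iff
proof (intro conjI ballI)
  have rp: "r \<in> polys n"
    using r by (simp add: Ann_iff)
  note hp = hpart_hcomp[OF rp]
  show e: "hpart e r \<in> polys n"
    using hp by (rule hcomp_polys)
  have hom: "hpart e r \<odot> x = \<zero>" if x: "x \<in> hcomp M j" for x j
  proof (cases "e \<in> degree_set r")
    case True
    have xc: "x \<in> carrier M"
      using x by (rule hcomp_carrier)
    have "\<zero> = (\<Sum>d\<in>degree_set r. hpart d r) \<odot> x"
      using r xc by (simp add: sum_hpart Ann_iff)
    also have "\<dots> = (\<Oplus>d\<in>degree_set r. hpart d r \<odot> x)"
      using hp hcomp_polys xc by (intro sum_smult) auto
    finally have zero: "(\<Oplus>d\<in>degree_set r. hpart d r \<odot> x) = \<zero>" ..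
    have "hpart d r \<odot> x \<in> hcomp M (d + j)" for d
      using hp x by (rule hcomp_smult)
    then show ?thesis
      by (intro homogeneous_independent_shift[OF finite_degree_set _ zero True])
  next
    case False
    then have "hpart e r = 0"
      by (intro poly_mapping_eqI) (simp add: lookup_hpart degree_set_def image_iff, metis in_keys_iff)
    then show ?thesis
      using hcomp_carrier[OF x] by simp
  qed
  fix x assume x: "x \<in> carrier M"
  obtain c where c: "\<forall>j. c j \<in> hcomp M j" "finite {j. c j \<noteq> \<zero>}" "x = (\<Oplus>j\<in>{j. c j \<noteq> \<zero>}. c j)"
    using decomposition[OF x] by (elim ex1E conjE)
  have "hpart e r \<odot> x = (\<Oplus>j\<in>{j. c j \<noteq> \<zero>}. hpart e r \<odot> c j)"
    unfolding c(3) using c(1) hcomp_carrier by (intro finsum_smult_ldistr c(2) e) blast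
  also have "\<dots> = (\<Oplus>j\<in>{j. c j \<noteq> \<zero>}. \<zero>)"
    using c(1) hom by (intro M.finsum_cong') auto
  also have "\<dots> = \<zero>"
    by (simp add: M.finsum_zero)
  finally show "hpart e r \<odot> x = \<zero>" .
qed

text \<open>If the relation below failed, prime avoidance (twice) would produce primes
  \<open>Ann \<subseteq> P \<subset> Q \<subset> (x\<^sub>0, \<dots>, x\<^bsub>n-1\<^esub>)\<close>; the factors \<open>u\<close> with non-zero constant
  coefficient in the multiplicative sets keep \<open>P\<close> and \<open>Q\<close> inside the ideal of the variables.\<close>

lemma dimension_one_relation:
  assumes dim: "module_dim (mpoly_ring n) M \<le> 1" and a: "a < n" and f: "f \<in> mpoly_hcomp n d"
  shows "\<exists>p q e h. h \<in> mpoly_hcomp n (int e - d) \<and>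
    indet a ^ p * f ^ q * (indet a ^ e - f * h) \<in> Ann"
proof (rule ccontr)
  assume no_rel: "\<not> ?thesis"
  let ?x = "indet a :: 'k mpoly"
  let ?unit = "\<lambda>u :: 'k mpoly. u \<in> polys n \<and> Poly_Mapping.lookup u 0 \<noteq> 0"
  let ?m = "{p \<in> polys n. Poly_Mapping.lookup p 0 = (0 :: 'k)}"
  \<comment> \<open>Avoiding the elements \<open>x^e u - f h\<close> will keep
    \<open>P + (f)\<close> away from all \<open>x^e u\<close>; avoiding the powers of
    \<open>f\<close> keeps \<open>f\<close> outside \<open>P\<close>.\<close>
  define S where "S = {?x ^ p * f ^ q * (?x ^ e * u - f * h) | p q e u h. ?unit u \<and> h \<in> polys n}"
  define S' where "S' = {?x ^ e * u | e u. ?unit u}"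
  have x: "?x \<in> polys n"
    using a by simp
  have fp: "f \<in> polys n"
    using f by (rule hcomp_polys)
  have unit_1: "?unit 1"
    by simp
  have unit_mult: "?unit (u * v)" if "?unit u" "?unit v" for u v
    using that by (simp add: lookup_mult_0)
  have SI: "?x ^ p * f ^ q * (?x ^ e * u - f * h) \<in> S" if "?unit u" "h \<in> polys n" for p q e u h
    unfolding S_def using that by blast
  have S'I: "?x ^ e * u \<in> S'" if "?unit u" for e u
    unfolding S'_def using that by blast
  have "Ann \<inter> S = {}"
  proof (rule ccontr)
    assume "Ann \<inter> S \<noteq> {}"
    then obtain p q e u h where u: "?unit u" and h: "h \<in> polys n"
      and Ann: "?x ^ p * f ^ q * (?x ^ e * u - f * h) \<in> Ann"
      unfolding S_def by blast
    \<comment> \<open>Taking homogeneous parts of the right degree leaves only the constant term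
      \<open>c\<close> of \<open>u\<close>. Dividing by it gives \<open>x^e\<close> the coefficient
      1, which is the excluded relation.\<close>
    define c where "c = Poly_Mapping.lookup u 0"
    define h' where "h' = Poly_Mapping.single 0 (inverse c) * hpart (int e - d) h"
    have c: "c \<noteq> 0"
      using u by (simp add: c_def)
    have h': "h' \<in> mpoly_hcomp n (int e - d)"
      using hcomp_mult[OF hcomp_single hpart_hcomp[OF h]] by (simp add: h'_def)
    let ?D = "int p + int q * d"
    have xf: "?x ^ p * f ^ q \<in> mpoly_hcomp n ?D"
      by (rule hcomp_mult[OF hcomp_indet_power[OF a] hcomp_power[OF f]])
    have "hpart (?D + int e) (?x ^ p * f ^ q * (?x ^ e * u - f * h)) =
        ?x ^ p * f ^ q * hpart (int e) (?x ^ e * u - f * h)"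
      using u h x fp by (subst hpart_mult[OF xf]) simp_all
    also have "hpart (int e) (?x ^ e * u - f * h) =
        ?x ^ e * hpart 0 u - f * hpart (int e - d) h"
      using u h hpart_mult[OF hcomp_indet_power[OF a, of e], of u "int e"] hpart_mult[OF f h, of "int e"]
      by (simp add: hpart_diff)
    finally have "?x ^ p * f ^ q * (?x ^ e * hpart 0 u - f * hpart (int e - d) h) \<in> Ann"
      using Ann_hpart[OF Ann, of "?D + int e"] by simp
    then have "Poly_Mapping.single 0 (inverse c) *
        (?x ^ p * f ^ q * (?x ^ e * hpart 0 u - f * hpart (int e - d) h)) \<in> Ann"
      by (rule Ann_mult) simp
    moreover have "Poly_Mapping.single 0 (inverse c) * hpart 0 u = 1"
      using c by (simp add: hpart_0_eq_single mult_single c_def)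
    then have "Poly_Mapping.single 0 (inverse c) *
        (?x ^ p * f ^ q * (?x ^ e * hpart 0 u - f * hpart (int e - d) h)) =
        ?x ^ p * f ^ q * (?x ^ e - f * h')"
      unfolding h'_def by (simp add: algebra_simps)
    ultimately show False
      using no_rel h' by metis
  qed
  moreover have "S \<subseteq> polys n"
    unfolding S_def using x fp by auto
  moreover have "1 \<in> S"
    using SI[OF unit_1 polys_closed(1), of 0 0 0] by simp
  moreover have "y * z \<in> S" if y: "y \<in> S" and z: "z \<in> S" for y z
  proof -
    obtain p q e u h where u: "?unit u" "h \<in> polys n"
      and y_eq: "y = ?x ^ p * f ^ q * (?x ^ e * u - f * h)"
      using y unfolding S_def by blast
    obtain p' q' e' u' h' where u': "?unit u'" "h' \<in> polys n"
      and z_eq: "z = ?x ^ p' * f ^ q' * (?x ^ e' * u' - f * h')"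
      using z unfolding S_def by blast
    \<comment> \<open>From
      \<open>(A - f h) (B - f h') = A B - f (h B + A h' - f h h')\<close>.\<close>
    let ?h = "h * (?x ^ e' * u') + ?x ^ e * u * h' - f * (h * h')"
    have "y * z = ?x ^ (p + p') * f ^ (q + q') * (?x ^ (e + e') * (u * u') - f * ?h)"
      unfolding y_eq z_eq by (simp add: power_add algebra_simps)
    then show ?thesis
      using SI[OF unit_mult[OF u(1) u'(1)], of ?h "p + p'" "q + q'" "e + e'"] u u' x fp by simp
  qed
  ultimately obtain P where P: "primeideal P (mpoly_ring n)" "Ann \<subseteq> P" "P \<inter> S = {}"
    using R.exists_primeideal_disjoint[OF Ann_ideal, of S] by auto
  interpret P: primeideal P "mpoly_ring n"
    by (rule P(1))
  define Pf where "Pf = {p + f * h | p h. p \<in> P \<and> h \<in> polys n}"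
  have PP: "p \<in> polys n" if "p \<in> P" for p
    using P.Icarr[OF that] .
  have QI: "p + f * h \<in> Pf" if "p \<in> P" "h \<in> polys n" for p h
    unfolding Pf_def using that by blast
  have QE: "\<exists>p h. p \<in> P \<and> h \<in> polys n \<and> y = p + f * h" if "y \<in> Pf" for y
    using that unfolding Pf_def by blast
  have Pf_ideal: "ideal Pf (mpoly_ring n)"
  proof (rule idealI[OF R.ring_axioms])
    show "subgroup Pf (add_monoid (mpoly_ring n))"
    proof (rule R.add.subgroupI)
      show "Pf \<subseteq> carrier (mpoly_ring n)"
        unfolding Pf_def using PP fp by auto
      show "Pf \<noteq> {}"
        using QI[OF P.zero_closed polys_closed(1)] by blast
    next
      fix y assume "y \<in> Pf"
      then obtain p h where ph: "p \<in> P" "h \<in> polys n" "y = p + f * h"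
        using QE by blast
      have "- p \<in> P"
        using P.a_inv_closed[OF ph(1)] PP[OF ph(1)] by simp
      from QI[OF this, of "- h"] have "- y \<in> Pf"
        using ph by simp
      moreover have "\<ominus>\<^bsub>mpoly_ring n\<^esub> y = - y"
        using ph PP fp by (intro mpoly_ring_uminus) simp
      ultimately show "\<ominus>\<^bsub>mpoly_ring n\<^esub> y \<in> Pf"
        by (simp only:)
    next
      fix y z :: "'k mpoly" assume "y \<in> Pf" "z \<in> Pf"
      then obtain p h p' h' where ph: "p \<in> P" "h \<in> polys n" "y = p + f * h"
        "p' \<in> P" "h' \<in> polys n" "z = p' + f * h'"
        using QE by (metis (no_types))
      have "p + p' \<in> P"
        using P.a_closed[OF ph(1,4)] by simp
      from QI[OF this, of "h + h'"] show "y \<oplus>\<^bsub>mpoly_ring n\<^esub> z \<in> Pf"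
        using ph by (simp add: algebra_simps)
    qed
  next
    fix y z :: "'k mpoly" assume "y \<in> Pf" and z: "z \<in> carrier (mpoly_ring n)"
    then obtain p h where ph: "p \<in> P" "h \<in> polys n" "y = p + f * h"
      using QE by blast
    have "z * p \<in> P"
      using P.I_l_closed[OF ph(1) z] by simp
    from QI[OF this, of "z * h"] have zy: "z * y \<in> Pf"
      using ph z by (simp add: algebra_simps)
    then show "z \<otimes>\<^bsub>mpoly_ring n\<^esub> y \<in> Pf"
      by (simp only: mpoly_ring_simps)
    show "y \<otimes>\<^bsub>mpoly_ring n\<^esub> z \<in> Pf"
      using zy by (simp only: mpoly_ring_simps mult.commute[of y z])
  qed
  \<comment> \<open>A common element would place some \<open>x^e u - f h\<close> in
    \<open>P\<close>, although it belongs to \<open>S\<close>.\<close>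
  have Pf_S': "Pf \<inter> S' = {}"
  proof (rule ccontr)
    assume "Pf \<inter> S' \<noteq> {}"
    then obtain p h e u where p: "p \<in> P" "h \<in> polys n" "?unit u" "p + f * h = ?x ^ e * u"
      unfolding S'_def Pf_def by blast
    then have "p = ?x ^ 0 * f ^ 0 * (?x ^ e * u - f * h)"
      by (simp add: algebra_simps)
    then have "p \<in> S"
      using SI[OF p(3,2), of 0 0 e] by simp
    then show False
      using p(1) P(3) by blast
  qed
  have S'_polys: "S' \<subseteq> polys n"
    unfolding S'_def using x by auto
  have S'_1: "1 \<in> S'"
    using S'I[OF unit_1, of 0] by simp
  have S'_mult: "y * z \<in> S'" if y: "y \<in> S'" and z: "z \<in> S'" for y z
  proof -
    obtain e u e' u' where u: "?unit u" "?unit u'" and eq: "y = ?x ^ e * u" "z = ?x ^ e' * u'"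
      using y z unfolding S'_def by blast
    have "y * z = ?x ^ (e + e') * (u * u')"
      unfolding eq by (simp add: power_add mult_ac)
    then show ?thesis
      using S'I[OF unit_mult[OF u]] by simp
  qed
  have "\<exists>Q. primeideal Q (mpoly_ring n) \<and> Pf \<subseteq> Q \<and> Q \<inter> S' = {}"
    by (rule R.exists_primeideal_disjoint) (simp_all add: Pf_ideal Pf_S' S'_polys S'_1 S'_mult)
  then obtain Q where Q: "primeideal Q (mpoly_ring n)" "Pf \<subseteq> Q" "Q \<inter> S' = {}"
    by blast
  interpret Q: primeideal Q "mpoly_ring n"
    by (rule Q(1))
  \<comment> \<open>\<open>f\<close> lies in \<open>Q\<close>, but with \<open>q = 1\<close> and
    trivial remaining data it also lies in \<open>S\<close>, hence not in \<open>P\<close>.\<close>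
  have P_Q: "P \<subset> Q"
  proof (rule psubsetI)
    show "P \<subseteq> Q"
    proof
      fix p assume "p \<in> P"
      from QI[OF this polys_closed(1)] show "p \<in> Q"
        using Q(2) by (simp add: subsetD)
    qed
    have "0 \<in> P"
      using P.zero_closed by simp
    from QI[OF this polys_closed(2)] have "f \<in> Q"
      using Q(2) by (simp add: subsetD)
    moreover have "f \<in> S"
      using SI[OF unit_1 polys_closed(1), of 0 1 0] by simp
    ultimately show "P \<noteq> Q"
      using P(3) by blast
  qed
  \<comment> \<open>With \<open>e = 0\<close>, \<open>S'\<close> contains every polynomial with
    non-zero constant coefficient, which gives the inclusion; with \<open>e = 1\<close> and
    \<open>u = 1\<close> it contains the variable, which makes it strict.\<close>
  have Q_m: "Q \<subset> ?m"
  proof (rule psubsetI)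
    show "Q \<subseteq> ?m"
    proof
      fix y assume y: "y \<in> Q"
      then have yp: "y \<in> polys n"
        using Q.Icarr by blast
      have "Poly_Mapping.lookup y 0 = 0"
      proof (rule ccontr)
        assume "Poly_Mapping.lookup y 0 \<noteq> 0"
        with yp have "y \<in> S'"
          using S'I[of y 0] by simp
        then show False
          using y Q(3) by blast
      qed
      with yp show "y \<in> ?m"
        by simp
    qed
    have "?x \<in> ?m"
      using x by (simp add: lookup_indet_0)
    moreover have "?x \<in> S'"
      using S'I[OF unit_1, of 1] by simp
    ultimately show "Q \<noteq> ?m"
      using Q(3) by blast
  qed
  define ch where "ch i = (if i = 0 then P else if i = 1 then Q else ?m)" for i :: nat
  have strict: "\<forall>i<2. ch i \<subset> ch (Suc i)"
  proof (intro allI impI)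
    fix i :: nat assume "i < 2"
    then consider "i = 0" | "i = 1"
      by linarith
    then show "ch i \<subset> ch (Suc i)"
      using P_Q Q_m by cases (simp_all add: ch_def)
  qed
  have prime: "\<forall>i\<le>2. primeideal (ch i) (mpoly_ring n) \<and> Ann \<subseteq> ch i"
  proof (intro allI impI conjI)
    fix i :: nat assume "i \<le> 2"
    have "primeideal ?m (mpoly_ring n)"
      by (rule constant_free_primeideal)
    then show "primeideal (ch i) (mpoly_ring n)"
      using P(1) Q(1) by (simp add: ch_def)
    have "P \<subseteq> Q" "Q \<subseteq> ?m"
      using P_Q Q_m by (simp_all only: psubset_imp_subset)
    then have "P \<subseteq> ch i"
      using subset_trans[of P Q ?m] by (simp add: ch_def)
    then show "Ann \<subseteq> ch i"
      by (rule subset_trans[OF P(2)])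
  qed
  have "ereal (real 2) \<le> module_dim (mpoly_ring n) M"
    unfolding module_dim_def
    by (rule Sup_upper, rule CollectI, rule exI[of _ 2], intro conjI refl exI[of _ ch] prime strict)
  also have "\<dots> \<le> 1"
    by (rule dim)
  finally show False
    by simp
qed

section \<open>Construction of a homogeneous parameter\<close>

definition in_Ann_plus :: "'k mpoly \<Rightarrow> 'k mpoly \<Rightarrow> bool"
  where "in_Ann_plus s p \<longleftrightarrow> (\<exists>g\<in>polys n. p - s * g \<in> Ann)"

lemma in_Ann_plusI: "\<lbrakk>g \<in> polys n; p - s * g \<in> Ann\<rbrakk> \<Longrightarrow> in_Ann_plus s p"
  unfolding in_Ann_plus_def by (rule bexI)

lemma in_Ann_plus_add:
  assumes "in_Ann_plus s p" "in_Ann_plus s q"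
  shows "in_Ann_plus s (p + q)"
proof -
  obtain g h where g: "g \<in> polys n" "p - s * g \<in> Ann" and h: "h \<in> polys n" "q - s * h \<in> Ann"
    using assms unfolding in_Ann_plus_def by (elim bexE)
  have "(p - s * g) + (q - s * h) = p + q - s * (g + h)"
    by (simp add: algebra_simps)
  with Ann_add[OF g(2) h(2)] have "p + q - s * (g + h) \<in> Ann"
    by (simp only:)
  with g(1) h(1) show ?thesis
    by (intro in_Ann_plusI[of "g + h"]) simp_all
qed

lemma in_Ann_plus_mult:
  assumes "in_Ann_plus s p" "r \<in> polys n"
  shows "in_Ann_plus s (r * p)"
proof -
  obtain g where g: "g \<in> polys n" "p - s * g \<in> Ann"
    using assms(1) unfolding in_Ann_plus_def by (elim bexE)
  have "r * (p - s * g) = r * p - s * (r * g)"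
    by (simp add: algebra_simps)
  with Ann_mult[OF g(2) assms(2)] have "r * p - s * (r * g) \<in> Ann"
    by (simp only:)
  with g(1) assms(2) show ?thesis
    by (intro in_Ann_plusI[of "r * g"]) simp_all
qed

lemma in_Ann_plus_mult': "\<lbrakk>in_Ann_plus s p; r \<in> polys n\<rbrakk> \<Longrightarrow> in_Ann_plus s (p * r)"
  by (subst mult.commute) (rule in_Ann_plus_mult)

lemma in_Ann_plus_Ann: "p \<in> Ann \<Longrightarrow> in_Ann_plus s p"
  by (rule in_Ann_plusI[of 0]) simp_all

lemma in_Ann_plus_self: "g \<in> polys n \<Longrightarrow> in_Ann_plus s (s * g)"
  by (rule in_Ann_plusI[of g]) (simp_all add: Ann_iff)

text \<open>The inductive step replaces \<open>s\<close> by \<open>s' = u\<^sup>\<alpha> + s\<^sup>\<beta>\<close>, where \<open>u = x\<^sup>p (x\<^sup>e - s h)\<close> satisfies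
  \<open>s\<^sup>q u \<in> Ann\<close>. Geometrically, \<open>u\<close> vanishes where \<open>s\<close> does not, and equals a power of
  \<open>x\<close> where \<open>s\<close> vanishes.\<close>

lemma exists_parameter:
  assumes dim: "module_dim (mpoly_ring n) M \<le> 1" and "r \<le> n"
  shows "\<exists>d s w. 0 < d \<and> s \<in> mpoly_hcomp n (int d) \<and> (\<forall>a<r. w a \<in> polys n) \<and>
    s = (\<Sum>a<r. w a * indet a ^ t) \<and> (\<forall>a<r. \<exists>k. in_Ann_plus s (indet a ^ k))"
  using \<open>r \<le> n\<close>
proof (induction r)
  case 0
  \<comment> \<open>The empty sum is zero, which is homogeneous of every degree, so a positive
    \<open>d\<close> may be chosen.\<close>
  show ?case
    by (intro exI[of _ 1] exI[of _ 0] exI[of _ "\<lambda>_. 0"]) simp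
next
  case (Suc r)
  then have "r \<le> n" and r: "r < n"
    by simp_all
  then obtain d s w where d: "0 < d" and s: "s \<in> mpoly_hcomp n (int d)"
    and w: "\<forall>a<r. w a \<in> polys n" and s_eq: "s = (\<Sum>a<r. w a * indet a ^ t)"
    and k: "\<forall>a<r. \<exists>k. in_Ann_plus s (indet a ^ k)"
    using Suc.IH by blast
  let ?x = "indet r :: 'k mpoly"
  obtain p q e h where h: "h \<in> mpoly_hcomp n (int e - int d)"
    and rel: "?x ^ p * s ^ q * (?x ^ e - s * h) \<in> Ann"
    using dimension_one_relation[OF dim r s] by blast
  define v where "v = ?x ^ e - s * h"
  \<comment> \<open>\<open>Suc p\<close> makes the degree \<open>D\<close> of \<open>u\<close>
    positive even if \<open>t\<close>, \<open>p\<close> and \<open>e\<close> are all zero. The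
    factor \<open>?x ^ t\<close> in \<open>u\<close> provides the required multiple of the
    \<open>t\<close>-th power.\<close>
  define m where "m = Suc p"
  define u where "u = ?x ^ t * (?x ^ m * v)"
  define D where "D = t + m + e"
  \<comment> \<open>The factors \<open>d\<close> and \<open>D\<close> give both summands of
    \<open>s'\<close> the same degree \<open>d * D * Suc q\<close>; the factor \<open>Suc q\<close>
    ensures \<open>q \<le> \<beta>\<close>. Both exponents are positive, so a factor can be split
    off either power.\<close>
  define \<alpha> where "\<alpha> = d * Suc q"
  define \<beta> where "\<beta> = D * Suc q"
  define s' where "s' = u ^ \<alpha> + s ^ \<beta>"
  have D: "0 < D"
    by (simp add: D_def m_def)
  have \<alpha>: "0 < \<alpha>" and \<beta>: "0 < \<beta>"
    using d D by (simp_all only: \<alpha>_def \<beta>_def nat_0_less_mult_iff zero_less_Suc simp_thms)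
  have q\<beta>: "q \<le> \<beta>"
  proof -
    have "1 * Suc q \<le> D * Suc q"
      using D by (intro mult_le_mono1) simp
    then show ?thesis
      unfolding \<beta>_def mult_1 by (rule Suc_leD)
  qed
  have sp: "s \<in> polys n" and hp: "h \<in> polys n" and x: "?x \<in> polys n"
    using s h r hcomp_polys by auto
  have "s * h \<in> mpoly_hcomp n (int e)"
    using hcomp_mult[OF s h] by simp
  then have v: "v \<in> mpoly_hcomp n (int e)"
    unfolding v_def by (intro hcomp_diff hcomp_indet_power r)
  have u: "u \<in> mpoly_hcomp n (int D)"
    using hcomp_mult[OF hcomp_indet_power[OF r, of t] hcomp_mult[OF hcomp_indet_power[OF r, of m] v]]
    by (simp add: u_def D_def algebra_simps)
  have vp: "v \<in> polys n" and up: "u \<in> polys n"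
    using v u by (simp_all add: hcomp_polys)
  have su: "s ^ q * u \<in> Ann"
  proof -
    have "s ^ q * u = (?x ^ t * ?x) * (?x ^ p * s ^ q * v)"
      by (simp add: u_def m_def algebra_simps)
    moreover have "(?x ^ t * ?x) * (?x ^ p * s ^ q * v) \<in> Ann"
      unfolding v_def using x by (intro Ann_mult rel) simp
    ultimately show ?thesis
      by (simp only:)
  qed
  have s': "s' \<in> mpoly_hcomp n (int (d * D * Suc q))"
    unfolding s'_def using hcomp_power[OF u, of \<alpha>] hcomp_power[OF s, of \<beta>]
    by (intro hcomp_add) (simp_all only: \<alpha>_def \<beta>_def of_nat_mult mult_ac)
  have s'p: "s' \<in> polys n"
    using s' by (rule hcomp_polys)
  \<comment> \<open>As \<open>s ^ q * u\<close> lies in \<open>Ann\<close>, multiplying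
    \<open>s'\<close> by \<open>s ^ q\<close> leaves only the power of \<open>s\<close> modulo
    \<open>Ann\<close>.\<close>
  have s_pow: "in_Ann_plus s' (s ^ (q + \<beta>))"
  proof -
    have "u ^ \<alpha> = u * u ^ (\<alpha> - 1)"
      using \<alpha> by (simp add: power_eq_if)
    then have "s ^ (q + \<beta>) = s' * s ^ q + - (u ^ (\<alpha> - 1)) * (s ^ q * u)"
      unfolding s'_def by (simp add: power_add algebra_simps)
    moreover have "- (u ^ (\<alpha> - 1)) * (s ^ q * u) \<in> Ann"
      using up by (intro Ann_mult su) simp
    moreover have "in_Ann_plus s' (s' * s ^ q)"
      using sp by (intro in_Ann_plus_self) simp
    ultimately show ?thesis
      by (simp only: in_Ann_plus_add in_Ann_plus_Ann)
  qed
  \<comment> \<open>Symmetrically, multiplying \<open>s'\<close> by \<open>u\<close> leaves only the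
    power of \<open>u\<close>, since \<open>q \<le> \<beta>\<close>.\<close>
  have u_pow: "in_Ann_plus s' (u ^ Suc \<alpha>)"
  proof -
    have "s ^ \<beta> = s ^ q * s ^ (\<beta> - q)"
      using q\<beta> by (simp only: flip: power_add) simp
    then have "u ^ Suc \<alpha> = s' * u + - (s ^ (\<beta> - q)) * (s ^ q * u)"
      unfolding s'_def by (simp add: algebra_simps)
    moreover have "- (s ^ (\<beta> - q)) * (s ^ q * u) \<in> Ann"
      using sp by (intro Ann_mult su) simp
    moreover have "in_Ann_plus s' (s' * u)"
      using up by (rule in_Ann_plus_self)
    ultimately show ?thesis
      by (simp only: in_Ann_plus_add in_Ann_plus_Ann)
  qed
  \<comment> \<open>By the choice of \<open>v\<close>, \<open>?x ^ D\<close> is \<open>u\<close>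
    plus a multiple of \<open>s\<close>. A high power of this sum lies in the ideal of
    \<open>u ^ Suc \<alpha>\<close> and \<open>s ^ (q + \<beta>)\<close>, which are both in
    \<open>Ann + (s')\<close>.\<close>
  have x_pow: "\<exists>k. in_Ann_plus s' (?x ^ k)"
  proof -
    let ?y = "?x ^ t * (?x ^ m * h)"
    have yp: "s * ?y \<in> polys n"
      using sp x hp by simp
    obtain A B where AB: "A \<in> polys n" "B \<in> polys n"
      "(u + s * ?y) ^ (Suc \<alpha> + (q + \<beta>)) = u ^ Suc \<alpha> * A + (s * ?y) ^ (q + \<beta>) * B"
      using power_add_decompose[OF up yp] by blast
    have "?x ^ D = u + s * ?y"
      by (simp add: D_def u_def v_def power_add algebra_simps)
    then have "?x ^ (D * (Suc \<alpha> + (q + \<beta>))) = u ^ Suc \<alpha> * A + s ^ (q + \<beta>) * (?y ^ (q + \<beta>) * B)"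
      using AB(3) by (simp only: power_mult power_mult_distrib mult.assoc)
    moreover have "in_Ann_plus s' (u ^ Suc \<alpha> * A + s ^ (q + \<beta>) * (?y ^ (q + \<beta>) * B))"
      using AB(1,2) x hp by (intro in_Ann_plus_add in_Ann_plus_mult' u_pow s_pow) simp_all
    ultimately show ?thesis
      by metis
  qed
  \<comment> \<open>Modulo \<open>Ann\<close> a power of this variable is a multiple of the old
    \<open>s\<close>, and a power of \<open>s\<close> is in \<open>Ann + (s')\<close>.\<close>
  have a_pow: "\<exists>k. in_Ann_plus s' (indet a ^ k)" if a: "a < r" for a
  proof -
    obtain k g where g: "g \<in> polys n" "indet a ^ k - s * g \<in> Ann"
      using k a unfolding in_Ann_plus_def by blast
    let ?j = "indet a ^ k - s * g"
    have jp: "?j \<in> polys n"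
      using g(2) by (simp add: Ann_iff)
    have "s * g \<in> polys n"
      using sp g(1) by simp
    then obtain A B where AB: "A \<in> polys n" "B \<in> polys n"
      "(s * g + ?j) ^ (q + \<beta> + 1) = (s * g) ^ (q + \<beta>) * A + ?j ^ 1 * B"
      using power_add_decompose[OF _ jp] by blast
    have "indet a ^ k = s * g + ?j"
      by simp
    then have "indet a ^ (k * (q + \<beta> + 1)) = s ^ (q + \<beta>) * (g ^ (q + \<beta>) * A) + ?j * B"
      using AB(3) by (simp only: power_mult power_mult_distrib mult.assoc power_one_right)
    moreover have "in_Ann_plus s' (s ^ (q + \<beta>) * (g ^ (q + \<beta>) * A) + ?j * B)"
      using AB(1,2) g(1)
      by (intro in_Ann_plus_add in_Ann_plus_mult' s_pow in_Ann_plus_Ann[OF g(2)]) simp_all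
    ultimately show ?thesis
      by metis
  qed
  \<comment> \<open>One factor is split off each power: \<open>s\<close> keeps its old expansion,
    and the factor \<open>?x ^ t\<close> of \<open>u\<close> supplies the new summand.\<close>
  define w' where "w' a = (if a < r then w a * s ^ (\<beta> - 1) else u ^ (\<alpha> - 1) * (?x ^ m * v))" for a
  have "s' = (\<Sum>a<Suc r. w' a * indet a ^ t)"
  proof -
    have "s ^ \<beta> = s * s ^ (\<beta> - 1)" "u ^ \<alpha> = u * u ^ (\<alpha> - 1)"
      using \<alpha> \<beta> by (simp_all add: power_eq_if)
    moreover have "s * s ^ (\<beta> - 1) = (\<Sum>a<r. w' a * indet a ^ t)"
      by (subst (1) s_eq) (simp add: w'_def sum_distrib_right sum_distrib_left mult_ac)
    moreover have "u * u ^ (\<alpha> - 1) = w' r * ?x ^ t"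
      by (simp add: w'_def u_def mult_ac)
    ultimately show ?thesis
      by (simp add: s'_def)
  qed
  moreover have "\<forall>a<Suc r. w' a \<in> polys n"
    using w sp up vp x by (simp add: w'_def)
  moreover have "\<forall>a<Suc r. \<exists>k. in_Ann_plus s' (indet a ^ k)"
    using a_pow x_pow less_Suc_eq by metis
  moreover have "0 < d * D * Suc q"
    using d D by simp
  ultimately show ?case
    using s' by blast
qed

text \<open>The coefficients found by the induction need not be homogeneous. Since \<open>s\<close>,
  the powers of the variables and \<open>Ann\<close> are, the coefficients may be replaced by their
  parts of the expected degrees.\<close>

lemma coh_trivial_dim_le_1:
  assumes dim: "module_dim (mpoly_ring n) M \<le> 1"
  shows "coh_trivial (Suc (Suc i)) j"
proof (rule coh_trivial_of_parameter)
  fix t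
  obtain d s w where s: "s \<in> mpoly_hcomp n (int d)" and w: "\<forall>a<n. w a \<in> polys n"
    and s_eq: "s = (\<Sum>a<n. w a * indet a ^ t)" and "\<forall>a<n. \<exists>k. in_Ann_plus s (indet a ^ k)"
    using exists_parameter[OF dim order_refl, of t] by blast
  then obtain k where k: "\<forall>a<n. in_Ann_plus s (indet a ^ k a)"
    by metis
  \<comment> \<open>Higher powers stay in \<open>Ann + (s)\<close>, so one exponent serves all
    variables.\<close>
  define K where "K = (\<Sum>a<n. k a)"
  have "\<exists>g. g \<in> mpoly_hcomp n (int K - int d) \<and> indet a ^ K - s * g \<in> Ann" if a: "a < n" for a
  proof -
    have "k a \<le> K"
      unfolding K_def using a by (intro member_le_sum) simp_all
    then have "indet a ^ K = indet a ^ (K - k a) * (indet a ^ k a :: 'k mpoly)"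
      by (simp flip: power_add)
    moreover have "in_Ann_plus s (indet a ^ (K - k a) * indet a ^ k a)"
      using k a by (intro in_Ann_plus_mult) simp_all
    ultimately obtain g where g: "g \<in> polys n" "indet a ^ K - s * g \<in> Ann"
      unfolding in_Ann_plus_def by auto
    have "hpart (int K) (indet a ^ K - s * g) = indet a ^ K - s * hpart (int K - int d) g"
      using hpart_of_hcomp[OF hcomp_indet_power[OF a, of K], of "int K"] hpart_mult[OF s g(1), of "int K"]
      by (simp add: hpart_diff)
    with Ann_hpart[OF g(2), of "int K"] show ?thesis
      using hpart_hcomp[OF g(1)] by auto
  qed
  then obtain g where g: "\<And>a. a < n \<Longrightarrow> g a \<in> mpoly_hcomp n (int K - int d)"
    "\<And>a. a < n \<Longrightarrow> indet a ^ K - s * g a \<in> Ann"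
    by metis
  have inv: "indet a ^ K \<odot> x = (s * g a) \<odot> x" if "a < n" "x \<in> carrier M" for a x
  proof -
    have closed: "s * g a \<in> polys n" "indet a ^ K - s * g a \<in> polys n"
      using hcomp_polys[OF s] hcomp_polys[OF g(1)[OF that(1)]] that(1) by simp_all
    have "indet a ^ K \<odot> x = ((indet a ^ K - s * g a) + s * g a) \<odot> x"
      by simp
    also have "\<dots> = \<zero> \<oplus> (s * g a) \<odot> x"
      using add_smult[OF closed(2,1) that(2)] g(2)[OF that(1)] that(2) by (simp add: Ann_iff)
    finally show ?thesis
      using closed(1) that(2) by simp
  qed
  let ?w = "\<lambda>a. hpart (int d - int t) (w a)"
  have "s = hpart (int d) s"
    using hpart_of_hcomp[OF s] by simp
  also have "\<dots> = (\<Sum>a<n. hpart (int d) (indet a ^ t * w a))"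
    by (subst s_eq) (simp add: hpart_sum mult.commute)
  also have "\<dots> = (\<Sum>a<n. ?w a * indet a ^ t)"
  proof (intro sum.cong refl)
    fix a assume "a \<in> {..<n}"
    then have a: "a < n"
      by simp
    have "hpart (int d) (indet a ^ t * w a) = indet a ^ t * ?w a"
      using hcomp_indet_power[OF a] w[rule_format, OF a] by (rule hpart_mult)
    then show "hpart (int d) (indet a ^ t * w a) = ?w a * indet a ^ t"
      by (simp only: mult.commute)
  qed
  finally have s_eq': "s = (\<Sum>a<n. ?w a * indet a ^ t)" .
  have w': "\<forall>a<n. ?w a \<in> mpoly_hcomp n (int d - int t)"
    using w hpart_hcomp by blast
  show "\<exists>d s w k g. s \<in> mpoly_hcomp n d \<and>
    (\<forall>a<n. w a \<in> mpoly_hcomp n (d - int t)) \<and> s = (\<Sum>a<n. w a * indet a ^ t) \<and>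
    (\<forall>a<n. g a \<in> mpoly_hcomp n (int k - d) \<and>
      (\<forall>x\<in>carrier M. indet a ^ k \<odot> x = (s * g a) \<odot> x))"
    by (intro exI[of _ "int d"] exI[of _ s] exI[of _ ?w] exI[of _ K] exI[of _ g] conjI s w' s_eq'
        allI impI ballI g(1) inv)
qed

end

section \<open>The graded Hom module of a cyclic module\<close>

text \<open>\<open>H\<close> is a copy, along \<open>\<phi>\<close>, of the graded submodule \<open>T\<close> of \<open>M\<close>.\<close>

locale graded_transport = graded_module n M
  for n :: nat and M :: "('k::field mpoly, 'a) gmodule" (structure) +
  fixes T :: "'a set" and \<phi> :: "'a \<Rightarrow> 'b" and H :: "('k mpoly, 'b) gmodule"
  assumes T_carrier: "T \<subseteq> carrier M"
    and T_zero: "\<zero> \<in> T"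
    and T_add: "\<lbrakk>y \<in> T; z \<in> T\<rbrakk> \<Longrightarrow> y \<oplus> z \<in> T"
    and T_smult: "\<lbrakk>r \<in> polys n; y \<in> T\<rbrakk> \<Longrightarrow> r \<odot> y \<in> T"
    and T_component: "\<lbrakk>y \<in> T; \<forall>j. c j \<in> hcomp M j; finite {j. c j \<noteq> \<zero>};
      y = (\<Oplus>j\<in>{j. c j \<noteq> \<zero>}. c j)\<rbrakk> \<Longrightarrow> c i \<in> T"
    and inj: "inj_on \<phi> T"
    and H_carrier: "carrier H = \<phi> ` T"
    and H_zero: "\<zero>\<^bsub>H\<^esub> = \<phi> \<zero>"
    and H_add: "\<lbrakk>y \<in> T; z \<in> T\<rbrakk> \<Longrightarrow> \<phi> y \<oplus>\<^bsub>H\<^esub> \<phi> z = \<phi> (y \<oplus> z)"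
    and H_smult: "\<lbrakk>r \<in> polys n; y \<in> T\<rbrakk> \<Longrightarrow> r \<odot>\<^bsub>H\<^esub> \<phi> y = \<phi> (r \<odot> y)"
    and H_hcomp: "hcomp H j = \<phi> ` (T \<inter> hcomp M j)"
begin

lemma T_in_carrier: "y \<in> T \<Longrightarrow> y \<in> carrier M"
  using T_carrier by (rule subsetD)

lemma \<phi>_carrier: "y \<in> T \<Longrightarrow> \<phi> y \<in> carrier H"
  unfolding H_carrier by (rule imageI)

lemma \<phi>_eq_iff: "\<lbrakk>y \<in> T; z \<in> T\<rbrakk> \<Longrightarrow> \<phi> y = \<phi> z \<longleftrightarrow> y = z"
  using inj by (rule inj_on_eq_iff)

lemma \<phi>_cases:
  assumes "x \<in> carrier H"
  obtains y where "y \<in> T" "x = \<phi> y"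
  using assms unfolding H_carrier by (elim imageE)

lemma T_minus:
  assumes "y \<in> T"
  shows "\<ominus> y \<in> T"
proof -
  have "(- 1) \<odot> y = \<ominus> y"
    using uminus_smult[of 1 y] T_in_carrier[OF assms] by simp
  then show ?thesis
    using T_smult[of "- 1" y] assms by simp
qed

lemma H_abelian_group: "abelian_group H"
proof (rule abelian_groupI)
  fix x x' assume "x \<in> carrier H" "x' \<in> carrier H"
  then obtain y y' where y: "y \<in> T" "y' \<in> T" and x: "x = \<phi> y" "x' = \<phi> y'"
    by (elim \<phi>_cases)
  show "x \<oplus>\<^bsub>H\<^esub> x' \<in> carrier H"
    unfolding x H_add[OF y] by (intro \<phi>_carrier T_add y)
  show "x \<oplus>\<^bsub>H\<^esub> x' = x' \<oplus>\<^bsub>H\<^esub> x"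
    unfolding x H_add[OF y] H_add[OF y(2,1)] using M.a_comm[OF y[THEN T_in_carrier]] by simp
next
  fix x x' x'' assume "x \<in> carrier H" "x' \<in> carrier H" "x'' \<in> carrier H"
  then obtain y y' y'' where y: "y \<in> T" "y' \<in> T" "y'' \<in> T" and x: "x = \<phi> y" "x' = \<phi> y'" "x'' = \<phi> y''"
    by (elim \<phi>_cases)
  show "x \<oplus>\<^bsub>H\<^esub> x' \<oplus>\<^bsub>H\<^esub> x'' = x \<oplus>\<^bsub>H\<^esub> (x' \<oplus>\<^bsub>H\<^esub> x'')"
    unfolding x using y by (simp add: H_add T_add M.a_assoc[OF y[THEN T_in_carrier]])
next
  show "\<zero>\<^bsub>H\<^esub> \<in> carrier H"
    unfolding H_zero by (intro \<phi>_carrier T_zero)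
next
  fix x assume "x \<in> carrier H"
  then obtain y where y: "y \<in> T" and x: "x = \<phi> y"
    by (elim \<phi>_cases)
  show "\<zero>\<^bsub>H\<^esub> \<oplus>\<^bsub>H\<^esub> x = x"
    unfolding x H_zero using y T_zero by (simp add: H_add T_in_carrier)
  have "\<phi> (\<ominus> y) \<oplus>\<^bsub>H\<^esub> x = \<zero>\<^bsub>H\<^esub>"
    unfolding x H_zero using y T_minus by (simp add: H_add T_in_carrier M.l_neg)
  then show "\<exists>x'\<in>carrier H. x' \<oplus>\<^bsub>H\<^esub> x = \<zero>\<^bsub>H\<^esub>"
    by (rule bexI) (intro \<phi>_carrier T_minus y)
qed

lemma H_module: "module (mpoly_ring n) H"
proof (rule moduleI[OF mpoly_ring_cring H_abelian_group])
  fix r :: "'k mpoly" and x assume r: "r \<in> polys n" and "x \<in> carrier H"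
  then obtain y where y: "y \<in> T" and x: "x = \<phi> y"
    by (elim \<phi>_cases)
  show "r \<odot>\<^bsub>H\<^esub> x \<in> carrier H"
    unfolding x H_smult[OF r y] by (intro \<phi>_carrier T_smult r y)
  fix s :: "'k mpoly" assume s: "s \<in> polys n"
  show "(r \<oplus>\<^bsub>mpoly_ring n\<^esub> s) \<odot>\<^bsub>H\<^esub> x = r \<odot>\<^bsub>H\<^esub> x \<oplus>\<^bsub>H\<^esub> s \<odot>\<^bsub>H\<^esub> x"
    unfolding x using r s y by (simp add: H_smult H_add T_smult add_smult T_in_carrier)
  show "(r \<otimes>\<^bsub>mpoly_ring n\<^esub> s) \<odot>\<^bsub>H\<^esub> x = r \<odot>\<^bsub>H\<^esub> (s \<odot>\<^bsub>H\<^esub> x)"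
    unfolding x using r s y by (simp add: H_smult T_smult T_in_carrier)
next
  fix r :: "'k mpoly" and x x' assume r: "r \<in> polys n" and "x \<in> carrier H" "x' \<in> carrier H"
  then obtain y y' where y: "y \<in> T" "y' \<in> T" and x: "x = \<phi> y" "x' = \<phi> y'"
    by (elim \<phi>_cases)
  show "r \<odot>\<^bsub>H\<^esub> (x \<oplus>\<^bsub>H\<^esub> x') = r \<odot>\<^bsub>H\<^esub> x \<oplus>\<^bsub>H\<^esub> r \<odot>\<^bsub>H\<^esub> x'"
    unfolding x using r y by (simp add: H_smult H_add T_smult T_add smult_r_distr T_in_carrier)
next
  fix x assume "x \<in> carrier H"
  then obtain y where y: "y \<in> T" and x: "x = \<phi> y"
    by (elim \<phi>_cases)
  show "\<one>\<^bsub>mpoly_ring n\<^esub> \<odot>\<^bsub>H\<^esub> x = x"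
    unfolding x using y by (simp add: H_smult T_in_carrier)
qed

lemma \<phi>_finsum:
  assumes "finite A" "\<And>a. a \<in> A \<Longrightarrow> u a \<in> T"
  shows "finsum M u A \<in> T" and "(\<Oplus>\<^bsub>H\<^esub>a\<in>A. \<phi> (u a)) = \<phi> (finsum M u A)"
proof -
  interpret H: abelian_group H
    by (rule H_abelian_group)
  have "finsum M u A \<in> T \<and> (\<Oplus>\<^bsub>H\<^esub>a\<in>A. \<phi> (u a)) = \<phi> (finsum M u A)"
    using assms
  proof (induction A)
    case empty
    then show ?case
      by (simp add: T_zero H_zero)
  next
    case (insert a A)
    have "finsum M u (insert a A) = u a \<oplus> finsum M u A"
      using insert.hyps insert.prems T_in_carrier by (intro M.finsum_insert funcsetI) simp_all
    moreover have "(\<Oplus>\<^bsub>H\<^esub>a\<in>insert a A. \<phi> (u a)) = \<phi> (u a) \<oplus>\<^bsub>H\<^esub> (\<Oplus>\<^bsub>H\<^esub>a\<in>A. \<phi> (u a))"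
      using insert.hyps insert.prems \<phi>_carrier by (intro H.finsum_insert funcsetI) simp_all
    ultimately show ?case
      using insert by (simp add: T_add H_add)
  qed
  then show "finsum M u A \<in> T" "(\<Oplus>\<^bsub>H\<^esub>a\<in>A. \<phi> (u a)) = \<phi> (finsum M u A)"
    by blast+
qed

text \<open>The components of an element of \<open>T\<close> stay in \<open>T\<close>, and
  injectivity of \<open>\<phi>\<close> makes supports agree, so existence and uniqueness both carry
  over from \<open>M\<close>.\<close>

lemma H_decomposition:
  assumes "x \<in> carrier H"
  shows "\<exists>!c. (\<forall>j. c j \<in> hcomp H j) \<and> finite {j. c j \<noteq> \<zero>\<^bsub>H\<^esub>} \<and>
    x = (\<Oplus>\<^bsub>H\<^esub>j\<in>{j. c j \<noteq> \<zero>\<^bsub>H\<^esub>}. c j)"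
proof -
  from assms obtain y where y: "y \<in> T" and x: "x = \<phi> y"
    by (elim \<phi>_cases)
  let ?dec = "\<lambda>y c. (\<forall>j. c j \<in> hcomp M j) \<and> finite {j. c j \<noteq> \<zero>} \<and> y = (\<Oplus>j\<in>{j. c j \<noteq> \<zero>}. c j)"
  have "\<exists>!c. ?dec y c"
    using T_in_carrier[OF y] by (rule decomposition)
  then obtain c where c: "?dec y c" and uniq: "\<And>c'. ?dec y c' \<Longrightarrow> c' = c"
    by (elim ex1E) metis
  have c_T: "c j \<in> T" for j
    using T_component[OF y, of c j] c by blast
  have support: "{j. \<phi> (u j) \<noteq> \<zero>\<^bsub>H\<^esub>} = {j. u j \<noteq> \<zero>}" if "\<And>j. u j \<in> T" for u :: "int \<Rightarrow> 'a"
    unfolding H_zero using \<phi>_eq_iff[OF that T_zero] by simp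
  show ?thesis
  proof (rule ex1I[of _ "\<lambda>j. \<phi> (c j)"])
    show "(\<forall>j. \<phi> (c j) \<in> hcomp H j) \<and> finite {j. \<phi> (c j) \<noteq> \<zero>\<^bsub>H\<^esub>} \<and>
        x = (\<Oplus>\<^bsub>H\<^esub>j\<in>{j. \<phi> (c j) \<noteq> \<zero>\<^bsub>H\<^esub>}. \<phi> (c j))"
      unfolding support[OF c_T]
    proof (intro conjI allI)
      show "\<phi> (c j) \<in> hcomp H j" for j
        unfolding H_hcomp using c c_T by (intro imageI IntI) simp_all
      show fin: "finite {j. c j \<noteq> \<zero>}"
        using c by simp
      have "(\<Oplus>\<^bsub>H\<^esub>j\<in>{j. c j \<noteq> \<zero>}. \<phi> (c j)) = \<phi> (\<Oplus>j\<in>{j. c j \<noteq> \<zero>}. c j)"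
        by (rule \<phi>_finsum(2)[OF fin c_T])
      also have "(\<Oplus>j\<in>{j. c j \<noteq> \<zero>}. c j) = y"
        using c by (metis (no_types))
      finally show "x = (\<Oplus>\<^bsub>H\<^esub>j\<in>{j. c j \<noteq> \<zero>}. \<phi> (c j))"
        unfolding x ..
    qed
  next
    fix c' assume c': "(\<forall>j. c' j \<in> hcomp H j) \<and> finite {j. c' j \<noteq> \<zero>\<^bsub>H\<^esub>} \<and>
        x = (\<Oplus>\<^bsub>H\<^esub>j\<in>{j. c' j \<noteq> \<zero>\<^bsub>H\<^esub>}. c' j)"
    have "\<forall>j. \<exists>u. u \<in> T \<and> u \<in> hcomp M j \<and> c' j = \<phi> u"
      using c' unfolding H_hcomp by blast
    then obtain u where u: "\<forall>j. u j \<in> T \<and> u j \<in> hcomp M j \<and> c' j = \<phi> (u j)"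
      by (rule choice[THEN exE])
    then have c'_eq: "c' = (\<lambda>j. \<phi> (u j))"
      by (intro ext) simp
    have u_T: "u j \<in> T" for j
      using u by simp
    have fin: "finite {j. u j \<noteq> \<zero>}"
      using c' unfolding c'_eq support[OF u_T] by simp
    have "\<phi> y = (\<Oplus>\<^bsub>H\<^esub>j\<in>{j. u j \<noteq> \<zero>}. \<phi> (u j))"
      using c' unfolding c'_eq support[OF u_T] x by simp
    also have "\<dots> = \<phi> (\<Oplus>j\<in>{j. u j \<noteq> \<zero>}. u j)"
      by (rule \<phi>_finsum(2)[OF fin u_T])
    finally have "y = (\<Oplus>j\<in>{j. u j \<noteq> \<zero>}. u j)"
      using \<phi>_eq_iff[OF y \<phi>_finsum(1)[OF fin u_T]] by simp
    then have "u = c"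
      using u fin by (intro uniq) simp
    then show "c' = (\<lambda>j. \<phi> (c j))"
      unfolding c'_eq by simp
  qed
qed

lemma H_graded_module: "graded_module n H"
proof (intro graded_module.intro graded_module_axioms.intro H_module H_decomposition)
  fix j
  interpret H: abelian_group H
    by (rule H_abelian_group)
  show "subgroup (hcomp H j) (add_monoid H)"
  proof (rule H.add.subgroupI)
    show "hcomp H j \<subseteq> carrier H"
      unfolding H_hcomp H_carrier by (intro image_mono Int_lower1)
    have "\<phi> \<zero> \<in> hcomp H j"
      unfolding H_hcomp by (intro imageI IntI T_zero zero_hcomp)
    then show "hcomp H j \<noteq> {}"
      by (metis empty_iff)
  next
    fix x assume "x \<in> hcomp H j"
    then obtain y where y: "y \<in> T" "y \<in> hcomp M j" and x: "x = \<phi> y"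
      unfolding H_hcomp by (elim imageE IntE)
    have "\<phi> (\<ominus> y) \<oplus>\<^bsub>H\<^esub> x = \<zero>\<^bsub>H\<^esub>"
      unfolding x H_zero using y T_minus by (simp add: H_add T_in_carrier M.l_neg)
    then have "\<ominus>\<^bsub>H\<^esub> x = \<phi> (\<ominus> y)"
      unfolding x by (intro H.minus_equality \<phi>_carrier T_minus y)
    then show "\<ominus>\<^bsub>H\<^esub> x \<in> hcomp H j"
      unfolding H_hcomp using y by (simp only: imageI IntI T_minus minus_hcomp)
  next
    fix x x' assume "x \<in> hcomp H j" "x' \<in> hcomp H j"
    then obtain y y' where y: "y \<in> T" "y \<in> hcomp M j" "y' \<in> T" "y' \<in> hcomp M j"
      and x: "x = \<phi> y" "x' = \<phi> y'"
      unfolding H_hcomp by (elim imageE IntE)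
    show "x \<oplus>\<^bsub>H\<^esub> x' \<in> hcomp H j"
      unfolding x H_add[OF y(1,3)] H_hcomp by (intro imageI IntI T_add add_hcomp y)
  qed
next
  fix r :: "'k mpoly" and i x j assume r: "r \<in> mpoly_hcomp n i" and "x \<in> hcomp H j"
  then obtain y where y: "y \<in> T" "y \<in> hcomp M j" and x: "x = \<phi> y"
    unfolding H_hcomp by (elim imageE IntE)
  show "r \<odot>\<^bsub>H\<^esub> x \<in> hcomp H (i + j)"
    unfolding x H_smult[OF hcomp_polys[OF r] y(1)] H_hcomp
    by (intro imageI IntI T_smult hcomp_smult hcomp_polys[OF r] r y)
qed

end

text \<open>Evaluation at the residue class of \<open>1\<close> identifies \<open>Hom(R/I, M)\<close> with \<open>T = (0 : I)\<close>; the map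
  \<open>hom_of\<close> is its inverse.\<close>

locale ideal_hom = graded_module n M
  for n :: nat and M :: "('k::field mpoly, 'a) gmodule" (structure) +
  fixes I :: "'k mpoly set"
  assumes homogeneous: "homogeneous_ideal n I"
begin

abbreviation residue :: "'k mpoly \<Rightarrow> 'k mpoly set"
  where "residue p \<equiv> a_r_coset (mpoly_ring n) I p"

abbreviation Q :: "('k mpoly, 'k mpoly set) gmodule"
  where "Q \<equiv> quotient_gmodule n I"

abbreviation H :: "('k mpoly, 'k mpoly set \<Rightarrow> 'a) gmodule"
  where "H \<equiv> hom_gmodule (mpoly_ring n) Q M"

definition T :: "'a set"
  where "T = {y \<in> carrier M. \<forall>r\<in>I. r \<odot> y = \<zero>}"

text \<open>A residue class acts on \<open>y\<close> through an arbitrary representative; for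
  \<open>y\<close> in \<open>T\<close> the choice is immaterial because \<open>I\<close> kills
  \<open>y\<close>. The restriction makes the map extensional, as members of
  \<open>module_homs\<close> are.\<close>

definition hom_of :: "'a \<Rightarrow> 'k mpoly set \<Rightarrow> 'a"
  where "hom_of y = (\<lambda>U\<in>carrier Q. (SOME p. p \<in> polys n \<and> residue p = U) \<odot> y)"

lemma ideal: "ideal I (mpoly_ring n)"
  using homogeneous by (simp add: homogeneous_ideal_def)

lemma I_polys: "r \<in> I \<Longrightarrow> r \<in> polys n"
  using ideal.Icarr[OF ideal] .

lemma residue_eq_iff: "\<lbrakk>p \<in> polys n; q \<in> polys n\<rbrakk> \<Longrightarrow> residue p = residue q \<longleftrightarrow> p - q \<in> I"
  using R.quotient_eq_iff_same_a_r_cos[OF ideal, of p q] by (simp add: R.minus_eq)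

lemma Q_carrier: "carrier Q = residue ` polys n"
  unfolding quotient_gmodule_def FactRing_def A_RCOSETS_def' by (simp add: UNION_singleton_eq_range)

lemma residue_Q: "p \<in> polys n \<Longrightarrow> residue p \<in> carrier Q"
  unfolding Q_carrier by (rule imageI)

lemma Q_add: "\<lbrakk>p \<in> polys n; q \<in> polys n\<rbrakk> \<Longrightarrow> residue p \<oplus>\<^bsub>Q\<^esub> residue q = residue (p + q)"
  using ideal.a_rcos_sum[OF ideal, of p q] by (simp add: quotient_gmodule_def FactRing_def)

lemma Q_smult: "\<lbrakk>r \<in> polys n; p \<in> polys n\<rbrakk> \<Longrightarrow> r \<odot>\<^bsub>Q\<^esub> residue p = residue (r * p)"
  using ideal.rcoset_mult_add[OF ideal, of r p] by (simp add: quotient_gmodule_def FactRing_def)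

lemma Q_hcomp: "hcomp Q j = residue ` mpoly_hcomp n j"
  by (simp add: quotient_gmodule_def)

lemma T_carrier: "T \<subseteq> carrier M"
  by (simp add: T_def subset_iff)

lemma T_in_carrier: "y \<in> T \<Longrightarrow> y \<in> carrier M"
  by (simp add: T_def)

lemma T_kill: "\<lbrakk>y \<in> T; r \<in> I\<rbrakk> \<Longrightarrow> r \<odot> y = \<zero>"
  by (simp add: T_def)

lemma T_zero: "\<zero> \<in> T"
  by (simp add: T_def I_polys)

lemma T_add: "\<lbrakk>y \<in> T; z \<in> T\<rbrakk> \<Longrightarrow> y \<oplus> z \<in> T"
  by (simp add: T_def I_polys smult_r_distr)

lemma T_smult:
  assumes "r \<in> polys n" "y \<in> T"
  shows "r \<odot> y \<in> T"
  unfolding T_def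
proof (intro CollectI conjI ballI)
  show "r \<odot> y \<in> carrier M"
    using assms T_in_carrier by simp
  fix s assume s: "s \<in> I"
  then have "s * r \<in> I"
    using ideal.I_r_closed[OF ideal s, of r] assms(1) by simp
  then show "s \<odot> (r \<odot> y) = \<zero>"
    using assms T_in_carrier[OF assms(2)] T_kill[OF assms(2)] I_polys[OF s] by simp
qed

text \<open>The polynomials that annihilate \<open>y\<close> form an ideal, and \<open>I\<close> is
  generated by its homogeneous elements.\<close>

lemma T_homogeneous:
  assumes y: "y \<in> carrier M" and kill: "\<And>r d. \<lbrakk>r \<in> I; r \<in> mpoly_hcomp n d\<rbrakk> \<Longrightarrow> r \<odot> y = \<zero>"
  shows "y \<in> T"
proof -
  let ?J = "{r \<in> polys n. r \<odot> y = \<zero>}"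
  have "ideal ?J (mpoly_ring n)"
  proof (rule idealI[OF R.ring_axioms])
    show "subgroup ?J (add_monoid (mpoly_ring n))"
    proof (rule R.add.subgroupI)
      have "0 \<in> ?J"
        using y by simp
      then show "?J \<noteq> {}"
        by (metis empty_iff)
    next
      fix r :: "'k mpoly" assume r: "r \<in> ?J"
      then have "\<ominus>\<^bsub>mpoly_ring n\<^esub> r = - r"
        by (intro mpoly_ring_uminus) simp
      then show "\<ominus>\<^bsub>mpoly_ring n\<^esub> r \<in> ?J"
        using r y by (simp add: uminus_smult)
    qed (use y in \<open>simp_all add: add_smult subset_iff\<close>)
  next
    fix r s :: "'k mpoly" assume r: "r \<in> ?J" and s: "s \<in> carrier (mpoly_ring n)"
    then have "(s * r) \<odot> y = \<zero>"
      using y by (simp flip: smult_smult)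
    then have sr: "s * r \<in> ?J"
      using r s by simp
    then show "s \<otimes>\<^bsub>mpoly_ring n\<^esub> r \<in> ?J"
      by (simp only: mpoly_ring_simps)
    show "r \<otimes>\<^bsub>mpoly_ring n\<^esub> s \<in> ?J"
      using sr by (simp only: mpoly_ring_simps mult.commute[of r s])
  qed
  then have "genideal (mpoly_ring n) {p \<in> I. \<exists>j. p \<in> mpoly_hcomp n j} \<subseteq> ?J"
  proof (rule R.genideal_minimal)
    show "{p \<in> I. \<exists>j. p \<in> mpoly_hcomp n j} \<subseteq> ?J"
      using kill I_polys by blast
  qed
  moreover have "I = genideal (mpoly_ring n) {p \<in> I. \<exists>j. p \<in> mpoly_hcomp n j}"
    using homogeneous unfolding homogeneous_ideal_def by (rule conjunct2)
  ultimately have "I \<subseteq> ?J"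
    by (metis (no_types))
  then show ?thesis
    unfolding T_def using y by blast
qed

text \<open>For homogeneous \<open>r\<close> in \<open>I\<close> the products of \<open>r\<close>
  with the components of \<open>y\<close> have different degrees and sum to zero, so each of them
  vanishes.\<close>

lemma T_component:
  assumes y: "y \<in> T" and c: "\<forall>j. c j \<in> hcomp M j" and fin: "finite {j. c j \<noteq> \<zero>}"
    and y_eq: "y = (\<Oplus>j\<in>{j. c j \<noteq> \<zero>}. c j)"
  shows "c i \<in> T"
proof (rule T_homogeneous)
  show "c i \<in> carrier M"
    using c hcomp_carrier by blast
  fix r d assume r: "r \<in> I" "r \<in> mpoly_hcomp n d"
  have rp: "r \<in> polys n"
    using r(1) by (rule I_polys)
  show "r \<odot> c i = \<zero>"
  proof (cases "c i = \<zero>")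
    case True
    then show ?thesis
      using rp by simp
  next
    case False
    have "(\<Oplus>j\<in>{j. c j \<noteq> \<zero>}. r \<odot> c j) = r \<odot> y"
      unfolding y_eq using c hcomp_carrier
      by (intro finsum_smult_ldistr[symmetric] fin rp) blast
    then have zero: "(\<Oplus>j\<in>{j. c j \<noteq> \<zero>}. r \<odot> c j) = \<zero>"
      using T_kill[OF y r(1)] by simp
    have "r \<odot> c j \<in> hcomp M (j + d)" for j
      using hcomp_smult[OF r(2), of "c j" j] c by (simp add: add.commute)
    with False show ?thesis
      using homogeneous_independent_shift[OF fin _ zero, of d i] by simp
  qed
qed

lemma hom_of_residue:
  assumes y: "y \<in> T" and p: "p \<in> polys n"
  shows "hom_of y (residue p) = p \<odot> y"
proof -
  define q where "q = (SOME q. q \<in> polys n \<and> residue q = residue p)"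
  have q: "q \<in> polys n \<and> residue q = residue p"
    unfolding q_def by (rule someI[of _ p]) (simp add: p)
  then have "q - p \<in> I"
    using residue_eq_iff[of q p] p by simp
  then have "(q - p) \<odot> y = \<zero>"
    by (rule T_kill[OF y])
  then have "((q - p) + p) \<odot> y = p \<odot> y"
    using add_smult[of "q - p" p y] q p T_in_carrier[OF y] by simp
  then have "q \<odot> y = p \<odot> y"
    by simp
  then show ?thesis
    unfolding hom_of_def q_def using residue_Q[OF p] by simp
qed

lemma hom_of_one: "y \<in> T \<Longrightarrow> hom_of y (residue 1) = y"
  using hom_of_residue[of y 1] T_in_carrier by simp

lemma eq_hom_of:
  assumes "f \<in> extensional (carrier Q)" and "y \<in> T" and "\<And>p. p \<in> polys n \<Longrightarrow> f (residue p) = p \<odot> y"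
  shows "f = hom_of y"
proof (rule extensionalityI[OF assms(1)])
  show "hom_of y \<in> extensional (carrier Q)"
    unfolding hom_of_def by (rule restrict_extensional)
  fix U assume "U \<in> carrier Q"
  then obtain p where "p \<in> polys n" "U = residue p"
    unfolding Q_carrier by (elim imageE)
  then show "f U = hom_of y U"
    using assms(3) hom_of_residue[OF assms(2)] by simp
qed

lemma hom_of_module_hom:
  assumes y: "y \<in> T"
  shows "hom_of y \<in> module_homs (mpoly_ring n) Q M"
  unfolding module_homs_def
proof (intro CollectI conjI ballI)
  show "hom_of y \<in> carrier Q \<rightarrow>\<^sub>E carrier M"
  proof (rule PiE_I)
    fix U assume "U \<in> carrier Q"
    then obtain p where p: "p \<in> polys n" "U = residue p"
      unfolding Q_carrier by (elim imageE)
    then show "hom_of y U \<in> carrier M"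
      using hom_of_residue[OF y] T_in_carrier[OF y] by simp
  next
    fix U assume "U \<notin> carrier Q"
    then show "hom_of y U = undefined"
      unfolding hom_of_def by (simp add: restrict_def)
  qed
next
  fix U V assume "U \<in> carrier Q" "V \<in> carrier Q"
  then obtain p q where p: "p \<in> polys n" "q \<in> polys n" "U = residue p" "V = residue q"
    unfolding Q_carrier by (elim imageE)
  then show "hom_of y (U \<oplus>\<^bsub>Q\<^esub> V) = hom_of y U \<oplus> hom_of y V"
    using T_in_carrier[OF y] by (simp add: Q_add hom_of_residue[OF y] add_smult)
next
  fix r :: "'k mpoly" and U assume r: "r \<in> polys n" and "U \<in> carrier Q"
  then obtain p where p: "p \<in> polys n" "U = residue p"
    unfolding Q_carrier by (elim imageE)
  then show "hom_of y (r \<odot>\<^bsub>Q\<^esub> U) = r \<odot> hom_of y U"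
    using r T_in_carrier[OF y] by (simp add: Q_smult hom_of_residue[OF y])
qed

lemma module_homs_eq: "module_homs (mpoly_ring n) Q M = hom_of ` T"
proof (intro equalityI subsetI)
  fix f assume f: "f \<in> module_homs (mpoly_ring n) Q M"
  let ?y = "f (residue 1)"
  have f_ext: "f \<in> carrier Q \<rightarrow>\<^sub>E carrier M"
    and f_smult: "\<And>r U. \<lbrakk>r \<in> polys n; U \<in> carrier Q\<rbrakk> \<Longrightarrow> f (r \<odot>\<^bsub>Q\<^esub> U) = r \<odot> f U"
    using f by (simp_all add: module_homs_def)
  have y: "?y \<in> carrier M"
    using f_ext residue_Q[OF polys_closed(2)] by (rule PiE_mem)
  have f_cos: "f (residue p) = p \<odot> ?y" if "p \<in> polys n" for p
    using f_smult[OF that residue_Q[OF polys_closed(2)]] that by (simp add: Q_smult)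
  have "?y \<in> T"
    unfolding T_def
  proof (intro CollectI conjI ballI y)
    fix r assume r: "r \<in> I"
    then have "residue r = residue 0"
      using residue_eq_iff[of r 0] I_polys by simp
    then show "r \<odot> ?y = \<zero>"
      using f_cos[OF I_polys[OF r]] f_cos[OF polys_closed(1)] y by simp
  qed
  moreover have "f \<in> extensional (carrier Q)"
    using f_ext by (simp add: PiE_def)
  ultimately have "f = hom_of ?y"
    using f_cos by (intro eq_hom_of)
  with \<open>?y \<in> T\<close> show "f \<in> hom_of ` T"
    by (intro image_eqI[of f hom_of ?y])
next
  fix f assume "f \<in> hom_of ` T"
  then show "f \<in> module_homs (mpoly_ring n) Q M"
    using hom_of_module_hom by (elim imageE) simp
qed

text \<open>The residue of \<open>1\<close> has degree 0 and generates the quotient, so the degree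
  of a homomorphism can be read off from its value there.\<close>

lemma homs_of_degree_eq: "homs_of_degree (mpoly_ring n) Q M d = hom_of ` (T \<inter> hcomp M d)"
proof (intro equalityI subsetI)
  fix f assume f: "f \<in> homs_of_degree (mpoly_ring n) Q M d"
  then have "f \<in> module_homs (mpoly_ring n) Q M"
    by (simp add: homs_of_degree_def)
  then obtain y where y: "y \<in> T" and f_eq: "f = hom_of y"
    unfolding module_homs_eq by (elim imageE)
  have "residue 1 \<in> hcomp Q 0"
    unfolding Q_hcomp by (intro imageI hcomp_1)
  moreover have "f ` hcomp Q 0 \<subseteq> hcomp M (0 + d)"
    using f unfolding homs_of_degree_def by blast
  ultimately have "f (residue 1) \<in> hcomp M (0 + d)"
    by blast
  then have "y \<in> hcomp M d"
    by (simp add: f_eq hom_of_one y)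
  with y show "f \<in> hom_of ` (T \<inter> hcomp M d)"
    unfolding f_eq by (intro imageI IntI)
next
  fix f assume "f \<in> hom_of ` (T \<inter> hcomp M d)"
  then obtain y where y: "y \<in> T" "y \<in> hcomp M d" and f_eq: "f = hom_of y"
    by (elim imageE IntE)
  have "hom_of y ` hcomp Q j \<subseteq> hcomp M (j + d)" for j
  proof (rule image_subsetI)
    fix U assume "U \<in> hcomp Q j"
    then obtain p where p: "p \<in> mpoly_hcomp n j" "U = residue p"
      unfolding Q_hcomp by (elim imageE)
    then show "hom_of y U \<in> hcomp M (j + d)"
      using hcomp_smult[OF p(1) y(2)] by (simp add: hom_of_residue[OF y(1)] hcomp_polys)
  qed
  then show "f \<in> homs_of_degree (mpoly_ring n) Q M d"
    unfolding homs_of_degree_def f_eq using hom_of_module_hom[OF y(1)] by simp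
qed

text \<open>Decomposing the value at the residue of \<open>1\<close>, whose components stay in
  \<open>T\<close>, writes any homomorphism as a finite sum of homogeneous ones.\<close>

lemma H_carrier: "carrier H = hom_of ` T"
proof -
  have "\<exists>D c. finite D \<and> (\<forall>d\<in>D. c d \<in> homs_of_degree (mpoly_ring n) Q M d) \<and>
      (\<forall>U\<in>carrier Q. hom_of y U = (\<Oplus>d\<in>D. c d U))" if y: "y \<in> T" for y
  proof -
    obtain c where c: "\<forall>j. c j \<in> hcomp M j" "finite {j. c j \<noteq> \<zero>}" "y = (\<Oplus>j\<in>{j. c j \<noteq> \<zero>}. c j)"
      using decomposition[OF T_in_carrier[OF y]] by (elim ex1E conjE)
    have c_T: "c j \<in> T" for j
      using y c by (rule T_component)
    show ?thesis
    proof (intro exI[of _ "{j. c j \<noteq> \<zero>}"] exI[of _ "\<lambda>j. hom_of (c j)"] conjI ballI c(2))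
      show "hom_of (c d) \<in> homs_of_degree (mpoly_ring n) Q M d" for d
        unfolding homs_of_degree_eq using c(1) c_T by (intro imageI IntI) simp_all
      fix U assume "U \<in> carrier Q"
      then obtain p where p: "p \<in> polys n" "U = residue p"
        unfolding Q_carrier by (elim imageE)
      have "hom_of y U = p \<odot> (\<Oplus>j\<in>{j. c j \<noteq> \<zero>}. c j)"
        unfolding p(2) hom_of_residue[OF y p(1)] using c(3) by (rule arg_cong)
      also have "\<dots> = (\<Oplus>j\<in>{j. c j \<noteq> \<zero>}. p \<odot> c j)"
        using c_T T_in_carrier by (intro finsum_smult_ldistr c(2) p(1)) blast
      also have "\<dots> = (\<Oplus>j\<in>{j. c j \<noteq> \<zero>}. hom_of (c j) U)"
        unfolding p(2) hom_of_residue[OF c_T p(1)] ..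
      finally show "hom_of y U = (\<Oplus>j\<in>{j. c j \<noteq> \<zero>}. hom_of (c j) U)" .
    qed
  qed
  then have "{f \<in> hom_of ` T. \<exists>D c. finite D \<and> (\<forall>d\<in>D. c d \<in> homs_of_degree (mpoly_ring n) Q M d) \<and>
      (\<forall>U\<in>carrier Q. f U = (\<Oplus>d\<in>D. c d U))} = hom_of ` T"
    by (intro equalityI subsetI) (elim CollectE conjE, assumption, intro CollectI conjI, assumption, elim imageE, simp)
  then show ?thesis
    unfolding hom_gmodule_def by (simp add: module_homs_eq)
qed

sublocale transport: graded_transport n M T hom_of H
proof (unfold_locales)
  show "inj_on hom_of T"
  proof (rule inj_onI)
    fix y z assume "y \<in> T" "z \<in> T" "hom_of y = hom_of z"
    then show "y = z"
      using hom_of_one by metis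
  qed
  show "\<zero>\<^bsub>H\<^esub> = hom_of \<zero>"
    by (rule eq_hom_of) (simp_all add: hom_gmodule_def T_zero residue_Q)
  show "hcomp H j = hom_of ` (T \<inter> hcomp M j)" for j
    by (simp add: hom_gmodule_def homs_of_degree_eq)
  show "hom_of y \<oplus>\<^bsub>H\<^esub> hom_of z = hom_of (y \<oplus> z)" if "y \<in> T" "z \<in> T" for y z
    by (rule eq_hom_of)
      (use that in \<open>simp_all add: hom_gmodule_def T_add residue_Q hom_of_residue smult_r_distr T_in_carrier\<close>)
  show "r \<odot>\<^bsub>H\<^esub> hom_of y = hom_of (r \<odot> y)" if "r \<in> polys n" "y \<in> T" for r y
    by (rule eq_hom_of)
      (use that in \<open>simp_all add: hom_gmodule_def T_smult residue_Q hom_of_residue T_in_carrier mult.commute\<close>)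
qed (fact T_carrier T_zero T_add T_smult T_component H_carrier)+

end

section \<open>Comparison in degrees zero and one\<close>

context graded_transport
begin

lemma H_coh_trivial_0:
  assumes "coh_trivial 0 j"
  shows "graded_module.coh_trivial n H 0 j"
proof -
  interpret H: graded_module n H
    by (rule H_graded_module)
  show ?thesis
    unfolding H.coh_trivial_0_iff
  proof (intro ballI impI)
    fix x assume "x \<in> hcomp H j" and tors: "\<forall>a<n. \<exists>s. indet a ^ s \<odot>\<^bsub>H\<^esub> x = \<zero>\<^bsub>H\<^esub>"
    then obtain y where y: "y \<in> T" "y \<in> hcomp M j" and x: "x = \<phi> y"
      unfolding H_hcomp by (elim imageE IntE)
    have "\<exists>s. indet a ^ s \<odot> y = \<zero>" if a: "a < n" for a
    proof -
      obtain s where "indet a ^ s \<odot>\<^bsub>H\<^esub> \<phi> y = \<zero>\<^bsub>H\<^esub>"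
        using tors a unfolding x by blast
      moreover have "(indet a ^ s :: 'k mpoly) \<in> polys n"
        using a by simp
      ultimately have "\<phi> (indet a ^ s \<odot> y) = \<phi> \<zero>"
        using y(1) by (simp add: H_smult H_zero)
      then have "indet a ^ s \<odot> y = \<zero>"
        using a y(1) \<phi>_eq_iff[OF T_smult T_zero] by simp
      then show ?thesis ..
    qed
    then have "y = \<zero>"
      using assms y(2) unfolding coh_trivial_0_iff by blast
    then show "x = \<zero>\<^bsub>H\<^esub>"
      unfolding x H_zero by (rule arg_cong)
  qed
qed

text \<open>The assumption \<open>saturated\<close> says that \<open>H^0(M / T)\<close> vanishes in
  degree \<open>j\<close>. The proof is the piece \<open>H^0(M / T) -> H^1(T) -> H^1(M)\<close> of
  the long exact sequence, chased by hand.\<close>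

lemma H_coh_trivial_1:
  assumes triv: "coh_trivial (Suc 0) j"
    and saturated: "\<And>y. \<lbrakk>y \<in> hcomp M j; \<And>a. a < n \<Longrightarrow> \<exists>s. indet a ^ s \<odot> y \<in> T\<rbrakk> \<Longrightarrow> y \<in> T"
  shows "graded_module.coh_trivial n H (Suc 0) j"
proof -
  interpret H: graded_module n H
    by (rule H_graded_module)
  show ?thesis
    unfolding H.coh_trivial_Suc_iff[of 0]
  proof (intro allI ballI impI)
    fix t m assume m: "m \<in> cech_faces n (Suc 0) \<rightarrow> hcomp H (j + int (t * Suc 0))"
      and K: "\<forall>\<tau>\<in>cech_faces n (Suc (Suc 0)). H.koszul t m \<tau> = \<zero>\<^bsub>H\<^esub>"
    have "\<exists>u. u \<in> T \<and> u \<in> hcomp M (j + int (t * Suc 0)) \<and> m \<rho> = \<phi> u"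
      if "\<rho> \<in> cech_faces n (Suc 0)" for \<rho>
      using funcset_mem[OF m that] unfolding H_hcomp by blast
    then have "\<forall>\<rho>\<in>cech_faces n (Suc 0). \<exists>u. u \<in> T \<and> u \<in> hcomp M (j + int (t * Suc 0)) \<and> m \<rho> = \<phi> u"
      by (rule ballI)
    then obtain u where u: "\<forall>\<rho>\<in>cech_faces n (Suc 0).
        u \<rho> \<in> T \<and> u \<rho> \<in> hcomp M (j + int (t * Suc 0)) \<and> m \<rho> = \<phi> (u \<rho>)"
      by (rule bchoice[THEN exE])
    have u_T: "u \<rho> \<in> T" and m_eq: "m \<rho> = \<phi> (u \<rho>)" if "\<rho> \<in> cech_faces n (Suc 0)" for \<rho>
      using u that by simp_all
    have u_hcomp: "u \<in> cech_faces n (Suc 0) \<rightarrow> hcomp M (j + int (t * Suc 0))"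
      using u by simp
    have "koszul t u \<tau> = \<zero>" if \<tau>: "\<tau> \<in> cech_faces n (Suc (Suc 0))" for \<tau>
    proof -
      let ?v = "\<lambda>a. (cech_sign a \<tau> * indet a ^ t) \<odot> u (\<tau> - {a})"
      have face: "\<tau> - {a} \<in> cech_faces n (Suc 0)" if "a \<in> \<tau>" for a
        using \<tau> that by (rule cech_faces_remove)
      have r: "(cech_sign a \<tau> * indet a ^ t :: 'k mpoly) \<in> polys n" if "a \<in> \<tau>" for a
        using cech_facesD(2)[OF \<tau>] that by (intro polys_closed(4) cech_sign_polys polys_power polys_indet) blast
      have v: "?v a \<in> T" if "a \<in> \<tau>" for a
        by (intro T_smult r u_T face that)
      have "H.koszul t m \<tau> = (\<Oplus>\<^bsub>H\<^esub>a\<in>\<tau>. \<phi> (?v a))"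
        unfolding H.koszul_def
      proof (rule H.M.finsum_cong'[OF refl])
        show "(\<lambda>a. \<phi> (?v a)) \<in> \<tau> \<rightarrow> carrier H"
          by (intro funcsetI \<phi>_carrier v)
        fix a assume a: "a \<in> \<tau>"
        show "(cech_sign a \<tau> * indet a ^ t) \<odot>\<^bsub>H\<^esub> m (\<tau> - {a}) = \<phi> (?v a)"
          unfolding m_eq[OF face[OF a]] by (intro H_smult r u_T face a)
      qed
      also have "\<dots> = \<phi> (koszul t u \<tau>)"
        unfolding koszul_def by (rule \<phi>_finsum(2)[OF cech_facesD(1)[OF \<tau>] v])
      finally have "\<phi> (koszul t u \<tau>) = \<phi> \<zero>"
        using bspec[OF K \<tau>] by (simp add: H_zero)
      moreover have "koszul t u \<tau> \<in> T"
        unfolding koszul_def by (rule \<phi>_finsum(1)[OF cech_facesD(1)[OF \<tau>] v])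
      ultimately show ?thesis
        using \<phi>_eq_iff T_zero by simp
    qed
    then obtain t' b where b: "b \<in> cech_faces n 0 \<rightarrow> hcomp M (j + int (t' * 0))"
      and eq: "cochain (Suc 0) u t = cochain (Suc 0) (koszul t' b) t'"
      using triv u_hcomp unfolding coh_trivial_Suc_iff[of 0] by blast
    \<comment> \<open>The only face of a 0-cochain is empty and has denominator 1, so its numerator
      has degree \<open>j\<close> whatever \<open>t'\<close> is.\<close>
    define y where "y = b {}"
    have y: "y \<in> hcomp M j"
      using b by (simp add: y_def cech_faces_0)
    note yc = hcomp_carrier[OF y]
    have rel: "\<exists>s. indet a ^ (s + t') \<odot> u {a} = indet a ^ (s + t) \<odot> (indet a ^ t' \<odot> y)"
      if a: "a < n" for a
    proof -
      have face: "{a} \<in> cech_faces n (Suc 0)"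
        using a by (simp add: cech_faces_1)
      have "frac (xm {a}) (u {a}) t = frac (xm {a}) (koszul t' b {a}) t'"
        using eq face unfolding cochain_eq_iff by (rule bspec)
      then have "frac (indet a) (u {a}) t = frac (indet a) (indet a ^ t' \<odot> y) t'"
        using koszul_singleton[OF a, of b t'] yc by (simp add: y_def)
      then show ?thesis
        using a yc T_in_carrier[OF u_T[OF face]] by (subst (asm) frac_eq_iff) simp_all
    qed
    have y_T: "y \<in> T"
    proof (rule saturated[OF y])
      fix a assume a: "a < n"
      obtain s where "indet a ^ (s + t') \<odot> u {a} = indet a ^ (s + t) \<odot> (indet a ^ t' \<odot> y)"
        using rel[OF a] by blast
      then have "indet a ^ (s + t + t') \<odot> y = indet a ^ (s + t') \<odot> u {a}"
        using a yc by (simp add: power_add)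
      also have "\<dots> \<in> T"
        using a by (intro T_smult u_T) (simp_all add: cech_faces_1)
      finally show "\<exists>s. indet a ^ s \<odot> y \<in> T" ..
    qed
    \<comment> \<open>The same \<open>y\<close> bounds the cocycle in \<open>H\<close>: all elements
      in the relation lie in \<open>T\<close>, so \<open>\<phi>\<close> carries it over.\<close>
    have "H.cochain (Suc 0) m t = H.cochain (Suc 0) (H.koszul t' (\<lambda>_. \<phi> y)) t'"
      unfolding H.cochain_eq_iff
    proof
      fix \<rho> assume \<rho>: "\<rho> \<in> cech_faces n (Suc 0)"
      then obtain a where a: "a < n" "\<rho> = {a}"
        by (auto simp: cech_faces_1)
      have x: "(indet a ^ k :: 'k mpoly) \<in> polys n" for k
        using a(1) by simp
      obtain s where s: "indet a ^ (s + t') \<odot> u {a} = indet a ^ (s + t) \<odot> (indet a ^ t' \<odot> y)"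
        using rel[OF a(1)] by blast
      have u_a: "u {a} \<in> T"
        using u_T \<rho> a(2) by simp
      have "indet a ^ (s + t') \<odot>\<^bsub>H\<^esub> \<phi> (u {a}) = indet a ^ (s + t) \<odot>\<^bsub>H\<^esub> (indet a ^ t' \<odot>\<^bsub>H\<^esub> \<phi> y)"
        unfolding H_smult[OF x y_T] H_smult[OF x T_smult[OF x y_T]] H_smult[OF x u_a] s ..
      then have "H.frac (indet a) (\<phi> (u {a})) t = H.frac (indet a) (indet a ^ t' \<odot>\<^bsub>H\<^esub> \<phi> y) t'"
        using a(1) \<phi>_carrier[OF u_a] H.smult_closed[OF x \<phi>_carrier[OF y_T]]
        by (subst H.frac_eq_iff) (auto simp del: H.smult_smult)
      then show "H.frac (xm \<rho>) (m \<rho>) t = H.frac (xm \<rho>) (H.koszul t' (\<lambda>_. \<phi> y) \<rho>) t'"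
        using H.koszul_singleton[OF a(1), of "\<lambda>_. \<phi> y" t'] \<phi>_carrier[OF y_T] m_eq[OF \<rho>]
        by (simp add: a(2))
    qed
    moreover have "(\<lambda>_. \<phi> y) \<in> cech_faces n 0 \<rightarrow> hcomp H (j + int (t' * 0))"
      using y y_T by (simp add: H_hcomp)
    ultimately show "\<exists>t'. \<exists>b\<in>cech_faces n 0 \<rightarrow> hcomp H (j + int (t' * 0)).
        H.cochain (Suc 0) m t = H.cochain (Suc 0) (H.koszul t' b) t'"
      by (intro exI[of _ t'] bexI[of _ "\<lambda>_. \<phi> y"])
  qed
qed

lemma H_coh_trivial_1_of_zero:
  assumes "T = {\<zero>}"
  shows "graded_module.coh_trivial n H (Suc 0) j"
proof -
  interpret H: graded_module n H
    by (rule H_graded_module)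
  have zero: "x = \<zero>\<^bsub>H\<^esub>" if "x \<in> carrier H" for x
    using that unfolding H_carrier H_zero assms by simp
  show ?thesis
    unfolding H.coh_trivial_Suc_iff[of 0]
  proof (intro allI ballI impI)
    fix t m assume m: "m \<in> cech_faces n (Suc 0) \<rightarrow> hcomp H (j + int (t * Suc 0))"
    have "m \<rho> = H.koszul t (\<lambda>_. \<zero>\<^bsub>H\<^esub>) \<rho>" if \<rho>: "\<rho> \<in> cech_faces n (Suc 0)" for \<rho>
    proof -
      have "H.koszul t (\<lambda>_. \<zero>\<^bsub>H\<^esub>) \<rho> \<in> carrier H"
        using \<rho> by (rule H.koszul_closed) simp
      from zero[OF this] show ?thesis
        using zero[OF H.hcomp_carrier[OF funcset_mem[OF m \<rho>]]] by simp
    qed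
    then have "H.cochain (Suc 0) m t = H.cochain (Suc 0) (H.koszul t (\<lambda>_. \<zero>\<^bsub>H\<^esub>)) t"
      unfolding H.cochain_eq_iff by simp
    then show "\<exists>t'. \<exists>b\<in>cech_faces n 0 \<rightarrow> hcomp H (j + int (t' * 0)).
        H.cochain (Suc 0) m t = H.cochain (Suc 0) (H.koszul t' b) t'"
      by (intro exI[of _ t] bexI[of _ "\<lambda>_. \<zero>\<^bsub>H\<^esub>"]) simp_all
  qed
qed

end

context ideal_hom
begin

text \<open>In the case \<open>1 \<in> I\<close> the ideal has elements of degree \<open>0\<close>, so that the argument below does not
  gain a degree; but then \<open>T = 0\<close>.\<close>

lemma H_coh_trivial_Suc_0:
  assumes triv_0: "\<And>e. j < e \<Longrightarrow> coh_trivial 0 e" and triv_1: "coh_trivial (Suc 0) j"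
  shows "graded_module.coh_trivial n H (Suc 0) j"
proof (cases "1 \<in> I")
  case True
  have "y = \<zero>" if "y \<in> T" for y
    using T_kill[OF that True] T_in_carrier[OF that] by simp
  then have "T = {\<zero>}"
    using T_zero by blast
  then show ?thesis
    by (rule transport.H_coh_trivial_1_of_zero)
next
  case False
  show ?thesis
  proof (rule transport.H_coh_trivial_1[OF triv_1])
    fix y assume y: "y \<in> hcomp M j" and sat: "\<And>a. a < n \<Longrightarrow> \<exists>s. indet a ^ s \<odot> y \<in> T"
    note yc = hcomp_carrier[OF y]
    show "y \<in> T"
    proof (rule T_homogeneous[OF yc])
      fix r d assume r: "r \<in> I" "r \<in> mpoly_hcomp n d"
      have rp: "r \<in> polys n"
        using r(1) by (rule I_polys)
      \<comment> \<open>A non-zero homogeneous element of non-positive degree is a constant, which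
        would put \<open>1\<close> into \<open>I\<close>.\<close>
      consider "0 < d" | "r = 0"
      proof (cases "0 < d")
        case nonpos: False
        have "r = 0"
        proof (rule poly_mapping_eqI, rule ccontr)
          fix m assume m: "Poly_Mapping.lookup r m \<noteq> Poly_Mapping.lookup 0 m"
          then have "int (monomial_degree m) = d"
            using r(2) by (simp add: mpoly_hcomp_def in_keys_iff)
          with nonpos have d: "d = 0"
            by simp
          define c where "c = Poly_Mapping.lookup r 0"
          have r_eq: "r = Poly_Mapping.single 0 c"
            using hpart_0_eq_single[of r] hpart_of_hcomp[OF r(2), of 0] d by (simp add: c_def)
          have "c \<noteq> 0"
            using m by (auto simp: r_eq)
          then have "Poly_Mapping.single 0 (inverse c) * r = 1"
            unfolding r_eq by (simp add: mult_single)
          moreover have "Poly_Mapping.single 0 (inverse c) * r \<in> I"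
            using ideal.I_l_closed[OF ideal r(1), of "Poly_Mapping.single 0 (inverse c)"] by simp
          ultimately show False
            using False by simp
        qed
        then show ?thesis
          by (rule that)
      qed (rule that)
      then show "r \<odot> y = \<zero>"
      proof cases
        case 1
        \<comment> \<open>Some power of the variable moves \<open>y\<close> into \<open>T\<close>,
          where \<open>r\<close> acts as zero; so \<open>r\<close> turns \<open>y\<close> into a
          torsion element, of degree greater than \<open>j\<close>.\<close>
        have "\<exists>s. indet a ^ s \<odot> (r \<odot> y) = \<zero>" if a: "a < n" for a
        proof -
          obtain s where "indet a ^ s \<odot> y \<in> T"
            using sat[OF a] by blast
          then have "r \<odot> (indet a ^ s \<odot> y) = \<zero>"
            using r(1) by (rule T_kill)
          then have "indet a ^ s \<odot> (r \<odot> y) = \<zero>"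
            using a rp yc by (simp add: mult.commute)
          then show ?thesis ..
        qed
        moreover have "r \<odot> y \<in> hcomp M (d + j)"
          using r(2) y by (rule hcomp_smult)
        moreover have "coh_trivial 0 (d + j)"
          using 1 by (intro triv_0) simp
        ultimately show ?thesis
          unfolding coh_trivial_0_iff by blast
      next
        case 2
        then show ?thesis
          using yc by simp
      qed
    qed
  qed
qed

end

theorem corollary1p3:
  fixes n :: nat
    and N :: "('k::field mpoly, 'a) gmodule"
    and I :: "'k mpoly set"
  assumes "graded_module n N"
    and "finitely_generated (mpoly_ring n) N"
    and "homogeneous_ideal n I"
    and "module_dim (mpoly_ring n) (hom_gmodule (mpoly_ring n) (quotient_gmodule n I) N) \<le> 1"
  shows "regularity n (hom_gmodule (mpoly_ring n) (quotient_gmodule n I) N) \<le> regularity n N"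
proof -
  interpret ideal_hom n N I
    using assms(1,3) by (intro ideal_hom.intro ideal_hom_axioms.intro)
  interpret H: graded_module n H
    by (rule transport.H_graded_module)
  \<comment> \<open>Stated in the extended reals, so that the infinite values of the regularity need
    no separate treatment.\<close>
  have triv: "coh_trivial i j" if "regularity n N < ereal (real_of_int (int i + j))" for i j
  proof (rule ccontr)
    assume "\<not> coh_trivial i j"
    then have "ereal (real_of_int (int i + j)) \<le> regularity n N"
      unfolding regularity_def coh_trivial_def
      by (intro Sup_upper CollectI exI[of _ i] exI[of _ j] conjI refl)
    with that show False
      by simp
  qed
  show ?thesis
    unfolding regularity_def[of n H]
  proof (rule Sup_least)
    fix b assume "b \<in> {ereal (real_of_int (int i + j)) | i j.
      carrier (local_cohomology n H i j) \<noteq> {\<one>\<^bsub>local_cohomology n H i j\<^esub>}}"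
    then obtain i j where b: "b = ereal (real_of_int (int i + j))" and nontriv: "\<not> H.coh_trivial i j"
      unfolding H.coh_trivial_def by blast
    show "b \<le> regularity n N"
    proof (rule ccontr)
      assume "\<not> b \<le> regularity n N"
      then have less: "regularity n N < ereal (real_of_int (int i + j))"
        by (simp add: b)
      have "H.coh_trivial i j"
      proof (cases i)
        case 0
        with less have "coh_trivial 0 j"
          by (intro triv) simp
        then show ?thesis
          unfolding 0 by (rule transport.H_coh_trivial_0)
      next
        case (Suc i')
        show ?thesis
        proof (cases i')
          case 0
          have "coh_trivial 0 e" if e: "j < e" for e
          proof (rule triv)
            \<comment> \<open>Here \<open>i = 1\<close> and \<open>e \<ge> j + 1\<close>: the rise
              in internal degree makes up exactly for the drop in cohomological degree.\<close>
            have "real_of_int (int i + j) \<le> real_of_int (int 0 + e)"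
              using e by (simp add: Suc 0)
            with less show "regularity n N < ereal (real_of_int (int 0 + e))"
              by (meson ereal_less_eq(3) less_le_trans)
          qed
          moreover have "coh_trivial (Suc 0) j"
            using less by (intro triv) (simp add: Suc 0)
          ultimately show ?thesis
            unfolding Suc 0 by (rule H_coh_trivial_Suc_0)
        next
          case (Suc i'')
          then show ?thesis
            using H.coh_trivial_dim_le_1[OF assms(4)] \<open>i = Suc i'\<close> by simp
        qed
      qed
      then show False
        using nontriv by simp
    qed
  qed
qed

end
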